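(* Let $H^*$ be a finite-dimensional graded commutative algebra over a field $\mathbb F$ of characteristic zero, and let $A_1=(H^*,\{m_i^{(1)}\})$ and $A_2=(H^*,\{m_i^{(2)}\})$ be two minimal $C_\infty$-algebra enhancements of $H^*$. Then $$A_1\sim_3A_2\quad\Longleftrightarrow\quad[m_3^{(1)}]=[m_3^{(2)}]\ \text{ in }\ \operatorname{Harr}^{3,-1}(H^*,H^* ).$$ Suppose, moreover, that $H^*$ is a Poincar\'e graded commutative algebra and that $A_1$ and $A_2$ are minimal unital cyclic $C_\infty$-algebra enhancements. Under the identification between the normalized cyclic Harrison complex and the normalized Harrison complex induced by the Poincar\'e pairing, $$A_1\sim_3A_2\quad\Longleftrightarrow\quad[Tm_3^{(1)}]=[Tm_3^{(2)}]\ \text{ in }\ HC_{\mathrm{Harr}}^{4,-1}(H^* ).$$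
   Context: $C_{\mathrm{Harr}}^{n,j}(H^*,H^* )$ denotes the space of Harrison cochains: linear maps $(H^* )^{\otimes n}\to H^*$ of internal degree $j$ vanishing on all signed shuffle products of two nonempty tensors (signs with respect to the shifted degrees on $sH$, $(sH)^i=H^{i+1}$). With total degree $n+j-1$, Gerstenhaber bracket $[f,g]=f\circ g-(-1)^{|f||g|}g\circ f$ (after suspension, the commutator of coderivations of $T^c(sH)$), and $\delta=[m_2,-]$ with $m_2$ the multiplication of $H^*$, $\mathfrak g_{H^*}=\prod_{n\ge2}C_{\mathrm{Harr}}^{n,*}(H^*,H^* )$ is a DGLA. $\operatorname{Harr}^{n,j}(H^*,H^* )$ is the cohomology of $\delta$ at $C_{\mathrm{Harr}}^{n,j}$. A minimal $C_\infty$-algebra enhancement of $H^*$ is a $C_\infty$-algebra $(H^*,m_1=0,m_2,m_3,\dots)$ with $m_2$ the given multiplication; equivalently $m=m_3+m_4+\cdots$, $m_n\in C_{\mathrm{Harr}}^{n,2-n}$, satisfies $\delta m+\frac12[m,m]=0$ (so $\delta m_3=0$). A $C_\infty$-isotopy is a $C_\infty$-morphism $\phi=(\phi_1=\mathrm{Id},\phi_2,\dots)$; $\phi(A)$ denotes the structure obtained by transporting $A$ along $\phi$ (the unique one for which $\phi\colon A\to\phi(A)$ is a $C_\infty$-isotopy). $A_1\sim_kA_2$ (isotopic modulo $k$) means that there is a $C_\infty$-isotopy $\phi$ such that the operations of $\phi(A_1)$ and $A_2$ agree in all arities $2\le i\le k$. A Poincar\'e graded commutative algebra of degree $n$ is a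 finite-dimensional unital GCA $H^*=\bigoplus_{k=0}^nH^k$ with $\int\colon H^n\to\mathbb F$ such that $\langle\alpha,\beta\rangle=\int\alpha\beta$ if $|\alpha|+|\beta|=n$, $0$ otherwise, is nondegenerate. A cochain $f$ of arity $k$ is cyclic if $\langle f(x_1,\dots,x_k),x_{k+1}\rangle=(-1)^k(-1)^{|x_1|(|x_2|+\cdots+|x_{k+1}|)}\langle f(x_2,\dots,x_{k+1}),x_1\rangle$ for homogeneous $x_i$, and normalized if it vanishes whenever some input is $1$. A minimal unital cyclic enhancement has all $m_k$ cyclic and $m_k$ normalized for $k\ge3$. For cyclic $f$ of arity $k$, $Tf(x_1,\dots,x_{k+1})=\langle f(x_1,\dots,x_k),x_{k+1}\rangle$; $HC_{\mathrm{Harr}}^{k+1,j}(H^* )$ is the cohomology, at arity $k$ and internal degree $j$, of the complex of cyclic $H^*$-valued Harrison cochains with differential $\delta$, identified with scalar-valued forms via $T$. The second index is the degree inherited from the corresponding $H^*$-valued Harrison cochain. *)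

theory Defs
  imports Complex_Main "HOL-Combinatorics.Permutations"
begin

section \<open>Graded commutative algebras\<close>

definition homogeneous_decomposition ::
  "(int \<Rightarrow> 'v set) \<Rightarrow> 'v \<Rightarrow> (int \<Rightarrow> 'v::ab_group_add) \<Rightarrow> bool" where
  "homogeneous_decomposition H x c \<longleftrightarrow>
     (\<forall>d. c d \<in> H d) \<and> finite {d. c d \<noteq> 0} \<and> x = (\<Sum>d | c d \<noteq> 0. c d)"

text \<open>The whole type \<open>'v\<close> is the total space, the direct sum of the subspaces \<open>H d\<close>.\<close>

locale graded_vector_space = vector_space scale
  for scale :: "'k::field_char_0 \<Rightarrow> 'v::ab_group_add \<Rightarrow> 'v" +
  fixes H :: "int \<Rightarrow> 'v set"
  assumes subspace_component: "subspace (H d)"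
    and direct_sum: "\<exists>!c. homogeneous_decomposition H x c"

locale finite_dim_gca = graded_vector_space scale H
  for scale :: "'k::field_char_0 \<Rightarrow> 'v::ab_group_add \<Rightarrow> 'v" and H +
  fixes mul :: "'v \<Rightarrow> 'v \<Rightarrow> 'v"
  assumes finite_dim: "\<exists>S. finite S \<and> span S = UNIV"
    and mult_linear_right: "Vector_Spaces.linear scale scale (mul x)"
    and mult_linear_left: "Vector_Spaces.linear scale scale (\<lambda>x. mul x y)"
    and mult_assoc: "mul (mul x y) z = mul x (mul y z)"
    and mult_degree: "x \<in> H d \<Longrightarrow> y \<in> H e \<Longrightarrow> mul x y \<in> H (d + e)"
    and mult_graded_commute:
      "x \<in> H d \<Longrightarrow> y \<in> H e \<Longrightarrow>
         mul x y = (if even (d * e) then mul y x else - mul y x)"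

definition hcomp :: "(int \<Rightarrow> 'v set) \<Rightarrow> 'v \<Rightarrow> int \<Rightarrow> 'v::ab_group_add" where
  "hcomp H x = (THE c. homogeneous_decomposition H x c)"

text \<open>\<open>integ\<close> is only relevant on \<open>H n\<close>. Since \<open>mul a b\<close> is homogeneous of degree
  \<open>|a| + |b|\<close> for homogeneous \<open>a\<close>, \<open>b\<close>, taking its component of degree \<open>n\<close> gives
  the bilinear extension of the pairing that vanishes unless \<open>|a| + |b| = n\<close>.\<close>

definition poincare_pairing ::
  "(int \<Rightarrow> 'v set) \<Rightarrow> ('v \<Rightarrow> 'v \<Rightarrow> 'v) \<Rightarrow> nat \<Rightarrow> ('v \<Rightarrow> 'k) \<Rightarrow> 'v::ab_group_add \<Rightarrow> 'v \<Rightarrow> 'k" where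
  "poincare_pairing H mul n integ a b = integ (hcomp H (mul a b) (int n))"

locale poincare_gca = finite_dim_gca scale H mul
  for scale :: "'k::field_char_0 \<Rightarrow> 'v::ab_group_add \<Rightarrow> 'v" and H mul +
  fixes n :: nat and unit :: 'v and integ :: "'v \<Rightarrow> 'k"
  assumes degree_range: "d < 0 \<or> int n < d \<Longrightarrow> H d = {0}"
    and unit_degree: "unit \<in> H 0"
    and unit_left: "mul unit x = x"
    and unit_right: "mul x unit = x"
    and integ_add: "x \<in> H (int n) \<Longrightarrow> y \<in> H (int n) \<Longrightarrow> integ (x + y) = integ x + integ y"
    and integ_scale: "x \<in> H (int n) \<Longrightarrow> integ (scale c x) = c * integ x"
    and nondegenerate: "(\<And>b. poincare_pairing H mul n integ a b = 0) \<Longrightarrow> a = 0"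

section \<open>Harrison cochains\<close>

text \<open>A linear map \<open>H\<^sup>\<otimes>\<^sup>n \<rightarrow> H\<close> is a function on lists that is multilinear on lists of
  length \<open>n\<close> and, by convention, zero on all other lists.\<close>

definition signed :: "int \<Rightarrow> 'a::ab_group_add \<Rightarrow> 'a" where
  "signed e x = (if even e then x else - x)"

definition multilinear ::
  "('k \<Rightarrow> 'v \<Rightarrow> 'v) \<Rightarrow> nat \<Rightarrow> ('v::ab_group_add list \<Rightarrow> 'v) \<Rightarrow> bool" where
  "multilinear scale n f \<longleftrightarrow>
     (\<forall>xs. length xs \<noteq> n \<longrightarrow> f xs = 0) \<and>
     (\<forall>xs ys x y c. length xs + length ys + 1 = n \<longrightarrow>
        f (xs @ (x + y) # ys) = f (xs @ x # ys) + f (xs @ y # ys) \<and>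
        f (xs @ scale c x # ys) = scale c (f (xs @ x # ys)))"

definition homog :: "(int \<Rightarrow> 'v set) \<Rightarrow> int list \<Rightarrow> 'v list \<Rightarrow> bool" where
  "homog H ds xs \<longleftrightarrow> list_all2 (\<lambda>d x. x \<in> H d) ds xs"

definition has_internal_degree ::
  "(int \<Rightarrow> 'v set) \<Rightarrow> nat \<Rightarrow> int \<Rightarrow> ('v list \<Rightarrow> 'v) \<Rightarrow> bool" where
  "has_internal_degree H n j f \<longleftrightarrow>
     (\<forall>ds xs. length xs = n \<longrightarrow> homog H ds xs \<longrightarrow> f xs \<in> H (sum_list ds + j))"

text \<open>The linear operator multiplying a homogeneous \<open>x\<close> by \<open>(-1)^(e * (|x| + s))\<close>.\<close>

definition degree_sign :: "(int \<Rightarrow> 'v set) \<Rightarrow> int \<Rightarrow> int \<Rightarrow> 'v \<Rightarrow> 'v::ab_group_add" where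
  "degree_sign H e s x = (\<Sum>d | hcomp H x d \<noteq> 0. signed (e * (d + s)) (hcomp H x d))"

text \<open>Suspension. Write \<open>s : H \<rightarrow> sH\<close> for the map of degree \<open>-1\<close>, so \<open>|s x| = |x| - 1\<close>. The map
  \<open>F\<close> on \<open>(sH)\<^sup>\<otimes>\<^sup>n\<close> corresponding to \<open>f\<close> is determined by \<open>F \<circ> s\<^sup>\<otimes>\<^sup>n = s \<circ> f\<close>, that is
  \<open>F (s x\<^sub>1, \<dots>, s x\<^sub>n) = (-1)^(\<Sum>i. (n - i) * |x\<^sub>i|) s (f (x\<^sub>1, \<dots>, x\<^sub>n))\<close>. If \<open>f\<close> has internal degree
  \<open>j\<close>, then \<open>F\<close> has degree \<open>n + j - 1\<close>. Elements of \<open>sH\<close> are represented by the underlying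
  elements of \<open>H\<close>. The operator is an involution, so it also serves as desuspension.\<close>

fun koszul_twist :: "(int \<Rightarrow> 'v set) \<Rightarrow> 'v::ab_group_add list \<Rightarrow> 'v list" where
  "koszul_twist H [] = []"
| "koszul_twist H (x # xs) = degree_sign H (int (length xs)) 0 x # koszul_twist H xs"

definition susp ::
  "(int \<Rightarrow> 'v set) \<Rightarrow> ('v list \<Rightarrow> 'v) \<Rightarrow> 'v::ab_group_add list \<Rightarrow> 'v" where
  "susp H f xs = f (koszul_twist H xs)"

text \<open>A \<open>(p,q)\<close>-shuffle \<open>\<sigma>\<close> moves the letter with index \<open>i\<close> to position \<open>\<sigma> i\<close>.\<close>

definition shuffle_perms :: "nat \<Rightarrow> nat \<Rightarrow> (nat \<Rightarrow> nat) set" where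
  "shuffle_perms p q =
     {\<sigma>. \<sigma> permutes {..<p + q} \<and> strict_mono_on {..<p} \<sigma> \<and> strict_mono_on {p..<p + q} \<sigma>}"

definition permuted_word :: "(nat \<Rightarrow> nat) \<Rightarrow> 'a list \<Rightarrow> 'a list" where
  "permuted_word \<sigma> xs = map (\<lambda>k. xs ! inv \<sigma> k) [0..<length xs]"

text \<open>Exponent of the Koszul sign for letters of \<open>sH\<close>; \<open>ds\<close> lists the degrees in \<open>H\<close>.\<close>

definition shifted_koszul_exp :: "(nat \<Rightarrow> nat) \<Rightarrow> int list \<Rightarrow> int" where
  "shifted_koszul_exp \<sigma> ds =
     (\<Sum>(i, j) | i < j \<and> j < length ds \<and> \<sigma> j < \<sigma> i. (ds ! i - 1) * (ds ! j - 1))"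

definition vanishes_on_shuffles ::
  "(int \<Rightarrow> 'v set) \<Rightarrow> nat \<Rightarrow> ('v::ab_group_add list \<Rightarrow> 'v) \<Rightarrow> bool" where
  "vanishes_on_shuffles H n F \<longleftrightarrow>
     (\<forall>p q ds xs. p \<ge> 1 \<longrightarrow> q \<ge> 1 \<longrightarrow> p + q = n \<longrightarrow> length xs = n \<longrightarrow> homog H ds xs \<longrightarrow>
        (\<Sum>\<sigma>\<in>shuffle_perms p q. signed (shifted_koszul_exp \<sigma> ds) (F (permuted_word \<sigma> xs))) = 0)"

definition harrison ::
  "('k \<Rightarrow> 'v \<Rightarrow> 'v) \<Rightarrow> (int \<Rightarrow> 'v set) \<Rightarrow> nat \<Rightarrow> int \<Rightarrow> ('v::ab_group_add list \<Rightarrow> 'v) set" where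
  "harrison scale H n j =
     {f. multilinear scale n f \<and> has_internal_degree H n j f \<and> vanishes_on_shuffles H n (susp H f)}"

section \<open>Gerstenhaber bracket and Harrison cohomology\<close>

text \<open>\<open>insertion H e l F G\<close> is the sum over \<open>r\<close> of \<open>F \<circ> (1\<^sup>\<otimes>\<^sup>r \<otimes> G \<otimes> 1\<^sup>\<otimes>\<^sup>t)\<close> on \<open>T(sH)\<close>, where \<open>G\<close> has
  arity \<open>l\<close> and degree \<open>e\<close>; moving \<open>G\<close> past the first \<open>r\<close> letters gives Koszul signs.\<close>

definition insertion ::
  "(int \<Rightarrow> 'v set) \<Rightarrow> int \<Rightarrow> nat \<Rightarrow> ('v list \<Rightarrow> 'v) \<Rightarrow> ('v list \<Rightarrow> 'v) \<Rightarrow> 'v::ab_group_add list \<Rightarrow> 'v"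
  where
  "insertion H e l F G xs =
     (\<Sum>r | r + l \<le> length xs.
        F (map (degree_sign H e (-1)) (take r xs) @ G (take l (drop r xs)) # drop (r + l) xs))"

text \<open>Bracket of \<open>f\<close> (arity \<open>k\<close>, internal degree \<open>i\<close>) and \<open>g\<close> (arity \<open>l\<close>, internal degree \<open>j\<close>).\<close>

definition gerstenhaber ::
  "(int \<Rightarrow> 'v set) \<Rightarrow> nat \<Rightarrow> int \<Rightarrow> ('v list \<Rightarrow> 'v) \<Rightarrow> nat \<Rightarrow> int \<Rightarrow> ('v list \<Rightarrow> 'v) \<Rightarrow>
     'v::ab_group_add list \<Rightarrow> 'v" where
  "gerstenhaber H k i f l j g =
     (let p = int k + i - 1; q = int l + j - 1 in
      susp H (\<lambda>xs. insertion H q l (susp H f) (susp H g) xs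
                   - signed (p * q) (insertion H p k (susp H g) (susp H f) xs)))"

definition mult_cochain :: "('v \<Rightarrow> 'v \<Rightarrow> 'v) \<Rightarrow> 'v::ab_group_add list \<Rightarrow> 'v" where
  "mult_cochain mul xs = (if length xs = 2 then mul (xs ! 0) (xs ! 1) else 0)"

definition harrison_d ::
  "(int \<Rightarrow> 'v set) \<Rightarrow> ('v \<Rightarrow> 'v \<Rightarrow> 'v) \<Rightarrow> nat \<Rightarrow> int \<Rightarrow> ('v list \<Rightarrow> 'v) \<Rightarrow> 'v::ab_group_add list \<Rightarrow> 'v"
  where
  "harrison_d H mul n j f = gerstenhaber H 2 0 (mult_cochain mul) n j f"

text \<open>\<open>Harr\<^sup>n\<^sup>,\<^sup>j\<close> is the quotient of the cocycles by the relation \<open>harrison_rel\<close>; the class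
  of a cocycle is its equivalence class.\<close>

definition harrison_cocycles where
  "harrison_cocycles scale H mul n j =
     {f \<in> harrison scale H n j. harrison_d H mul n j f = (\<lambda>_. 0)}"

definition harrison_coboundaries where
  "harrison_coboundaries scale H mul n j =
     harrison_d H mul (n - 1) j ` harrison scale H (n - 1) j"

definition harrison_rel where
  "harrison_rel scale H mul n j =
     {(f, g). f \<in> harrison_cocycles scale H mul n j \<and> g \<in> harrison_cocycles scale H mul n j \<and>
              (\<lambda>xs. f xs - g xs) \<in> harrison_coboundaries scale H mul n j}"

definition harrison_class where
  "harrison_class scale H mul n j f = harrison_rel scale H mul n j `` {f}"

section \<open>\<open>C\<^sub>\<infinity>\<close>-algebras, morphisms and isotopies\<close>

text \<open>Operations are indexed by arity; index \<open>0\<close> is a dummy. Each suspended operation has degree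
  \<open>1\<close>, and the relations say that the induced coderivation of \<open>T\<^sup>c(sH)\<close> squares to zero.\<close>

definition C_inf_algebra ::
  "('k \<Rightarrow> 'v \<Rightarrow> 'v) \<Rightarrow> (int \<Rightarrow> 'v set) \<Rightarrow> (nat \<Rightarrow> 'v::ab_group_add list \<Rightarrow> 'v) \<Rightarrow> bool" where
  "C_inf_algebra scale H m \<longleftrightarrow>
     m 0 = (\<lambda>_. 0) \<and>
     (\<forall>n\<ge>1. m n \<in> harrison scale H n (2 - int n)) \<and>
     (\<forall>xs. (\<Sum>l=1..length xs.
        insertion H 1 l (susp H (m (length xs + 1 - l))) (susp H (m l)) xs) = 0)"

definition minimal_enhancement ::
  "('k \<Rightarrow> 'v \<Rightarrow> 'v) \<Rightarrow> (int \<Rightarrow> 'v set) \<Rightarrow> ('v \<Rightarrow> 'v \<Rightarrow> 'v) \<Rightarrow>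
     (nat \<Rightarrow> 'v::ab_group_add list \<Rightarrow> 'v) \<Rightarrow> bool" where
  "minimal_enhancement scale H mul m \<longleftrightarrow>
     C_inf_algebra scale H m \<and> m 1 = (\<lambda>_. 0) \<and> m 2 = mult_cochain mul"

fun blocks :: "nat list \<Rightarrow> 'a list \<Rightarrow> 'a list list" where
  "blocks [] xs = []"
| "blocks (i # is) xs = take i xs # blocks is (drop i xs)"

text \<open>The components of a morphism have degree \<open>0\<close> after suspension, so the tensor products
  \<open>\<phi>\<^bsub>i1\<^esub> \<otimes> \<dots> \<otimes> \<phi>\<^bsub>ik\<^esub>\<close>, indexed by the compositions \<open>(i1, \<dots>, ik)\<close> of the number of inputs, carry
  no further signs.\<close>

definition C_inf_morphism ::
  "('k \<Rightarrow> 'v \<Rightarrow> 'v) \<Rightarrow> (int \<Rightarrow> 'v set) \<Rightarrow> (nat \<Rightarrow> 'v list \<Rightarrow> 'v) \<Rightarrow> (nat \<Rightarrow> 'v list \<Rightarrow> 'v) \<Rightarrow>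
     (nat \<Rightarrow> 'v::ab_group_add list \<Rightarrow> 'v) \<Rightarrow> bool" where
  "C_inf_morphism scale H A B \<phi> \<longleftrightarrow>
     C_inf_algebra scale H A \<and> C_inf_algebra scale H B \<and>
     (\<forall>n\<ge>1. \<phi> n \<in> harrison scale H n (1 - int n)) \<and>
     (\<forall>xs. xs \<noteq> [] \<longrightarrow>
        (\<Sum>l=1..length xs.
           insertion H 1 l (susp H (\<phi> (length xs + 1 - l))) (susp H (A l)) xs) =
        (\<Sum>c | sum_list c = length xs \<and> 0 \<notin> set c.
           susp H (B (length c)) (map (\<lambda>ys. susp H (\<phi> (length ys)) ys) (blocks c xs))))"

definition C_inf_isotopy where
  "C_inf_isotopy scale H A B \<phi> \<longleftrightarrow>
     C_inf_morphism scale H A B \<phi> \<and> \<phi> 1 = (\<lambda>xs. if length xs = 1 then hd xs else 0)"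

definition transport where
  "transport scale H \<phi> A = (THE B. C_inf_isotopy scale H A B \<phi>)"

definition isotopic_mod ::
  "('k \<Rightarrow> 'v \<Rightarrow> 'v) \<Rightarrow> (int \<Rightarrow> 'v set) \<Rightarrow> nat \<Rightarrow> (nat \<Rightarrow> 'v list \<Rightarrow> 'v) \<Rightarrow>
     (nat \<Rightarrow> 'v::ab_group_add list \<Rightarrow> 'v) \<Rightarrow> bool" where
  "isotopic_mod scale H k A1 A2 \<longleftrightarrow>
     (\<exists>\<phi>. C_inf_isotopy scale H A1 (transport scale H \<phi> A1) \<phi> \<and>
          (\<forall>i\<in>{2..k}. transport scale H \<phi> A1 i = A2 i))"

section \<open>Cyclic cochains\<close>

definition cyclic_form ::
  "('v \<Rightarrow> 'v \<Rightarrow> 'k) \<Rightarrow> ('v list \<Rightarrow> 'v) \<Rightarrow> 'v list \<Rightarrow> 'k" where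
  "cyclic_form pairing f xs = pairing (f (butlast xs)) (last xs)"

definition cyclic_cochain ::
  "(int \<Rightarrow> 'v set) \<Rightarrow> ('v \<Rightarrow> 'v \<Rightarrow> 'k::field_char_0) \<Rightarrow> nat \<Rightarrow> ('v list \<Rightarrow> 'v) \<Rightarrow> bool" where
  "cyclic_cochain H pairing k f \<longleftrightarrow>
     (\<forall>d ds x xs. length xs = k \<longrightarrow> x \<in> H d \<longrightarrow> homog H ds xs \<longrightarrow>
        cyclic_form pairing f (x # xs) =
        signed (int k + d * sum_list ds) (cyclic_form pairing f (xs @ [x])))"

definition normalized_cochain :: "'v \<Rightarrow> ('v list \<Rightarrow> 'v::ab_group_add) \<Rightarrow> bool" where
  "normalized_cochain unit f \<longleftrightarrow> (\<forall>xs. unit \<in> set xs \<longrightarrow> f xs = 0)"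

definition minimal_unital_cyclic_enhancement where
  "minimal_unital_cyclic_enhancement scale H mul unit pairing m \<longleftrightarrow>
     minimal_enhancement scale H mul m \<and>
     (\<forall>k\<ge>1. cyclic_cochain H pairing k (m k)) \<and>
     (\<forall>k\<ge>3. normalized_cochain unit (m k))"

definition cyclic_harrison where
  "cyclic_harrison scale H pairing k j =
     {f \<in> harrison scale H k j. cyclic_cochain H pairing k f}"

text \<open>In \<open>HC\<^sup>N\<^sup>,\<^sup>j\<close> the index \<open>N\<close> is the number of arguments of the scalar-valued form, one more than the
  arity of the cochain, and \<open>j\<close> is the internal degree of the cochain. The complex of forms is the
  image of the complex of cyclic Harrison cochains under \<open>cyclic_form\<close>.\<close>

definition HC_cocycles where
  "HC_cocycles scale H mul pairing N j =
     cyclic_form pairing `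
       {f \<in> cyclic_harrison scale H pairing (N - 1) j. harrison_d H mul (N - 1) j f = (\<lambda>_. 0)}"

definition HC_coboundaries where
  "HC_coboundaries scale H mul pairing N j =
     (\<lambda>g. cyclic_form pairing (harrison_d H mul (N - 2) j g)) `
       cyclic_harrison scale H pairing (N - 2) j"

definition HC_rel where
  "HC_rel scale H mul pairing N j =
     {(\<omega>, \<theta>). \<omega> \<in> HC_cocycles scale H mul pairing N j \<and> \<theta> \<in> HC_cocycles scale H mul pairing N j \<and>
              (\<lambda>xs. \<omega> xs - \<theta> xs) \<in> HC_coboundaries scale H mul pairing N j}"

definition HC_class where
  "HC_class scale H mul pairing N j \<omega> = HC_rel scale H mul pairing N j `` {\<omega>}"

end

theory Submission
  imports Defs
begin

text \<open>
  The idea of the first equivalence is that, for an isotopy with components \<open>\<phi>\<^sub>1 = id\<close> and \<open>\<phi>\<^sub>2\<close>,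
  the morphism equation in arity three says exactly that the old and the new \<open>m\<^sub>3\<close> differ by
  \<open>\<delta>\<phi>\<^sub>2\<close>. This gives one direction at once (\<open>isotopy_imp_coboundary\<close>). For the other one, a
  Harrison cochain \<open>g\<close> with \<open>\<delta>g = m\<^sub>3 - m\<^sub>3'\<close> has to be realised by an isotopy, and the isotopy
  \<open>(id, g, 0, 0, \<dots>)\<close> does it. What needs proof is that the structure transported along it exists in
  all arities and is again a \<open>C\<^sub>\<infinity>\<close>-structure (\<open>transported_isotopy\<close>). On \<open>T\<^sup>c(sH)\<close> the argument
  is the usual one. The isotopy is an invertible coalgebra map \<open>\<Phi>\<close>, the algebra is a coderivation
  \<open>D\<close>, and the transported structure is \<open>\<Phi>D\<Phi>\<^sup>-\<^sup>1\<close>, which squares to zero. Since \<open>\<Phi>\<close> is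
  multiplicative and \<open>D\<close> is a derivation for the shuffle product, \<open>\<Phi>D\<Phi>\<^sup>-\<^sup>1\<close> is a derivation too,
  so its components vanish on shuffles.

  All of this is done on the dual side. Instead of tensors there are functions of words, and an
  operator \<open>\<Lambda>\<close> on \<open>T\<^sup>c(sH)\<close> is represented by the pullback \<open>F \<mapsto> F \<circ> \<Lambda>\<close> of such functions,
  which has a simple recursion on words: \<open>split_sum\<close> for deconcatenation, \<open>morph\<close> for \<open>\<Phi>\<close>,
  \<open>coder\<close> for \<open>D\<close>, \<open>shuf\<close> for the signed shuffle product. The structural facts then read
  \<open>morph_split_sum\<close> and \<open>coder_split_sum\<close> (coalgebra map, coderivation), \<open>shuf_morph\<close> and
  \<open>shuf_coder\<close> (compatibility with shuffles), \<open>morph_coder\<close> (\<open>\<Phi>\<close> intertwines the two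
  coderivations as soon as this holds after projection to letters) and \<open>coder_coder\<close>
  (\<open>D\<^sup>2 = 0\<close> as soon as its projection to letters vanishes).

  For the second equivalence it remains to see that a cyclic normalized coboundary \<open>c = \<delta>g\<close> is the
  coboundary of a cyclic cochain (\<open>cyclic_representative\<close>). Cyclicity moves the unit of
  \<open>\<integral> c(x,y,z)\<cdot>1\<close> into an input of \<open>c\<close>, so \<open>\<integral> c(x,y,z) = 0\<close>. If moreover
  \<open>\<integral> g(u,v) = 0\<close> for all \<open>u\<close>, \<open>v\<close>, then only two of the four terms of \<open>\<integral> \<delta>g(x,y,z)\<close>
  survive, and they say that \<open>g\<close> is cyclic. The condition \<open>\<integral> g = 0\<close> can be achieved: let \<open>h\<close> be
  the map with \<open>\<langle>h u, v\<rangle> = - \<integral> g(u,v) / 2\<close>, which exists because the pairing is nondegenerate,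
  and add to \<open>g\<close> the cocycle measuring the failure of \<open>h\<close> to be a derivation.
\<close>

section \<open>Pullbacks of operators on the tensor coalgebra\<close>

text \<open>Pullback of the deconcatenation coproduct.\<close>

fun split_sum :: "('a list \<Rightarrow> 'a list \<Rightarrow> 'w::ab_group_add) \<Rightarrow> 'a list \<Rightarrow> 'w" where
  "split_sum K [] = K [] []"
| "split_sum K (a # w) = K [] (a # w) + split_sum (\<lambda>u v. K (a # u) v) w"

text \<open>
  Pullback along the coalgebra map \<open>\<Phi>\<close> with components \<open>id\<close>, \<open>f\<close>, \<open>0\<close>, \<open>0\<close>, \<open>\<dots>\<close>: the first
  letter is either kept or merged with the second one. Two components are enough to realise every
  coboundary, and the short recursion is what makes the inductions below work.
\<close>

fun morph :: "('a \<Rightarrow> 'a \<Rightarrow> 'a) \<Rightarrow> ('a list \<Rightarrow> 'w::ab_group_add) \<Rightarrow> 'a list \<Rightarrow> 'w" where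
  "morph f F [] = F []"
| "morph f F [a] = F [a]"
| "morph f F (a # b # w) = morph f (\<lambda>u. F (a # u)) (b # w) + morph f (\<lambda>u. F (f a b # u)) w"

text \<open>
  Pullback along the coderivation with components \<open>A\<close>, where \<open>t\<close> is the sign operator picked up by
  a letter when \<open>A\<close> passes it. The empty subword is also inserted, with the value \<open>A []\<close>; in the
  applications this value is zero, and allowing it keeps the recursion free of case distinctions.
\<close>

fun coder :: "('a \<Rightarrow> 'a) \<Rightarrow> ('a list \<Rightarrow> 'a) \<Rightarrow> ('a list \<Rightarrow> 'w::ab_group_add) \<Rightarrow> 'a list \<Rightarrow> 'w" where
  "coder t A F [] = F [A []]"
| "coder t A F (a # w) = split_sum (\<lambda>u v. F (A u # v)) (a # w) + coder t A (\<lambda>u. F (t a # u)) w"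

text \<open>
  The operators considered here are finite signed sums of evaluations. Additivity in the function is
  all that is needed to exchange two of them, which is the content of the lemmas ending in \<open>_op\<close>.
\<close>

definition additive_op :: "(('i \<Rightarrow> 'w::ab_group_add) \<Rightarrow> 'x::ab_group_add) \<Rightarrow> bool" where
  "additive_op L \<longleftrightarrow> (\<forall>F G. L (\<lambda>i. F i + G i) = L F + L G)"

lemma additive_opD: "additive_op L \<Longrightarrow> L (\<lambda>i. F i + G i) = L F + L G"
  unfolding additive_op_def by blast

lemma additive_op_zero: "additive_op L \<Longrightarrow> L (\<lambda>i. 0) = 0"
  using additive_opD[of L "\<lambda>i. 0" "\<lambda>i. 0"] by simp

lemma additive_op_minus: "additive_op L \<Longrightarrow> L (\<lambda>i. - F i) = - L F"
  using additive_opD[of L F "\<lambda>i. - F i"] additive_op_zero[of L]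
  by (simp add: eq_neg_iff_add_eq_0 add.commute)

lemma signed_zero [simp]: "signed e 0 = 0" and signed_add: "signed e (x + y) = signed e x + signed e y"
  and signed_0 [simp]: "signed 0 x = x"
  by (auto simp: signed_def)

lemma signed_signed [simp]: "signed e (signed e' x) = signed (e + e') x"
  by (auto simp: signed_def)

lemma signed_cong: "even e = even e' \<Longrightarrow> signed e x = signed e' x"
  by (auto simp: signed_def)

lemma additive_op_signed: "additive_op L \<Longrightarrow> L (\<lambda>i. signed e (F i)) = signed e (L F)"
  by (simp add: signed_def additive_op_minus)

lemma split_sum_op: "additive_op L \<Longrightarrow> split_sum (\<lambda>u v. L (M u v)) w = L (\<lambda>i. split_sum (\<lambda>u v. M u v i) w)"
  by (induction w arbitrary: M) (simp_all add: additive_opD[symmetric])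

lemma morph_op: "additive_op L \<Longrightarrow> morph f (\<lambda>u. L (M u)) w = L (\<lambda>i. morph f (\<lambda>u. M u i) w)"
  by (induction w arbitrary: M rule: induct_list012) (simp_all add: additive_opD[symmetric])

lemma coder_op: "additive_op L \<Longrightarrow> coder t A (\<lambda>u. L (M u)) w = L (\<lambda>i. coder t A (\<lambda>u. M u i) w)"
  by (induction w arbitrary: M)
    (simp_all add: additive_opD[symmetric] split_sum_op[where L = L] del: split_sum.simps)

lemma split_sum_add: "split_sum (\<lambda>u v. K u v + K' u v) w = split_sum K w + split_sum K' w"
  by (induction w arbitrary: K K') (simp_all add: algebra_simps)

lemma morph_add: "morph f (\<lambda>u. F u + G u) w = morph f F w + morph f G w"
  by (induction w arbitrary: F G rule: induct_list012) (simp_all add: algebra_simps)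

lemma coder_add: "coder t A (\<lambda>u. F u + G u) w = coder t A F w + coder t A G w"
  by (induction w arbitrary: F G) (simp_all add: algebra_simps split_sum_add)

lemma additive_op_morph: "additive_op (\<lambda>F. morph f F w)"
  and additive_op_coder: "additive_op (\<lambda>F. coder t A F w)"
  by (simp_all add: additive_op_def morph_add coder_add)

lemma additive_op_fun: "(\<And>x y. L (x + y) = L x + L y) \<Longrightarrow> additive_op (\<lambda>F. L (F ()))"
  by (simp add: additive_op_def)

lemma split_sum_cong: "(\<And>u v. u @ v = w \<Longrightarrow> K u v = K' u v) \<Longrightarrow> split_sum K w = split_sum K' w"
proof (induction w arbitrary: K K')
  case (Cons a w)
  have "split_sum (\<lambda>u v. K (a # u) v) w = split_sum (\<lambda>u v. K' (a # u) v) w"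
    by (rule Cons.IH) (simp add: Cons.prems)
  then show ?case by (simp add: Cons.prems)
qed simp

lemma split_sum_zero: "(\<And>u v. u @ v = w \<Longrightarrow> K u v = 0) \<Longrightarrow> split_sum K w = 0"
  using split_sum_cong[of w K "\<lambda>_ _. 0"] split_sum_add[of "\<lambda>_ _. 0" "\<lambda>_ _. 0" w] by simp

lemma split_sum_neg: "split_sum (\<lambda>u v. - K u v) w = - split_sum K w"
  by (induction w arbitrary: K) simp_all

lemma split_sum_map: "split_sum K (map t w) = split_sum (\<lambda>u v. K (map t u) (map t v)) w"
  by (induction w arbitrary: K) simp_all

lemma split_sum_coassoc:
  "split_sum (\<lambda>u s. split_sum (\<lambda>v z. M u v z) s) w = split_sum (\<lambda>s z. split_sum (\<lambda>u v. M u v z) s) w"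
  by (induction w arbitrary: M) (simp_all add: algebra_simps split_sum_add)

lemma split_sum_last: "(\<And>u v. u @ v = w \<Longrightarrow> v \<noteq> [] \<Longrightarrow> K u v = 0) \<Longrightarrow> split_sum K w = K w []"
proof (induction w arbitrary: K)
  case (Cons a w)
  have "split_sum (\<lambda>u v. K (a # u) v) w = K (a # w) []"
    by (rule Cons.IH) (simp add: Cons.prems)
  then show ?case by (simp add: Cons.prems)
qed simp

lemma morph_cong: "(\<And>u. length u \<le> length w \<Longrightarrow> F u = G u) \<Longrightarrow> morph f F w = morph f G w"
proof (induction w arbitrary: F G rule: induct_list012)
  case (3 a b w)
  have "morph f (\<lambda>u. F (a # u)) (b # w) = morph f (\<lambda>u. G (a # u)) (b # w)"
    "morph f (\<lambda>u. F (f a b # u)) w = morph f (\<lambda>u. G (f a b # u)) w"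
    by (rule 3; simp add: 3)+
  then show ?case by simp
qed simp_all

lemma morph_ne_cong: "(\<And>u. u \<noteq> [] \<Longrightarrow> F u = G u) \<Longrightarrow> w \<noteq> [] \<Longrightarrow> morph f F w = morph f G w"
  by (cases w rule: remdups_adj.cases) simp_all

lemma coder_ne_cong: "(\<And>u. u \<noteq> [] \<Longrightarrow> F u = G u) \<Longrightarrow> coder t A F w = coder t A G w"
  by (cases w) simp_all

text \<open>
  \<open>\<Phi>\<close> never lengthens a word and turns letters satisfying \<open>P\<close> into letters satisfying \<open>P\<close>.
\<close>

lemma morph_vanish:
  assumes "\<And>a b. P a \<Longrightarrow> P b \<Longrightarrow> P (f a b)"
  shows "list_all P w \<Longrightarrow> w \<noteq> [] \<Longrightarrow>
    (\<And>u. u \<noteq> [] \<Longrightarrow> list_all P u \<Longrightarrow> length u \<le> length w \<Longrightarrow> F u = 0) \<Longrightarrow> morph f F w = 0"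
proof (induction w arbitrary: F rule: induct_list012)
  case (3 a b w)
  have "morph f (\<lambda>u. F (a # u)) (b # w) = 0"
    by (rule 3(2)) (use 3(3,5) in auto)
  moreover have "morph f (\<lambda>u. F (f a b # u)) w = 0"
  proof (cases "w = []")
    case False
    show ?thesis
      by (rule 3(1)) (use 3(3,5) False assms in auto)
  qed (use 3(3,5) assms in auto)
  ultimately show ?case by simp
qed auto

text \<open>
  \<open>\<Phi>\<close> is the identity plus terms of smaller length. This unitriangularity gives invertibility of
  \<open>\<Phi>\<close>, and it lets inductions on length pass from \<open>F \<circ> \<Phi>\<close> to \<open>F\<close>.
\<close>

lemma morph_leading:
  assumes "\<And>a b. P a \<Longrightarrow> P b \<Longrightarrow> P (f a b)"
  shows "list_all P w \<Longrightarrow>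
    (\<And>u. u \<noteq> [] \<Longrightarrow> list_all P u \<Longrightarrow> length u < length w \<Longrightarrow> F u = 0) \<Longrightarrow> morph f F w = F w"
proof (induction w arbitrary: F rule: induct_list012)
  case (3 a b w)
  have "morph f (\<lambda>u. F (a # u)) (b # w) = F (a # b # w)"
    by (rule 3(2)) (use 3(3,4) in auto)
  moreover have "morph f (\<lambda>u. F (f a b # u)) w = 0"
  proof (cases "w = []")
    case False
    show ?thesis
      by (rule morph_vanish[where P = P]) (use 3(3,4) False assms in auto)
  qed (use 3(3,4) assms in auto)
  ultimately show ?case by simp
qed auto

text \<open>
  The pulled back form of \<open>\<Delta>\<Phi> = (\<Phi> \<otimes> \<Phi>)\<Delta>\<close>.
\<close>

lemma morph_split_sum: "morph f (split_sum K) w = split_sum (\<lambda>u v. morph f (\<lambda>u'. morph f (K u') v) u) w"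
proof (induction w arbitrary: K rule: induct_list012)
  case (3 a b w)
  show ?case
    using 3(1)[of "\<lambda>u. K (f a b # u)"] 3(2)[of "\<lambda>u. K (a # u)"]
    by (simp add: morph_add split_sum_add algebra_simps)
qed simp_all

text \<open>
  The pulled back form of \<open>\<Delta>D = (D \<otimes> 1 + t \<otimes> D)\<Delta>\<close>: the inserted block lies on one side of the
  cut, and if it lies on the right, all letters on the left are passed.
\<close>

lemma coder_split_sum:
  "coder t A (split_sum K) w =
     split_sum (\<lambda>u v. coder t A (\<lambda>u'. K u' v) u + coder t A (\<lambda>v'. K (map t u) v') v) w"
proof (induction w arbitrary: K)
  case Nil
  show ?case by simp
next
  case (Cons a w)
  have "coder t A (split_sum K) (a # w) =
    split_sum (\<lambda>u v. K [] (A u # v)) (a # w) + split_sum (\<lambda>u s. split_sum (\<lambda>v z. K (A u # v) z) s) (a # w)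
    + (coder t A (\<lambda>u. K [] (t a # u)) w + coder t A (split_sum (\<lambda>u v. K (t a # u) v)) w)"
    by (simp add: split_sum_add coder_add algebra_simps)
  also have "split_sum (\<lambda>u s. split_sum (\<lambda>v z. K (A u # v) z) s) (a # w) =
     split_sum (\<lambda>s z. split_sum (\<lambda>u v. K (A u # v) z) s) (a # w)"
    by (rule split_sum_coassoc)
  finally show ?case by (simp add: Cons split_sum_add algebra_simps)
qed

section \<open>The signed shuffle product\<close>

text \<open>
  For the shuffle product the letters carry their degree in \<open>sH\<close> explicitly, because the zero
  vector is homogeneous of every degree and a degree function on vectors would not be additive.
\<close>

definition word_deg :: "(int \<times> 'v) list \<Rightarrow> int" where
  "word_deg w = sum_list (map fst w)"

lemma word_deg_simps [simp]: "word_deg [] = 0" "word_deg (a # w) = fst a + word_deg w"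
  "word_deg (u @ v) = word_deg u + word_deg v"
  by (simp_all add: word_deg_def)

text \<open>
  The value of \<open>F\<close> on the signed shuffle product of two words. The Koszul sign arises when the
  first letter of the second word is moved in front of the whole first word.
\<close>

fun shuf :: "('v list \<Rightarrow> 'w::ab_group_add) \<Rightarrow> (int \<times> 'v) list \<Rightarrow> (int \<times> 'v) list \<Rightarrow> 'w" where
  "shuf F [] y = F (map snd y)"
| "shuf F (a # x) [] = F (map snd (a # x))"
| "shuf F (a # x) (b # y) = shuf (\<lambda>u. F (snd a # u)) x (b # y)
     + signed (fst b * (fst a + word_deg x)) (shuf (\<lambda>u. F (snd b # u)) (a # x) y)"

lemma shuf_Nil2 [simp]: "shuf F x [] = F (map snd x)"
  by (cases x) simp_all

lemma shuf_add: "shuf (\<lambda>u. F u + G u) x y = shuf F x y + shuf G x y"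
  by (induction x y arbitrary: F G rule: shuffles.induct) (simp_all add: signed_add algebra_simps)

lemma shuf_op: "additive_op L \<Longrightarrow> shuf (\<lambda>u. L (M u)) x y = L (\<lambda>i. shuf (\<lambda>u. M u i) x y)"
  by (induction x y arbitrary: M rule: shuffles.induct)
    (simp_all add: additive_opD[symmetric] additive_op_signed[symmetric])

lemma shuf_fun:
  assumes "\<And>x y. L (x + y) = L x + L y"
  shows "shuf (\<lambda>u. L (F u)) x y = L (shuf F x y)"
  using shuf_op[OF additive_op_fun[of L], of "\<lambda>u _. F u" x y] assms by simp

lemma split_sum_fun:
  assumes "\<And>x y. L (x + y) = L x + L y"
  shows "split_sum (\<lambda>u v. L (F u v)) x = L (split_sum F x)"
  using split_sum_op[OF additive_op_fun[of L], of "\<lambda>u v _. F u v" x] assms by simp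

lemma signed_split_sum: "signed e (split_sum K w) = split_sum (\<lambda>u v. signed e (K u v)) w"
  by (rule split_sum_fun[symmetric]) (rule signed_add)

lemma shuf_signed: "shuf (\<lambda>u. signed e (F u)) x y = signed e (shuf F x y)"
  by (rule shuf_fun) (rule signed_add)

text \<open>
  Deconcatenation is multiplicative for the shuffle product: cutting a shuffle of \<open>x\<close> and \<open>y\<close> cuts
  \<open>x\<close> and \<open>y\<close>. The sign comes from moving the initial part of \<open>y\<close> past the final part of \<open>x\<close>.
\<close>

lemma shuf_split_sum:
  "shuf (split_sum K) x y = split_sum (\<lambda>x1 x2. split_sum (\<lambda>y1 y2.
     signed (word_deg y1 * word_deg x2) (shuf (\<lambda>u. shuf (K u) x2 y2) x1 y1)) y) x"
proof (induction x y arbitrary: K rule: shuffles.induct)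
  case (1 y)
  show ?case by (simp add: split_sum_map)
next
  case (2 x)
  show ?case by (simp add: split_sum_map)
next
  case (3 a x b y)
  let ?s = "fst b * (fst a + word_deg x)"
  let ?Ka = "\<lambda>u v. K (snd a # u) v" and ?Kb = "\<lambda>u v. K (snd b # u) v"
  have 1: "shuf (split_sum K) (a # x) (b # y) = shuf (K []) (a # x) (b # y)
     + shuf (split_sum ?Ka) x (b # y) + signed ?s (shuf (split_sum ?Kb) (a # x) y)"
    by (simp add: shuf_add signed_add algebra_simps)
  have 2: "signed ?s (shuf (split_sum ?Kb) (a # x) y) =
     split_sum (\<lambda>y1 y2. signed (word_deg (b # y1) * word_deg (a # x)) (shuf (K (map snd (b # y1))) (a # x) y2)) y
     + split_sum (\<lambda>x1 x2. split_sum (\<lambda>y1 y2. signed (word_deg (b # y1) * word_deg x2 + fst b * (fst a + word_deg x1))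
         (shuf (\<lambda>u. shuf (?Kb u) x2 y2) (a # x1) y1)) y) x"
    unfolding 3(2) split_sum.simps signed_add signed_split_sum signed_signed
    by (intro arg_cong2[where f = "(+)"] split_sum_cong) (auto simp: algebra_simps)
  have 3: "shuf (split_sum ?Ka) x (b # y) =
     split_sum (\<lambda>x1 x2. shuf (K (map snd (a # x1))) x2 (b # y)) x
     + split_sum (\<lambda>x1 x2. split_sum (\<lambda>y1 y2. signed (word_deg (b # y1) * word_deg x2)
         (shuf (\<lambda>u. shuf (?Ka u) x2 y2) x1 (b # y1))) y) x"
    unfolding 3(1) by (simp add: split_sum_add)
  show ?case
    unfolding 1 2 3 
    by (simp add: split_sum_add signed_add algebra_simps)
qed

text \<open>
  Tensors are only present through functions on words, so linear relations between letters can be used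
  only for functions that are additive in each letter.
\<close>

definition multiadd :: "('v::ab_group_add list \<Rightarrow> 'w::ab_group_add) \<Rightarrow> bool" where
  "multiadd F \<longleftrightarrow> (\<forall>xs ys x y. F (xs @ (x + y) # ys) = F (xs @ x # ys) + F (xs @ y # ys))"

lemma multiadd_Cons: "multiadd F \<Longrightarrow> multiadd (\<lambda>u. F (a # u))"
  unfolding multiadd_def by (metis append_Cons)

lemma multiadd_hd: "multiadd F \<Longrightarrow> F ((x + y) # u) = F (x # u) + F (y # u)"
  unfolding multiadd_def by (metis append_Nil)

lemma multiadd_hd_zero: "multiadd F \<Longrightarrow> F (0 # u) = 0"
  using multiadd_hd[of F 0 0 u] by simp

lemma multiadd_hd_signed: "multiadd F \<Longrightarrow> F (signed e x # u) = signed e (F (x # u))"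
  using multiadd_hd[of F x "- x" u] multiadd_hd_zero[of F u]
  by (auto simp: signed_def eq_neg_iff_add_eq_0 add.commute)

lemma multiadd_map_signed:
  assumes "multiadd F" "\<forall>(e, v) \<in> set x. t v = signed e v"
  shows "F (map t (map snd x)) = signed (word_deg x) (F (map snd x))"
  using assms
proof (induction x arbitrary: F)
  case (Cons a x)
  obtain e v where a: "a = (e, v)" by force
  have "F (map t (map snd (a # x))) = signed e (F (v # map t (map snd x)))"
    using Cons.prems a by (simp add: multiadd_hd_signed)
  also have "F (v # map t (map snd x)) = signed (word_deg x) (F (v # map snd x))"
    using Cons.IH[of "\<lambda>u. F (v # u)"] Cons.prems by (simp add: multiadd_Cons)
  finally show ?case by (simp add: a)
qed simp

definition on_letter where "on_letter t a = (fst a, t (snd a))"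

lemma on_letter_simps [simp]: "fst (on_letter t a) = fst a" "snd (on_letter t a) = t (snd a)"
  "map snd (map (on_letter t) x) = map t (map snd x)"
  by (simp_all add: on_letter_def)

lemma word_deg_map_snd [simp]: "word_deg (map (on_letter t) x) = word_deg x"
  by (induction x) auto

lemma shuf_map_signed:
  assumes "multiadd F" "\<forall>(e, v) \<in> set x. t v = signed e v"
  shows "shuf F (map (on_letter t) x) y = signed (word_deg x) (shuf F x y)"
  using assms
proof (induction x y arbitrary: F rule: shuffles.induct)
  case (2 x)
  then show ?case
    using multiadd_map_signed[of F x t] by (simp del: map_map)
next
  case (3 a x b y)
  obtain e v where a: "a = (e, v)" by force
  have tv: "t v = signed e v" using 3(4) a by simp
  have IH1: "shuf (\<lambda>u. F (v # u)) (map (on_letter t) x) (b # y) =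
      signed (word_deg x) (shuf (\<lambda>u. F (v # u)) x (b # y))"
    using 3(1) 3(3,4) a by (simp add: multiadd_Cons)
  have IH2: "shuf (\<lambda>u. F (snd b # u)) (map (on_letter t) (a # x)) y =
      signed (word_deg (a # x)) (shuf (\<lambda>u. F (snd b # u)) (a # x) y)"
    using 3(2) 3(3,4) a by (simp add: multiadd_Cons)
  have "(\<lambda>u. F (t v # u)) = (\<lambda>u. signed e (F (v # u)))"
    using 3(3) tv by (simp add: multiadd_hd_signed)
  then have "shuf (\<lambda>u. F (t v # u)) (map (on_letter t) x) (b # y) =
      signed (e + word_deg x) (shuf (\<lambda>u. F (v # u)) x (b # y))"
    using IH1 by (simp add: shuf_signed)
  with IH2 show ?case by (simp add: a signed_add algebra_simps)
qed simp

lemma signed_morph: 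
  assumes "\<And>a b. fst (g a b) = fst a + fst b"
  shows "morph g (\<lambda>u. signed (c + k * word_deg u) (G u)) x = signed (c + k * word_deg x) (morph g G x)"
proof (induction x arbitrary: c G rule: induct_list012)
  case (3 a b x)
  show ?case
    using 3(1)[of "c + k * (fst a + fst b)" "\<lambda>u. G (g a b # u)"] 3(2)[of "c + k * fst a" "\<lambda>u. G (a # u)"]
    by (simp add: assms algebra_simps signed_add)
qed simp_all

lemma signed_coder:
  assumes "\<And>w. fst (A w) = word_deg w + 1" and "\<And>a. fst (t a) = fst a"
  shows "coder t A (\<lambda>u. signed (c + k * word_deg u) (G u)) x =
     signed (c + k * (word_deg x + 1)) (coder t A G x)"
proof (induction x arbitrary: c G)
  case (Cons a x)
  have "split_sum (\<lambda>u v. signed (c + k * word_deg (A u # v)) (G (A u # v))) (a # x) =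
    signed (c + k * (word_deg (a # x) + 1)) (split_sum (\<lambda>u v. G (A u # v)) (a # x))"
    unfolding signed_split_sum
  proof (rule split_sum_cong)
    fix u v assume "u @ v = a # x"
    then have "word_deg (a # x) = word_deg u + word_deg v" by (metis word_deg_simps(3))
    then show "signed (c + k * word_deg (A u # v)) (G (A u # v)) =
        signed (c + k * (word_deg (a # x) + 1)) (G (A u # v))"
      by (simp add: assms algebra_simps)
  qed
  then show ?case
    using Cons.IH[of "c + k * fst a" "\<lambda>u. G (t a # u)"] assms
    by (simp add: algebra_simps signed_add del: split_sum.simps)
qed (simp add: assms)

text \<open>
  The lift of \<open>f\<close> to letters with a recorded degree, for \<open>f\<close> of degree zero on \<open>sH\<close>.
\<close>

definition letter_op where "letter_op f a b = (fst a + fst b :: int, f (snd a) (snd b))"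

text \<open>
  Multiplicativity of \<open>\<Phi>\<close>. In a shuffle of \<open>a x\<close> and \<open>b y\<close> the map \<open>\<Phi>\<close> may merge two letters of
  the same word, which is what happens in \<open>\<Phi>(a x)\<close> and \<open>\<Phi>(b y)\<close>, or merge \<open>a\<close> with \<open>b\<close>. The
  latter terms occur once for \<open>a b\<close> and once for \<open>b a\<close> and cancel, since \<open>f\<close> vanishes on the shuffle
  of two letters.
\<close>

lemma shuf_morph:
  assumes "multiadd F"
    and "\<And>a b. a \<in> set x \<Longrightarrow> b \<in> set y \<Longrightarrow>
      f (snd a) (snd b) + signed (fst a * fst b) (f (snd b) (snd a)) = 0"
  shows "shuf (morph f F) x y = morph (letter_op f) (\<lambda>x'. morph (letter_op f) (\<lambda>y'. shuf F x' y') y) x"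
  using assms
proof (induction "length x + length y" arbitrary: F x y rule: less_induct)
  case less
  have base: "morph f F (map snd w) = morph (letter_op f) (\<lambda>u. F (map snd u)) w" for F :: "'a list \<Rightarrow> 'b" and w
    by (induction w arbitrary: F rule: induct_list012) (simp_all add: letter_op_def)
  show ?case
  proof (cases x)
    case Nil
    have "(\<lambda>u. F (map snd u)) = shuf F []" by (rule ext) simp
    then show ?thesis using Nil by (simp add: base)
  next
    case x: (Cons a x')
    show ?thesis
    proof (cases y)
      case Nil
      then show ?thesis using base[of F x] by (simp add: x)
    next
      case y: (Cons b y')
      have IH: "shuf (morph f (\<lambda>u. F (c # u))) z w =
          morph (letter_op f) (\<lambda>x'. morph (letter_op f) (\<lambda>y'. shuf (\<lambda>u. F (c # u)) x' y') w) z"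
        if "length z + length w < length x + length y" "set z \<subseteq> set x" "set w \<subseteq> set y" for c z w
        by (rule less(1)[OF that(1) multiadd_Cons[OF less(2)]]) (rule less(3); use that(2,3) in blast)
      (* Pulled back along \<Phi>, a word beginning with the letter c either keeps it or merges it with
         the next letter; H collects the second kind. *)
      define H where "H c w = (case w of [] \<Rightarrow> 0 | d # w' \<Rightarrow> morph f (\<lambda>u. F (f c d # u)) w')" for c w
      define Hx where "Hx = (case x' of [] \<Rightarrow> 0 | d # x'' \<Rightarrow> shuf (morph f (\<lambda>u. F (f (snd a) (snd d) # u))) x'' y)"
      define Hy where "Hy = (case y' of [] \<Rightarrow> 0 | d # y'' \<Rightarrow>
         signed (fst d * word_deg x) (shuf (morph f (\<lambda>u. F (f (snd b) (snd d) # u))) x y''))"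
      let ?s = "fst b * word_deg x"
      let ?M = "\<lambda>c. shuf (morph f (\<lambda>u. F (c # u))) x' y'"
      have phiH: "(\<lambda>u. morph f F (c # u)) = (\<lambda>u. morph f (\<lambda>u. F (c # u)) u + H c u)" for c
        by (rule ext) (auto simp: H_def split: list.split)
      have Hx: "shuf (H (snd a)) x' y = Hx + signed (fst b * word_deg x') (?M (f (snd a) (snd b)))"
        by (auto simp: H_def Hx_def y split: list.split)
      have Hy: "shuf (H (snd b)) x y' = ?M (f (snd b) (snd a)) + Hy"
        by (auto simp: H_def Hy_def x split: list.split)
      (* The merges of a with b, in both orders: the only terms without a counterpart on the other side. *)
      have canc: "?M (f (snd a) (snd b)) + signed (fst a * fst b) (?M (f (snd b) (snd a))) = 0"
      proof -
        have "f (snd a) (snd b) + signed (fst a * fst b) (f (snd b) (snd a)) = 0"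
          using less(3) x y by simp
        then have "(\<lambda>u. F (f (snd a) (snd b) # u) + signed (fst a * fst b) (F (f (snd b) (snd a) # u))) = (\<lambda>_. 0)"
          using less(2) by (simp flip: multiadd_hd_signed multiadd_hd add: multiadd_hd_zero)
        then have "(\<lambda>w. morph f (\<lambda>u. F (f (snd a) (snd b) # u) + signed (fst a * fst b) (F (f (snd b) (snd a) # u))) w) = (\<lambda>_. 0)"
          by (simp add: additive_op_zero[OF additive_op_morph])
        then show ?thesis
          by (simp add: morph_add additive_op_signed[OF additive_op_morph] flip: shuf_signed shuf_add)
            (simp add: additive_op_zero[of "\<lambda>F. shuf F x' y'"] additive_op_def shuf_add)
      qed
      have "shuf (morph f F) x y = shuf (\<lambda>u. morph f F (snd a # u)) x' y + signed ?s (shuf (\<lambda>u. morph f F (snd b # u)) x y')"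
        by (simp add: x y)
      also have "\<dots> = shuf (morph f (\<lambda>u. F (snd a # u))) x' y + Hx
         + signed ?s (shuf (morph f (\<lambda>u. F (snd b # u))) x y') + signed ?s Hy
         + signed (fst b * word_deg x') (?M (f (snd a) (snd b)) + signed (fst a * fst b) (?M (f (snd b) (snd a))))"
        unfolding phiH shuf_add Hx Hy by (simp add: signed_add x algebra_simps)
      finally have L: "shuf (morph f F) x y = shuf (morph f (\<lambda>u. F (snd a # u))) x' y + Hx
         + signed ?s (shuf (morph f (\<lambda>u. F (snd b # u))) x y') + signed ?s Hy"
        by (simp add: canc)
      define G where "G \<alpha> \<beta> x0 y0 = shuf F (\<alpha> # x0) (\<beta> # y0)" for \<alpha> \<beta> x0 y0
      have sg: "morph (letter_op f) (\<lambda>u. signed (k * word_deg u) (G u)) z = signed (k * word_deg z) (morph (letter_op f) G z)" for k G z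
        using signed_morph[of "letter_op f" 0 k G z] by (simp add: letter_op_def)
      (* The right hand side is split according to whether the first letter of the shuffle of the two
         images comes from the image of x or from the image of y. *)
      define Px where "Px = morph (letter_op f) (\<lambda>x0. case x0 of [] \<Rightarrow> 0 | \<alpha> # x1 \<Rightarrow> morph (letter_op f) (\<lambda>y0. shuf (\<lambda>u. F (snd \<alpha> # u)) x1 y0) y) x"
      define Py where "Py = morph (letter_op f) (\<lambda>x0. morph (letter_op f) (\<lambda>y0. case y0 of [] \<Rightarrow> 0 | \<beta> # y1 \<Rightarrow> signed (fst \<beta> * word_deg x0) (shuf (\<lambda>u. F (snd \<beta> # u)) x0 y1)) y) x"
      have "morph (letter_op f) (\<lambda>x'. morph (letter_op f) (\<lambda>y'. shuf F x' y') y) x =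
        morph (letter_op f) (\<lambda>x0. (case x0 of [] \<Rightarrow> 0 | \<alpha> # x1 \<Rightarrow> morph (letter_op f) (\<lambda>y0. shuf (\<lambda>u. F (snd \<alpha> # u)) x1 y0) y)
          + morph (letter_op f) (\<lambda>y0. case y0 of [] \<Rightarrow> 0 | \<beta> # y1 \<Rightarrow> signed (fst \<beta> * word_deg x0) (shuf (\<lambda>u. F (snd \<beta> # u)) x0 y1)) y) x"
      proof (rule morph_ne_cong)
        fix x0 :: "(int \<times> 'a) list" assume "x0 \<noteq> []"
        then obtain \<alpha> x1 where x0: "x0 = \<alpha> # x1" by (cases x0) auto
        have "morph (letter_op f) (shuf F x0) y = morph (letter_op f) (\<lambda>y0. shuf (\<lambda>u. F (snd \<alpha> # u)) x1 y0 
           + (case y0 of [] \<Rightarrow> 0 | \<beta> # y1 \<Rightarrow> signed (fst \<beta> * word_deg x0) (shuf (\<lambda>u. F (snd \<beta> # u)) x0 y1))) y"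
          by (rule morph_ne_cong) (auto simp: x0 y neq_Nil_conv)
        then show "morph (letter_op f) (shuf F x0) y = (case x0 of [] \<Rightarrow> 0 | \<alpha> # x1 \<Rightarrow> morph (letter_op f) (\<lambda>y0. shuf (\<lambda>u. F (snd \<alpha> # u)) x1 y0) y)
          + morph (letter_op f) (\<lambda>y0. case y0 of [] \<Rightarrow> 0 | \<beta> # y1 \<Rightarrow> signed (fst \<beta> * word_deg x0) (shuf (\<lambda>u. F (snd \<beta> # u)) x0 y1)) y"
          by (simp add: morph_add x0)
      qed (simp add: x)
      then have R: "morph (letter_op f) (\<lambda>x'. morph (letter_op f) (\<lambda>y'. shuf F x' y') y) x = Px + Py"
        by (simp add: morph_add Px_def Py_def)
      have Px: "Px = shuf (morph f (\<lambda>u. F (snd a # u))) x' y + Hx"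
      proof (cases x')
        case Nil
        then show ?thesis using IH[of "[]" y "snd a"] by (simp add: Px_def Hx_def x)
      next
        case (Cons d x'')
        have "set x'' \<subseteq> set x" "set x' \<subseteq> set x" by (auto simp: x Cons)
        then show ?thesis
          using IH[of x' y "snd a"] IH[of x'' y "f (snd a) (snd d)"]
          by (simp add: Px_def Hx_def x Cons letter_op_def)
      qed
      have swap: "morph (letter_op f) (\<lambda>x0. morph (letter_op f) (\<lambda>y0. signed (k * word_deg x0) (shuf (\<lambda>u. F (c # u)) x0 y0)) z) x
         = signed (k * word_deg x) (morph (letter_op f) (\<lambda>x0. morph (letter_op f) (\<lambda>y0. shuf (\<lambda>u. F (c # u)) x0 y0) z) x)" for k z c
        by (simp add: additive_op_signed[OF additive_op_morph] sg)
      have Py: "Py = signed ?s (shuf (morph f (\<lambda>u. F (snd b # u))) x y') + signed ?s Hy"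
      proof (cases y')
        case Nil
        then show ?thesis
          using base[of "\<lambda>u. F (snd b # u)" x] by (simp add: Py_def Hy_def y sg)
      next
        case (Cons d y'')
        have sub: "set y'' \<subseteq> set y" "set y' \<subseteq> set y" by (auto simp: y Cons)
        have "Py = signed ?s (morph (letter_op f) (\<lambda>x0. morph (letter_op f) (\<lambda>y0. shuf (\<lambda>u. F (snd b # u)) x0 y0) y') x)
          + signed ((fst b + fst d) * word_deg x)
             (morph (letter_op f) (\<lambda>x0. morph (letter_op f) (\<lambda>y0. shuf (\<lambda>u. F (f (snd b) (snd d) # u)) x0 y0) y'') x)"
          unfolding swap[symmetric] by (simp add: Py_def y Cons letter_op_def morph_add)
        then show ?thesis
          using IH[of x y' "snd b"] IH[of x y'' "f (snd b) (snd d)"] sub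
          by (simp add: y Hy_def Cons algebra_simps)
      qed
      show ?thesis unfolding L R Px Py by (simp add: add.assoc)
    qed
  qed
qed


text \<open>
  The lift of the components of a coderivation to letters with a recorded degree; the degree of the
  coderivation on \<open>sH\<close> is one.
\<close>

definition letter_coder where "letter_coder A w = (word_deg w + 1, A (map snd w))"

lemma letter_coder_simps [simp]: "fst (letter_coder A w) = word_deg w + 1" "snd (letter_coder A w) = A (map snd w)"
  by (simp_all add: letter_coder_def)

lemma letter_coder_Nil: "A [] = 0 \<Longrightarrow> letter_coder A [] = (1, 0)"
  by (simp add: letter_coder_def)

lemma split_sum_first: "split_sum (\<lambda>u v. if u = [] then M v else 0) w = M w"
  by (cases w) (simp_all add: split_sum_zero)

lemma split_sum_only_first: "(\<And>u v. u @ v = w \<Longrightarrow> u \<noteq> [] \<Longrightarrow> K u v = 0) \<Longrightarrow> split_sum K w = K [] w"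
  by (cases w) (simp_all add: split_sum_zero)

lemma shuf_zero_letter_left: "multiadd F \<Longrightarrow> shuf F [(e, 0)] y = 0"
  by (induction y arbitrary: F) (simp_all add: multiadd_hd_zero multiadd_Cons)

lemma shuf_zero_letter_right: "multiadd F \<Longrightarrow> shuf F x [(e, 0)] = 0"
  by (induction x arbitrary: F) (simp_all add: multiadd_hd_zero multiadd_Cons)

lemma coder_map_snd:
  "coder t A F (map snd y) = coder (on_letter t) (letter_coder A) (\<lambda>u. F (map snd u)) y"
proof (induction y arbitrary: F)
  case (Cons b y)
  then show ?case
    using split_sum_map[of "\<lambda>u v. F (A u # v)" snd "b # y"] by simp
qed simp

text \<open>
  Inserting \<open>A\<close> at the beginning of a shuffle. By multiplicativity of deconcatenation the block to
  which \<open>A\<close> is applied runs over shuffles of initial parts of \<open>x\<close> and \<open>y\<close>. Since \<open>A\<close> vanishes on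
  proper shuffles, the block comes from \<open>x\<close> alone or from \<open>y\<close> alone.
\<close>

lemma shuf_insert:
  assumes F: "multiadd F" and A0: "A [] = 0"
    and A: "\<And>x1 y1. x1 \<noteq> [] \<Longrightarrow> y1 \<noteq> [] \<Longrightarrow> set x1 \<subseteq> set x \<Longrightarrow> set y1 \<subseteq> set y \<Longrightarrow> shuf A x1 y1 = 0"
  shows "shuf (split_sum (\<lambda>u v. F (A u # v))) x y =
     split_sum (\<lambda>x1 x2. shuf (\<lambda>v. F (A (map snd x1) # v)) x2 y) x +
     split_sum (\<lambda>y1 y2. signed (word_deg y1 * word_deg x) (shuf (\<lambda>v. F (A (map snd y1) # v)) x y2)) y"
proof -
  define L where "L x2 y2 z = shuf (\<lambda>v. F (z # v)) x2 y2" for x2 y2 z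
  have L_add: "L x2 y2 (z + z') = L x2 y2 z + L x2 y2 z'" for x2 y2 z z'
    using F by (simp add: L_def multiadd_hd shuf_add)
  have L_zero: "L x2 y2 0 = 0" for x2 y2
    using L_add[of x2 y2 0 0] by simp
  (* T vanishes unless x1 or y1 is empty, and also if both are. *)
  define T where "T x1 x2 y1 y2 = signed (word_deg y1 * word_deg x2) (L x2 y2 (shuf A x1 y1))" for x1 x2 y1 y2
  have T: "split_sum (T x1 x2) y = T x1 x2 [] y + (if x1 = [] then split_sum (T [] x2) y else 0)"
    if "x1 @ x2 = x" for x1 x2
  proof (cases "x1 = []")
    case True
    then show ?thesis by (simp add: T_def A0 L_zero)
  next
    case False
    have "split_sum (T x1 x2) y = T x1 x2 [] y"
    proof (rule split_sum_only_first)
      fix u v assume "u @ v = y" "u \<noteq> []"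
      then have "shuf A x1 u = 0"
        using False that by (intro A) auto
      then show "T x1 x2 u v = 0" by (simp add: T_def L_zero)
    qed
    with False show ?thesis by simp
  qed
  have "shuf (split_sum (\<lambda>u v. F (A u # v))) x y = split_sum (\<lambda>x1 x2. split_sum (T x1 x2) y) x"
    using shuf_fun[of "L x2 y2" A for x2 y2, OF L_add]
    by (simp add: shuf_split_sum T_def[abs_def] L_def)
  also have "\<dots> = split_sum (\<lambda>x1 x2. T x1 x2 [] y + (if x1 = [] then split_sum (T [] x2) y else 0)) x"
    by (rule split_sum_cong) (rule T)
  also have "\<dots> = split_sum (\<lambda>x1 x2. T x1 x2 [] y) x + split_sum (T [] x) y"
    by (simp add: split_sum_add split_sum_first)
  finally show ?thesis by (simp add: T_def[abs_def] L_def)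
qed

text \<open>
  A coderivation whose components vanish on shuffles is a derivation of the shuffle product. The
  induction is on the two words: either the insertion takes place at the beginning, or it takes
  place after the first letter, and the first letter comes from \<open>x\<close> or from \<open>y\<close>. The sign
  \<open>(-1)^|x|\<close> of the Leibniz rule is expressed by letting the sign operator act on \<open>x\<close>.
\<close>

lemma shuf_coder:
  assumes F: "multiadd F" and A0: "A [] = 0"
    and A: "\<And>x1 y1. x1 \<noteq> [] \<Longrightarrow> y1 \<noteq> [] \<Longrightarrow> set x1 \<subseteq> set x \<Longrightarrow> set y1 \<subseteq> set y \<Longrightarrow> shuf A x1 y1 = 0"
    and t: "\<forall>(e, v) \<in> set x \<union> set y. t v = signed e v"
  shows "shuf (coder t A F) x y =
     coder (on_letter t) (letter_coder A) (\<lambda>x'. shuf F x' y) x +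
     coder (on_letter t) (letter_coder A) (\<lambda>y'. shuf F (map (on_letter t) x) y') y"
  using F A t
proof (induction x y arbitrary: F rule: shuffles.induct)
  case (1 y)
  have "(\<lambda>u. F (map snd u)) = shuf F []" by (rule ext) simp
  then show ?case
    using 1 by (simp add: letter_coder_Nil A0 shuf_zero_letter_left coder_map_snd)
next
  case (2 x)
  have "(\<lambda>u. F (map snd u)) = (\<lambda>u. shuf F u [])" by (rule ext) simp
  then show ?case
    using 2 by (simp add: letter_coder_Nil A0 shuf_zero_letter_right coder_map_snd)
next
  case (3 a x b y)
  let ?X = "a # x" and ?Y = "b # y" and ?t = "on_letter t" and ?A = "letter_coder A"
  let ?ta = "t (snd a)" and ?tb = "t (snd b)" and ?b = "fst b"
  let ?W = "word_deg ?X"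
  have tb: "?tb = signed ?b (snd b)" using 3(5) by (auto split: prod.splits)
  have IH1: "shuf (coder t A (\<lambda>u. F (?ta # u))) x ?Y =
     coder ?t ?A (\<lambda>x'. shuf (\<lambda>u. F (?ta # u)) x' ?Y) x +
     coder ?t ?A (\<lambda>y'. shuf (\<lambda>u. F (?ta # u)) (map ?t x) y') ?Y"
    by (rule 3(1)[OF multiadd_Cons[OF 3(3)]], rule 3(4)) (use 3(5) in auto)
  have IH2: "shuf (coder t A (\<lambda>u. F (?tb # u))) ?X y =
     coder ?t ?A (\<lambda>x'. shuf (\<lambda>u. F (?tb # u)) x' y) ?X +
     coder ?t ?A (\<lambda>y'. shuf (\<lambda>u. F (?tb # u)) (map ?t ?X) y') y"
    by (rule 3(2)[OF multiadd_Cons[OF 3(3)]], rule 3(4)) (use 3(5) in auto)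
  have L: "shuf (coder t A F) ?X ?Y = shuf (split_sum (\<lambda>u v. F (A u # v))) ?X ?Y
      + shuf (coder t A (\<lambda>u. F (?ta # u))) x ?Y
      + signed (?b * ?W) (shuf (coder t A (\<lambda>u. F (?tb # u))) ?X y)"
    by (simp add: shuf_add signed_add algebra_simps del: split_sum.simps)
  have E: "shuf (split_sum (\<lambda>u v. F (A u # v))) ?X ?Y =
     split_sum (\<lambda>x1 x2. shuf (\<lambda>v. F (A (map snd x1) # v)) x2 ?Y) ?X +
     split_sum (\<lambda>y1 y2. signed (word_deg y1 * ?W) (shuf (\<lambda>v. F (A (map snd y1) # v)) ?X y2)) ?Y"
    by (rule shuf_insert) (use 3 A0 in auto)

  have X1: "shuf F (x1 # x2) ?Y = shuf (\<lambda>v. F (snd x1 # v)) x2 ?Y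
     + signed (0 + ?b * word_deg (x1 # x2)) (shuf (\<lambda>v. F (snd b # v)) (x1 # x2) y)" for x1 x2
    by simp
  have "coder ?t ?A (\<lambda>x'. shuf F x' ?Y) ?X =
     split_sum (\<lambda>x1 x2. shuf (\<lambda>v. F (A (map snd x1) # v)) x2 ?Y) ?X
     + coder ?t ?A (\<lambda>x'. shuf (\<lambda>v. F (?ta # v)) x' ?Y) x
     + coder ?t ?A (\<lambda>x'. signed (0 + ?b * word_deg x') (shuf (\<lambda>v. F (snd b # v)) x' y)) ?X"
    unfolding coder.simps X1 split_sum_add coder_add
    by (simp add: algebra_simps del: split_sum.simps)
  also have "coder ?t ?A (\<lambda>x'. signed (0 + ?b * word_deg x') (shuf (\<lambda>v. F (snd b # v)) x' y)) ?X =
     signed (0 + ?b * (?W + 1)) (coder ?t ?A (\<lambda>x'. shuf (\<lambda>v. F (snd b # v)) x' y) ?X)"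
    by (rule signed_coder) simp_all
  also have "\<dots> = signed (?b * ?W) (coder ?t ?A (\<lambda>x'. shuf (\<lambda>u. F (?tb # u)) x' y) ?X)"
    using 3(3) by (simp add: tb multiadd_hd_signed shuf_signed additive_op_signed[OF additive_op_coder]
      algebra_simps del: coder.simps)
  finally have X: "coder ?t ?A (\<lambda>x'. shuf F x' ?Y) ?X =
     split_sum (\<lambda>x1 x2. shuf (\<lambda>v. F (A (map snd x1) # v)) x2 ?Y) ?X
     + coder ?t ?A (\<lambda>x'. shuf (\<lambda>v. F (?ta # v)) x' ?Y) x
     + signed (?b * ?W) (coder ?t ?A (\<lambda>x'. shuf (\<lambda>u. F (?tb # u)) x' y) ?X)" .

  have Y1: "shuf F (map ?t ?X) (y1 # y2) = shuf (\<lambda>v. F (?ta # v)) (map ?t x) (y1 # y2)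
     + signed (fst y1 * ?W) (shuf (\<lambda>v. F (snd y1 # v)) (map ?t ?X) y2)" for y1 y2
    by simp
  have Y2: "signed (fst (?A y1) * ?W) (shuf (\<lambda>v. F (snd (?A y1) # v)) (map ?t ?X) y2) =
     signed (word_deg y1 * ?W) (shuf (\<lambda>v. F (A (map snd y1) # v)) ?X y2)" for y1 y2
  proof -
    have "shuf (\<lambda>v. F (snd (?A y1) # v)) (map ?t ?X) y2 =
      signed ?W (shuf (\<lambda>v. F (A (map snd y1) # v)) ?X y2)"
      using shuf_map_signed[of "\<lambda>v. F (A (map snd y1) # v)" ?X t y2] 3(3,5)
      by (auto simp: multiadd_Cons)
    then show ?thesis by (auto simp del: word_deg_simps intro!: signed_cong)
  qed
  have Y: "coder ?t ?A (\<lambda>y'. shuf F (map ?t ?X) y') ?Y =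
     split_sum (\<lambda>y1 y2. signed (word_deg y1 * ?W) (shuf (\<lambda>v. F (A (map snd y1) # v)) ?X y2)) ?Y
     + coder ?t ?A (\<lambda>y'. shuf (\<lambda>u. F (?ta # u)) (map ?t x) y') ?Y
     + signed (?b * ?W) (coder ?t ?A (\<lambda>y'. shuf (\<lambda>u. F (?tb # u)) (map ?t ?X) y') y)"
    unfolding coder.simps Y1 split_sum_add coder_add Y2
    by (simp add: additive_op_signed[OF additive_op_coder] algebra_simps del: split_sum.simps)
  show ?case
    unfolding L E IH1 IH2 X Y by (simp add: signed_add algebra_simps del: split_sum.simps coder.simps)
qed

section \<open>Coalgebra maps and coderivations are determined by their letters\<close>

definition proj_letter :: "'v::zero list \<Rightarrow> 'v" where
  "proj_letter w = (if length w = 1 then hd w else 0)"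

text \<open>
  Every function on nonempty words is a pullback along deconcatenation, of a function that reads its
  first argument only through the projection to letters. Together with the compatibility of \<open>\<Phi>\<close> and
  \<open>D\<close> with deconcatenation this reduces identities between coalgebra maps and coderivations to their
  projections to letters.
\<close>

definition head_split :: "('v list \<Rightarrow> 'w::zero) \<Rightarrow> 'v list \<Rightarrow> 'v list \<Rightarrow> 'w" where
  "head_split F u v = (if length u = 1 then F (hd u # v) else 0)"

lemma head_split_Nil [simp]: "head_split F [] = (\<lambda>_. 0)"
  by (rule ext) (simp add: head_split_def)

lemma split_sum_head_split: "w \<noteq> [] \<Longrightarrow> split_sum (head_split F) w = F w"
proof (cases w)
  case (Cons a w')
  have "split_sum (\<lambda>u v. head_split F (a # u) v) w' = F (a # w')"
    by (subst split_sum_only_first) (auto simp: head_split_def[abs_def])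
  then show ?thesis by (simp add: Cons)
qed simp

lemma head_split_proj: "multiadd F \<Longrightarrow> head_split F = (\<lambda>u v. F (proj_letter u # v))"
  by (intro ext) (simp add: head_split_def proj_letter_def multiadd_hd_zero)

lemma morph_map:
  assumes "\<And>a b. f (t a) (t b) = t (f a b)"
  shows "morph f (\<lambda>u. G (map t u)) u = morph f G (map t u)"
proof (induction u arbitrary: G rule: induct_list012)
  case (3 a b u)
  show ?case
    using 3(1)[of "\<lambda>u. G (t (f a b) # u)"] 3(2)[of "\<lambda>u. G (t a # u)"] by (simp add: assms)
qed simp_all

lemma morph_fun:
  assumes "\<And>x y. L (x + y) = L x + L y"
  shows "morph f (\<lambda>u. L (F u)) w = L (morph f F w)"
  using morph_op[OF additive_op_fun[of L], of f "\<lambda>u _. F u" w] assms by simp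

lemma coder_fun:
  assumes "\<And>x y. L (x + y) = L x + L y"
  shows "coder t A (\<lambda>u. L (F u)) w = L (coder t A F w)"
  using coder_op[OF additive_op_fun[of L], of t A "\<lambda>u _. F u" w] assms by simp

lemma morph_zero [simp]: "morph f (\<lambda>_. 0) = (\<lambda>_. 0)"
  by (rule ext, rule additive_op_zero[OF additive_op_morph])

lemma coder_zero [simp]: "coder t A (\<lambda>_. 0) = (\<lambda>_. 0)"
  by (rule ext, rule additive_op_zero[OF additive_op_coder])

lemma coder_proj_letter: "coder t A proj_letter w = A w"
proof (cases w)
  case (Cons a w')
  have "split_sum (\<lambda>u v. proj_letter (A u # v)) w = A w"
    by (subst split_sum_last) (simp_all add: proj_letter_def)
  moreover have "coder t A (\<lambda>u. proj_letter (t a # u)) w' = 0"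
    using coder_ne_cong[of "\<lambda>u. proj_letter (t a # u)" "\<lambda>_. 0" t A w'] by (simp add: proj_letter_def)
  ultimately show ?thesis by (simp add: Cons del: split_sum.simps)
qed (simp add: proj_letter_def)

text \<open>
  If \<open>\<Phi>D\<^sub>A\<close> and \<open>D\<^sub>B\<Phi>\<close> have the same projection to letters, they agree. Both sides are
  \<open>\<Phi>\<close>-coderivations: after splitting off the first letter of the result, that letter is governed by
  the hypothesis and the remaining shorter word by induction.
\<close>

lemma morph_coder:
  assumes F: "multiadd F" and A0: "A [] = 0" and B0: "B [] = 0"
    and B: "\<And>w. morph f B w = coder t A (morph f proj_letter) w"
    and f: "\<And>a b. f (t a) (t b) = t (f a b)"
  shows "morph f (coder t B F) w = coder t A (morph f F) w"
  using F
proof (induction "length w" arbitrary: w F rule: less_induct)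
  case less
  show ?case
  proof (cases "w = []")
    case True
    then show ?thesis using less(2) by (simp add: A0 B0 multiadd_hd_zero)
  next
    case False
    let ?K = "head_split F"
    have "morph f (coder t B F) w = morph f (coder t B (split_sum ?K)) w"
      by (rule arg_cong[where f = "\<lambda>F. morph f F w"], rule ext, rule coder_ne_cong)
        (simp add: split_sum_head_split)
    also have "\<dots> = split_sum (\<lambda>u v. morph f (\<lambda>u'. morph f (\<lambda>v'. coder t B (\<lambda>u'. ?K u' v') u') v) u
       + morph f (\<lambda>u'. morph f (coder t B (?K (map t u'))) v) u) w"
      by (simp add: coder_split_sum[abs_def] morph_split_sum morph_add)
    also have "\<dots> = split_sum (\<lambda>u v. coder t A (\<lambda>u'. morph f (\<lambda>u'. morph f (?K u') v) u') u
       + coder t A (\<lambda>v'. morph f (\<lambda>u'. morph f (?K u') v') (map t u)) v) w"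
    proof (rule split_sum_cong, rule arg_cong2[where f = "(+)"])
      fix u v assume uv: "u @ v = w"
      define L where "L z = morph f (\<lambda>v'. F (z # v')) v" for z
      have L: "L (z + z') = L z + L z'" for z z'
        using less(2) by (simp add: L_def multiadd_hd morph_add)
      have "morph f (\<lambda>v'. coder t B (\<lambda>u'. ?K u' v') u') v = L (B u')" for u'
      proof -
        have "morph f (\<lambda>v'. coder t B (\<lambda>u'. ?K u' v') u') v = coder t B (\<lambda>u'. L (proj_letter u')) u'"
          using less(2) by (simp add: morph_op[OF additive_op_coder] head_split_proj L_def)
        then show ?thesis using L by (simp add: coder_fun coder_proj_letter)
      qed
      then have "morph f (\<lambda>u'. morph f (\<lambda>v'. coder t B (\<lambda>u'. ?K u' v') u') v) u
          = L (coder t A (morph f proj_letter) u)"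
        using L by (simp add: morph_fun B)
      also have "\<dots> = coder t A (\<lambda>u'. morph f (\<lambda>u'. L (proj_letter u')) u') u"
        using L by (simp add: morph_fun coder_fun)
      also have "\<dots> = coder t A (\<lambda>u'. morph f (\<lambda>u'. morph f (?K u') v) u') u"
        using less(2) by (simp add: L_def head_split_proj)
      finally show "morph f (\<lambda>u'. morph f (\<lambda>v'. coder t B (\<lambda>u'. ?K u' v') u') v) u = \<dots>" .
      have "morph f (coder t B (?K (map t u'))) v = coder t A (morph f (?K (map t u'))) v" if "u \<noteq> []" for u'
      proof (rule less(1))
        show "length v < length w" using uv that by auto
        show "multiadd (?K (map t u'))"
          using multiadd_Cons[OF less(2)] by (auto simp: head_split_def multiadd_def)
      qed
      moreover have "u = [] \<Longrightarrow> morph f (\<lambda>u'. morph f (coder t B (?K (map t u'))) v) u =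
          morph f (\<lambda>u'. coder t A (morph f (?K (map t u'))) v) u"
        by simp
      ultimately have "morph f (\<lambda>u'. morph f (coder t B (?K (map t u'))) v) u
          = morph f (\<lambda>u'. coder t A (morph f (?K (map t u'))) v) u"
        by (cases "u = []") simp_all
      also have "\<dots> = coder t A (\<lambda>v'. morph f (\<lambda>u'. morph f (?K (map t u')) v') u) v"
        by (rule morph_op[OF additive_op_coder])
      also have "\<dots> = coder t A (\<lambda>v'. morph f (\<lambda>u'. morph f (?K u') v') (map t u)) v"
        using morph_map[of f t "\<lambda>u'. morph f (?K u') v'" u for v'] f by simp
      finally show "morph f (\<lambda>u'. morph f (coder t B (?K (map t u'))) v) u = \<dots>" .
    qed
    also have "\<dots> = coder t A (morph f (split_sum ?K)) w"
      by (simp add: morph_split_sum[abs_def] coder_split_sum)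
    also have "\<dots> = coder t A (morph f F) w"
      by (rule coder_ne_cong, rule morph_ne_cong) (simp_all add: split_sum_head_split)
    finally show ?thesis .
  qed
qed

lemma coder_map_anti:
  assumes G: "multiadd G" and t: "\<And>a. t (t a) = a" and A: "\<And>u. A (map t u) = - t (A u)"
  shows "coder t A (\<lambda>u. G (map t u)) w = - coder t A G (map t w)"
  using G
proof (induction w arbitrary: G)
  case Nil
  have "G [A []] + G [- A []] = G [A [] + - A []]" 
    using multiadd_hd[OF Nil] by metis
  then have "G [A []] + G [- A []] = 0"
    using multiadd_hd_zero[OF Nil] by simp
  moreover have "t (A []) = - A []" using A[of "[]"] by (metis list.map(1) minus_minus)
  ultimately show ?case by (simp add: add_eq_0_iff)
next
  case (Cons a w)
  have "split_sum (\<lambda>u v. G (map t (A u # v))) (a # w) = split_sum (\<lambda>u v. - G (A (map t u) # map t v)) (a # w)"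
  proof (rule split_sum_cong)
    fix u v
    have "G (signed 1 (t (A u)) # map t v) = signed 1 (G (t (A u) # map t v))"
      by (rule multiadd_hd_signed[OF Cons(2)])
    then show "G (map t (A u # v)) = - G (A (map t u) # map t v)"
      by (simp add: A signed_def)
  qed
  also have "\<dots> = - split_sum (\<lambda>u v. G (A u # v)) (map t (a # w))"
    by (simp only: split_sum_neg split_sum_map)
  finally show ?case
    using Cons.IH[of "\<lambda>u. G (a # u)"] Cons.prems t
    by (simp add: multiadd_Cons algebra_simps del: split_sum.simps)
qed

text \<open>
  The square of an odd coderivation is a coderivation, the two mixed terms cancelling by
  \<open>coder_map_anti\<close>. It therefore vanishes if its projection to letters does.
\<close>

lemma coder_coder:
  assumes F: "multiadd F" and "multiadd A" and A0: "A [] = 0" and A: "\<And>w. coder t A A w = 0"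
    and t: "\<And>a. t (t a) = a" and At: "\<And>u. A (map t u) = - t (A u)"
  shows "coder t A (coder t A F) w = 0"
  using F
proof (induction "length w" arbitrary: w F rule: less_induct)
  case less
  show ?case
  proof (cases "w = []")
    case True
    have "F [t 0, 0] = 0" "A [0] = 0"
      using multiadd_hd_zero[OF multiadd_Cons[OF less(2)]] multiadd_hd_zero[OF assms(2)] by auto
    then show ?thesis using less(2) True by (simp add: A0 multiadd_hd_zero)
  next
    case False
    let ?K = "head_split F"
    have K1: "multiadd (?K u)" for u
      using multiadd_Cons[OF less(2)] by (auto simp: head_split_def multiadd_def)
    have "coder t A (coder t A F) w = coder t A (coder t A (split_sum ?K)) w"
      by (rule arg_cong[where f = "\<lambda>F. coder t A F w"], rule ext, rule coder_ne_cong)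
        (simp add: split_sum_head_split)
    also have "\<dots> = split_sum (\<lambda>u v.
         coder t A (\<lambda>u'. coder t A (\<lambda>u'. ?K u' v) u') u
       + coder t A (\<lambda>u'. coder t A (?K (map t u')) v) u
       + coder t A (\<lambda>v'. coder t A (\<lambda>u'. ?K u' v') (map t u)) v
       + coder t A (\<lambda>v'. coder t A (?K (map t (map t u))) v') v) w"
      by (simp add: coder_split_sum[abs_def] coder_add add.assoc)
    also have "\<dots> = 0"
    proof (rule split_sum_zero)
      fix u v assume uv: "u @ v = w"
      define L where "L z = F (z # v)" for z
      have L: "L (z + z') = L z + L z'" for z z'
        using less(2) by (simp add: L_def multiadd_hd)
      have "coder t A (\<lambda>u'. coder t A (\<lambda>u'. ?K u' v) u') u = coder t A (\<lambda>u'. coder t A (\<lambda>u'. L (proj_letter u')) u') u"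
        using less(2) by (simp add: head_split_proj L_def)
      also have "\<dots> = L (coder t A A u)"
        using L coder_proj_letter[of t A] by (simp add: coder_fun)
      finally have 1: "coder t A (\<lambda>u'. coder t A (\<lambda>u'. ?K u' v) u') u = 0"
        using less(2) by (simp add: A L_def multiadd_hd_zero)
      have "multiadd (\<lambda>u'. coder t A (?K u') v)"
      proof -
        have "?K (xs @ (x + y) # ys) = (\<lambda>v'. ?K (xs @ x # ys) v' + ?K (xs @ y # ys) v')" for xs x y ys
          by (rule ext, cases xs) (simp_all add: head_split_def multiadd_hd[OF less(2)])
        then show ?thesis by (simp add: multiadd_def coder_add)
      qed
      then have "coder t A (\<lambda>u'. coder t A (?K (map t u')) v) u = - coder t A (\<lambda>u'. coder t A (?K u') v) (map t u)"
        using coder_map_anti[of "\<lambda>u'. coder t A (?K u') v" t A u] t At by blast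
      also have "coder t A (\<lambda>u'. coder t A (?K u') v) (map t u) = coder t A (\<lambda>v'. coder t A (\<lambda>u'. ?K u' v') (map t u)) v"
        by (rule coder_op[OF additive_op_coder])
      finally have 2: "coder t A (\<lambda>u'. coder t A (?K (map t u')) v) u = - \<dots>" .
      have 3: "coder t A (\<lambda>v'. coder t A (?K (map t (map t u))) v') v = 0"
      proof (cases "u = []")
        case False
        then have "length v < length w" using uv by auto
        then show ?thesis by (rule less(1)) (rule K1)
      qed simp
      show "coder t A (\<lambda>u'. coder t A (\<lambda>u'. ?K u' v) u') u
       + coder t A (\<lambda>u'. coder t A (?K (map t u')) v) u
       + coder t A (\<lambda>v'. coder t A (\<lambda>u'. ?K u' v') (map t u)) v
       + coder t A (\<lambda>v'. coder t A (?K (map t (map t u))) v') v = 0"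
        unfolding 1 2 3 by simp
    qed
    finally show ?thesis .
  qed
qed

text \<open>
  \<open>1 - \<Phi>\<close> lowers the length, so the Neumann series \<open>\<Sum>\<^sub>k (1 - \<Phi>)\<^sup>k\<close> is finite on every word and
  inverts \<open>\<Phi>\<close>. The truncation in the next definition depends on the word.
\<close>

definition morph_defect where "morph_defect f F w = F w - morph f F w"

definition morph_inv where "morph_inv f G w = (\<Sum>k\<le>length w. (morph_defect f ^^ k) G w)"

lemma morph_defect_vanish: "length w < k \<Longrightarrow> (morph_defect f ^^ k) G w = 0"
proof (induction k arbitrary: w)
  case (Suc k)
  have "morph f ((morph_defect f ^^ k) G) w = (morph_defect f ^^ k) G w"
    by (rule morph_leading[where P = "\<lambda>_. True"]) (use Suc in \<open>auto simp: list_all_iff\<close>)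
  then have "morph_defect f ((morph_defect f ^^ k) G) w = 0"
    by (subst morph_defect_def) simp
  then show ?case by simp
qed simp

lemma morph_sum: "morph f (\<lambda>u. \<Sum>k\<in>S. F k u) w = (\<Sum>k\<in>S. morph f (F k) w)"
  by (induction S rule: infinite_finite_induct) (simp_all add: morph_add)

lemma morph_inv:
  fixes G :: "'a list \<Rightarrow> 'w::ab_group_add"
  shows "morph f (morph_inv f G) w = G w"
proof -
  let ?N = "\<lambda>k. (morph_defect f ^^ k) G"
  let ?n = "length w"
  have "morph f (morph_inv f G) w = morph f (\<lambda>u. \<Sum>k\<le>?n. ?N k u) w"
  proof (rule morph_cong)
    fix u :: "'a list" assume u: "length u \<le> ?n"
    show "morph_inv f G u = (\<Sum>k\<le>?n. ?N k u)"
      unfolding morph_inv_def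
      by (rule sum.mono_neutral_left) (use u in \<open>auto simp: morph_defect_vanish\<close>)
  qed
  also have "\<dots> = (\<Sum>k\<le>?n. ?N k w - ?N (Suc k) w)"
  proof -
    have "morph f (?N k) w = ?N k w - ?N (Suc k) w" for k
      using morph_defect_def[of f "?N k" w] by simp
    then show ?thesis by (simp add: morph_sum del: funpow.simps(2))
  qed
  also have "\<dots> = G w"
    by (subst sum_telescope) (simp add: morph_defect_vanish del: funpow.simps(2))
  finally show ?thesis .
qed

lemma morph_inject: "(\<And>w. morph f F w = morph f G w) \<Longrightarrow> F w = G w"
proof (induction "length w" arbitrary: w rule: less_induct)
  case less
  have "morph f (\<lambda>u. F u + - G u) w = F w + - G w"
    by (rule morph_leading[where P = "\<lambda>_. True"]) (use less in \<open>auto simp: list_all_iff\<close>)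
  moreover have "morph f (\<lambda>u. F u + - G u) w = 0"
    using less(2) by (simp only: morph_add additive_op_minus[OF additive_op_morph]) simp
  ultimately show ?case by simp
qed

section \<open>Multilinear functions on words of a graded space\<close>

lemma multiadd_zero: "multiadd F \<Longrightarrow> F (xs @ 0 # ys) = 0"
  unfolding multiadd_def by (metis add.right_neutral add_left_cancel)

context graded_vector_space
begin

lemma decomposition_hcomp: "homogeneous_decomposition H x (hcomp H x)"
  unfolding hcomp_def by (rule theI'[OF direct_sum])

lemma hcomp_eqI: "homogeneous_decomposition H x c \<Longrightarrow> hcomp H x = c"
  using direct_sum[of x] decomposition_hcomp by blast

lemma hcomp_mem: "hcomp H x d \<in> H d"
  and finite_hcomp: "finite {d. hcomp H x d \<noteq> 0}"
  and sum_hcomp: "(\<Sum>d | hcomp H x d \<noteq> 0. hcomp H x d) = x"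
  using decomposition_hcomp[of x] by (auto simp: homogeneous_decomposition_def)

lemma component_add: "x \<in> H d \<Longrightarrow> y \<in> H d \<Longrightarrow> x + y \<in> H d"
  and component_scale: "x \<in> H d \<Longrightarrow> scale c x \<in> H d"
  and component_0: "0 \<in> H d"
  using subspace_component by (auto simp: subspace_add subspace_scale subspace_0)

lemma component_signed: "x \<in> H d \<Longrightarrow> signed e x \<in> H d"
  using subspace_neg[OF subspace_component] by (auto simp: signed_def)

lemma component_sum: "(\<And>i. i \<in> I \<Longrightarrow> g i \<in> H d) \<Longrightarrow> sum g I \<in> H d"
  by (rule subspace_sum[OF subspace_component])

lemma hcomp_unique:
  assumes "finite S" "\<And>d. c d \<in> H d" "\<And>d. d \<notin> S \<Longrightarrow> c d = 0" "x = (\<Sum>d\<in>S. c d)"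
  shows "hcomp H x = c"
proof (rule hcomp_eqI)
  have "{d. c d \<noteq> 0} \<subseteq> S" using assms(3) by auto
  then show "homogeneous_decomposition H x c"
    using assms finite_subset[OF _ assms(1)]
    by (auto simp: homogeneous_decomposition_def intro!: sum.mono_neutral_right)
qed

lemma hcomp_add: "hcomp H (x + y) d = hcomp H x d + hcomp H y d"
proof -
  let ?S = "{d. hcomp H x d \<noteq> 0} \<union> {d. hcomp H y d \<noteq> 0}"
  have "x = sum (hcomp H x) ?S" "y = sum (hcomp H y) ?S"
    by (subst sum_hcomp[symmetric], rule sum.mono_neutral_left; use finite_hcomp in auto)+
  then have "hcomp H (x + y) = (\<lambda>d. hcomp H x d + hcomp H y d)"
    by (intro hcomp_unique[of ?S])
      (auto simp: finite_hcomp hcomp_mem component_add sum.distrib)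
  then show ?thesis by simp
qed

lemma hcomp_scale: "hcomp H (scale c x) d = scale c (hcomp H x d)"
proof -
  have "hcomp H (scale c x) = (\<lambda>d. scale c (hcomp H x d))"
    by (intro hcomp_unique[of "{d. hcomp H x d \<noteq> 0}"])
      (auto simp: finite_hcomp hcomp_mem component_scale sum_hcomp simp flip: scale_sum_right)
  then show ?thesis by simp
qed

lemma hcomp_homogeneous: "x \<in> H d \<Longrightarrow> hcomp H x = (\<lambda>e. if e = d then x else 0)"
  by (rule hcomp_unique[of "{d}"]) (auto simp: component_0)

lemma degree_sign_sum:
  assumes "finite S" "\<And>d. d \<notin> S \<Longrightarrow> hcomp H x d = 0"
  shows "degree_sign H e s x = (\<Sum>d\<in>S. signed (e * (d + s)) (hcomp H x d))"
  unfolding degree_sign_def by (rule sum.mono_neutral_left) (use assms in auto)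

lemma degree_sign_homogeneous:
  "x \<in> H d \<Longrightarrow> degree_sign H e s x = signed (e * (d + s)) x"
  by (subst degree_sign_sum[of "{d}"]) (auto simp: hcomp_homogeneous)

lemma scale_signed: "scale c (signed e x) = signed e (scale c x)"
  by (simp add: signed_def)

abbreviation klinear :: "('v \<Rightarrow> 'v) \<Rightarrow> bool" where
  "klinear \<equiv> Vector_Spaces.linear scale scale"

lemma linearI':
  assumes "\<And>x y. g (x + y) = g x + g y" "\<And>c x. g (scale c x) = scale c (g x)"
  shows "klinear g"
  using assms by unfold_locales

lemma linear_add': "klinear g \<Longrightarrow> g (x + y) = g x + g y"
  by (rule module_hom.add) (auto simp: Vector_Spaces.linear_def)

lemma linear_scale': "klinear g \<Longrightarrow> g (scale c x) = scale c (g x)"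
  by (rule module_hom.scale) (auto simp: Vector_Spaces.linear_def)

lemma linear_degree_sign: "klinear (degree_sign H e s)"
proof (rule linearI')
  fix x y
  let ?S = "{d. hcomp H x d \<noteq> 0} \<union> {d. hcomp H y d \<noteq> 0}"
  have "degree_sign H e s z = (\<Sum>d\<in>?S. signed (e * (d + s)) (hcomp H z d))"
    if "z \<in> {x, y, x + y}" for z
    by (rule degree_sign_sum) (use that finite_hcomp in \<open>auto simp: hcomp_add\<close>)
  then show "degree_sign H e s (x + y) = degree_sign H e s x + degree_sign H e s y"
    by (simp add: hcomp_add signed_add sum.distrib)
next
  fix c x
  show "degree_sign H e s (scale c x) = scale c (degree_sign H e s x)"
    by (subst (1 2) degree_sign_sum[of "{d. hcomp H x d \<noteq> 0}"])
      (auto simp: finite_hcomp hcomp_scale scale_sum_right scale_signed)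
qed

lemma additive_ext_homogeneous:
  assumes "\<And>x y. g (x + y) = g x + g y" "\<And>x d. x \<in> H d \<Longrightarrow> g x = 0"
  shows "g x = (0 :: 'w::ab_group_add)"
proof -
  have g0: "g 0 = 0" using assms(2)[OF component_0] .
  have "g (sum (hcomp H x) S) = 0" if "finite S" for S
    using that by (induction S) (auto simp: g0 assms(1) assms(2)[OF hcomp_mem])
  from this[OF finite_hcomp[of x]] show ?thesis by (simp add: sum_hcomp)
qed

lemma degree_sign_degree_sign: "degree_sign H e s (degree_sign H e s x) = x"
proof -
  have "degree_sign H e s (degree_sign H e s x) - x = 0"
  proof (rule additive_ext_homogeneous[of "\<lambda>x. degree_sign H e s (degree_sign H e s x) - x"])
    fix x d assume "x \<in> H d"
    then show "degree_sign H e s (degree_sign H e s x) - x = 0"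
      by (simp add: degree_sign_homogeneous[of _ d] component_signed)
        (simp add: signed_def)
  qed (simp add: linear_add'[OF linear_degree_sign])
  then show ?thesis by simp
qed

text \<open>
  The recorded degree of a letter is its degree in \<open>sH\<close>, one less than the degree in \<open>H\<close>.
\<close>

definition hom_letter :: "int \<times> 'v \<Rightarrow> bool" where
  "hom_letter a \<longleftrightarrow> snd a \<in> H (fst a + 1)"

definition hom_word :: "(int \<times> 'v) list \<Rightarrow> bool" where
  "hom_word w \<longleftrightarrow> list_all hom_letter w"

lemma hom_word_simps [simp]: "hom_word []" "hom_word (a # w) \<longleftrightarrow> snd a \<in> H (fst a + 1) \<and> hom_word w"
  "hom_word (u @ v) \<longleftrightarrow> hom_word u \<and> hom_word v"
  by (auto simp: hom_word_def hom_letter_def)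

lemma hom_word_subset: "hom_word w \<Longrightarrow> set u \<subseteq> set w \<Longrightarrow> hom_word u"
  by (auto simp: hom_word_def list_all_iff)

lemma multiadd_ext_hom_word:
  assumes F: "multiadd F" and 0: "\<And>w. hom_word w \<Longrightarrow> F (map snd w) = 0"
  shows "F xs = 0"
proof -
  have "F (map snd w @ ys) = 0" if "hom_word w" for w ys
    using that
  proof (induction ys arbitrary: w)
    case Nil
    then show ?case by (simp add: 0)
  next
    case (Cons y ys)
    show ?case
    proof (rule additive_ext_homogeneous[of "\<lambda>y. F (map snd w @ y # ys)"])
      fix x d assume "x \<in> H d"
      then show "F (map snd w @ x # ys) = 0"
        using Cons.IH[of "w @ [(d - 1, x)]"] Cons.prems by simp
    qed (use F in \<open>simp add: multiadd_def\<close>)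
  qed
  from this[of "[]" xs] show ?thesis by simp
qed

text \<open>
  Linearity in each letter, simultaneously for words of all lengths. A family of cochains, one for each
  arity, is treated as a single function of this kind.
\<close>

definition multilin :: "('v list \<Rightarrow> 'v) \<Rightarrow> bool" where
  "multilin F \<longleftrightarrow> (\<forall>xs ys. klinear (\<lambda>x. F (xs @ x # ys)))"

lemma multilin_multiadd: "multilin F \<Longrightarrow> multiadd F"
  using linear_add'[of "\<lambda>x. F (xs @ x # ys)" for xs ys] by (simp add: multilin_def multiadd_def)

lemma multilin_linear: "multilin F \<Longrightarrow> klinear (\<lambda>x. F (xs @ x # ys))"
  by (simp add: multilin_def)

lemma multilin_Cons: "multilin F \<Longrightarrow> multilin (\<lambda>u. F (a # u))"
  using multilin_linear[of F "a # xs" for xs] by (simp add: multilin_def)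

lemma multilin_hd: "multilin F \<Longrightarrow> klinear (\<lambda>x. F (x # u))"
  using multilin_linear[of F "[]"] by simp

lemma linear_plus: "klinear g \<Longrightarrow> klinear h \<Longrightarrow>
    klinear (\<lambda>x. g x + h x)"
  by (rule linearI') (simp_all add: linear_add' linear_scale' scale_right_distrib algebra_simps)

lemma linear_comp: "klinear g \<Longrightarrow> klinear h \<Longrightarrow>
    klinear (\<lambda>x. g (h x))"
  by (rule linearI') (simp_all add: linear_add' linear_scale')

lemma linear_minus: "klinear g \<Longrightarrow> klinear h \<Longrightarrow>
    klinear (\<lambda>x. g x - h x)"
  by (rule linearI') (simp_all add: linear_add' linear_scale' scale_right_diff_distrib)

lemma linear_split_sum:
  "(\<And>u v. klinear (\<lambda>x. K x u v)) \<Longrightarrow>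
    klinear (\<lambda>x. split_sum (K x) w)"
  by (induction w arbitrary: K) (auto intro!: linear_plus)

lemma linear_morph:
  "(\<And>u. klinear (\<lambda>x. F x u)) \<Longrightarrow>
    klinear (\<lambda>x. morph f (F x) w)"
  by (induction w arbitrary: F rule: induct_list012) (auto intro!: linear_plus)

lemma linear_coder:
  "(\<And>u. klinear (\<lambda>x. F x u)) \<Longrightarrow>
    klinear (\<lambda>x. coder t A (F x) w)"
  by (induction w arbitrary: F) (auto intro!: linear_plus linear_split_sum simp del: split_sum.simps)

lemma multilin_split_sum:
  assumes "\<And>u. multilin (K u)" "\<And>v. multilin (\<lambda>u. K u v)"
  shows "multilin (split_sum K)"
proof -
  have "klinear (\<lambda>x. split_sum K (xs @ x # ys))" for xs ys
    using assms
  proof (induction xs arbitrary: K)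
    case Nil
    then show ?case by (auto intro!: linear_plus linear_split_sum multilin_hd)
  next
    case (Cons a xs)
    have "klinear (\<lambda>x. K [] (a # xs @ x # ys))"
      using multilin_Cons[OF Cons(2)[of "[]"], of a] by (simp add: multilin_def)
    moreover have "klinear (\<lambda>x. split_sum (\<lambda>u v. K (a # u) v) (xs @ x # ys))"
      by (rule Cons(1)) (use Cons(2,3) in \<open>auto intro: multilin_Cons\<close>)
    ultimately show ?case by (simp add: linear_plus)
  qed
  then show ?thesis by (simp add: multilin_def)
qed

lemma multilin_coder:
  assumes "multilin F" "multilin A" and t: "klinear t"
  shows "multilin (coder t A F)"
proof -
  have ins: "multilin (split_sum (\<lambda>u v. F (A u # v)))" if "multilin F" for F
  proof (rule multilin_split_sum)
    fix v
    show "multilin (\<lambda>u. F (A u # v))"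
      unfolding multilin_def
      using assms(2) multilin_hd[OF that, of v] by (auto simp: multilin_def intro!: linear_comp[of "\<lambda>x. F (x # v)"])
  qed (use that in \<open>rule multilin_Cons\<close>)
  have "klinear (\<lambda>x. coder t A F (xs @ x # ys))" for xs ys
    using assms(1)
  proof (induction xs arbitrary: F)
    case Nil
    show ?case
      using ins[OF Nil] linear_comp[OF multilin_hd[OF Nil] t]
      by (auto intro!: linear_plus linear_coder simp: multilin_hd simp del: split_sum.simps)
  next
    case (Cons a xs)
    show ?case
      using linear_plus[OF multilin_linear[OF ins[OF Cons(2)], of "a # xs" ys] Cons(1)[OF multilin_Cons[OF Cons(2)]]]
      by (simp del: split_sum.simps)
  qed
  then show ?thesis by (simp add: multilin_def)
qed

definition bilin :: "('v \<Rightarrow> 'v \<Rightarrow> 'v) \<Rightarrow> bool" where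
  "bilin f \<longleftrightarrow> (\<forall>a. klinear (f a) \<and> klinear (\<lambda>x. f x a))"

lemma multilin_morph:
  assumes "multilin F" "bilin f"
  shows "multilin (morph f F)"
proof -
  have "klinear (\<lambda>x. morph f F (xs @ x # ys))" for xs ys
    using assms(1)
  proof (induction xs arbitrary: F rule: induct_list012)
    case 1
    show ?case
      using assms(2) linear_comp[OF multilin_hd[OF 1], of "\<lambda>x. f x a" for a]
      by (cases ys) (auto intro!: linear_plus linear_morph simp: multilin_hd[OF 1] bilin_def)
  next
    case (2 a)
    have "klinear (\<lambda>x. morph f (\<lambda>u. F (a # u)) (x # ys))"
      using 2 assms(2) linear_comp[OF multilin_hd[OF multilin_Cons[OF 2]], of "\<lambda>x. f x b" for b]
      by (cases ys) (auto intro!: linear_plus linear_morph simp: multilin_hd[OF multilin_Cons[OF 2]] bilin_def)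
    moreover have "klinear (\<lambda>x. morph f (\<lambda>u. F (f a x # u)) ys)"
      using assms(2) linear_comp[OF multilin_hd[OF 2], of "f a"]
      by (auto intro!: linear_morph simp: bilin_def)
    ultimately show ?case by (simp add: linear_plus)
  next
    case (3 a b xs)
    show ?case
      using 3(1)[OF multilin_Cons[OF 3(3)]] 3(2)[OF multilin_Cons[OF 3(3)]] by (simp add: linear_plus)
  qed
  then show ?thesis by (simp add: multilin_def)
qed

lemma multilin_minus: "multilin F \<Longrightarrow> multilin G \<Longrightarrow> multilin (\<lambda>u. F u - G u)"
  by (simp add: multilin_def linear_minus)

lemma multilin_plus: "multilin F \<Longrightarrow> multilin G \<Longrightarrow> multilin (\<lambda>u. F u + G u)"
  by (simp add: multilin_def linear_plus)

lemma linear_zero: "klinear (\<lambda>x. 0)"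
  by (rule linearI') auto

lemma linear_id': "klinear (\<lambda>x. x)"
  by (rule linearI') auto

lemma multilin_proj_letter: "multilin proj_letter"
proof -
  have "klinear (\<lambda>x. proj_letter (xs @ x # ys))" for xs ys
    by (cases "xs = [] \<and> ys = []") (auto simp: proj_letter_def linear_zero linear_id')
  then show ?thesis by (simp add: multilin_def)
qed

lemma multilin_morph_inv:
  assumes "multilin G" "bilin f"
  shows "multilin (morph_inv f G)"
proof -
  have N: "multilin ((morph_defect f ^^ k) G)" for k
  proof (induction k)
    case (Suc k)
    have "(morph_defect f ^^ Suc k) G = (\<lambda>u. (morph_defect f ^^ k) G u - morph f ((morph_defect f ^^ k) G) u)"
      by (rule ext) (simp add: morph_defect_def[of f "(morph_defect f ^^ k) G"])
    with Suc assms(2) show ?case by (simp only: multilin_minus multilin_morph)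
  qed (use assms in simp)
  have "multilin (\<lambda>u. \<Sum>k\<le>n. (morph_defect f ^^ k) G u)" for n
    using N N[of 0] by (induction n) (simp_all add: multilin_plus del: funpow.simps(2))
  then show ?thesis by (simp add: multilin_def morph_inv_def[abs_def] del: sum.atMost_Suc)
qed

text \<open>
  A map of degree \<open>k\<close> on \<open>sH\<close>, expressed through degrees in \<open>H\<close>.
\<close>

definition graded :: "int \<Rightarrow> ('v list \<Rightarrow> 'v) \<Rightarrow> bool" where
  "graded k F \<longleftrightarrow> (\<forall>w. hom_word w \<longrightarrow> F (map snd w) \<in> H (word_deg w + 1 + k))"

lemma gradedD: "graded k F \<Longrightarrow> hom_word w \<Longrightarrow> F (map snd w) \<in> H (word_deg w + 1 + k)"
  by (simp add: graded_def)

lemma graded_Cons: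
  assumes "graded k F" "x \<in> H (e + 1)"
  shows "graded (k + e) (\<lambda>u. F (x # u))"
  unfolding graded_def
proof (intro allI impI)
  fix w assume "hom_word w"
  then show "F (x # map snd w) \<in> H (word_deg w + 1 + (k + e))"
    using gradedD[OF assms(1), of "(e, x) # w"] assms(2) by (simp add: algebra_simps)
qed

definition degree_preserving :: "('v \<Rightarrow> 'v \<Rightarrow> 'v) \<Rightarrow> bool" where
  "degree_preserving f \<longleftrightarrow> (\<forall>a b d e. a \<in> H (d + 1) \<longrightarrow> b \<in> H (e + 1) \<longrightarrow> f a b \<in> H (d + e + 1))"

lemma graded_morph:
  assumes "graded k F" "degree_preserving f"
  shows "graded k (morph f F)"
proof -
  have "morph f F (map snd w) \<in> H (word_deg w + 1 + k)" if "hom_word w" for w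
    using that assms(1)
  proof (induction w arbitrary: F k rule: induct_list012)
    case (3 a b w)
    have 1: "morph f (\<lambda>u. F (snd a # u)) (map snd (b # w)) \<in> H (word_deg (b # w) + 1 + (k + fst a))"
      by (rule 3(2)) (use 3(3,4) in \<open>auto intro: graded_Cons\<close>)
    have "f (snd a) (snd b) \<in> H ((fst a + fst b) + 1)"
      using 3(3) assms(2) by (simp add: degree_preserving_def)
    then have 2: "morph f (\<lambda>u. F (f (snd a) (snd b) # u)) (map snd w) \<in> H (word_deg w + 1 + (k + (fst a + fst b)))"
      by (intro 3(1)) (use 3(3,4) in \<open>auto intro: graded_Cons\<close>)
    show ?case using component_add[of _ "word_deg (a # b # w) + 1 + k"] 1 2 by (simp add: algebra_simps)
  qed (use gradedD[of _ _ "[]"] gradedD[of _ _ "[a]" for a] in auto)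
  then show ?thesis by (simp add: graded_def)
qed

lemma split_sum_mem: "(\<And>u v. u @ v = w \<Longrightarrow> K u v \<in> H d) \<Longrightarrow> split_sum K w \<in> H d"
proof (induction w arbitrary: K)
  case (Cons a w)
  have "split_sum (\<lambda>u v. K (a # u) v) w \<in> H d" by (rule Cons.IH) (simp add: Cons.prems)
  then show ?case by (simp add: Cons.prems component_add)
qed simp

lemma graded_coder:
  assumes "graded k F" and A: "graded 1 A" and t: "\<And>x d. x \<in> H d \<Longrightarrow> t x \<in> H d"
  shows "graded (k + 1) (coder t A F)"
proof -
  have "coder t A F (map snd w) \<in> H (word_deg w + 1 + (k + 1))" if "hom_word w" for w
    using that assms(1)
  proof (induction w arbitrary: F k)
    case Nil
    have "A [] \<in> H (1 + 1)" using gradedD[OF A, of "[]"] by simp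
    then show ?case using gradedD[OF Nil(2), of "[(1, A [])]"] by (simp add: algebra_simps)
  next
    case (Cons a w)
    have 1: "split_sum (\<lambda>u v. F (A u # v)) (map snd (a # w)) \<in> H (word_deg (a # w) + 1 + (k + 1))"
      unfolding split_sum_map
    proof (rule split_sum_mem)
      fix u v assume uv: "u @ v = a # w"
      then have w: "word_deg (a # w) = word_deg u + word_deg v" by (metis word_deg_simps(3))
      have g: "hom_word u" "hom_word v" using Cons(2) uv hom_word_simps(3) by metis+
      have "A (map snd u) \<in> H ((word_deg u + 1) + 1)"
        using gradedD[OF A g(1)] by simp
      with g have "hom_word ((word_deg u + 1, A (map snd u)) # v)" by simp
      from gradedD[OF Cons(3) this]
      show "F (A (map snd u) # map snd v) \<in> H (word_deg (a # w) + 1 + (k + 1))"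
        by (simp add: w algebra_simps del: word_deg_simps(2)) (simp add: algebra_simps)
    qed
    have "coder t A (\<lambda>u. F (t (snd a) # u)) (map snd w) \<in> H (word_deg w + 1 + (k + fst a + 1))"
      by (rule Cons(1)) (use Cons(2,3) t in \<open>auto intro: graded_Cons\<close>)
    with 1 show ?case
      using component_add[of _ "word_deg (a # w) + 1 + (k + 1)"] by (simp add: algebra_simps del: split_sum.simps)
  qed
  then show ?thesis by (simp add: graded_def)
qed

lemma graded_proj_letter: "graded 0 proj_letter"
  unfolding graded_def
proof (intro allI impI)
  fix w assume "hom_word w"
  then show "proj_letter (map snd w) \<in> H (word_deg w + 1 + 0)"
    by (cases w rule: remdups_adj.cases) (auto simp: proj_letter_def component_0)
qed

lemma graded_minus: "graded k F \<Longrightarrow> graded k G \<Longrightarrow> graded k (\<lambda>u. F u - G u)"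
  by (auto simp: graded_def intro!: subspace_diff[OF subspace_component])

lemma graded_morph_inv:
  assumes "graded k G" "degree_preserving f"
  shows "graded k (morph_inv f G)"
proof -
  have N: "graded k ((morph_defect f ^^ n) G)" for n
  proof (induction n)
    case (Suc n)
    have "(morph_defect f ^^ Suc n) G = (\<lambda>u. (morph_defect f ^^ n) G u - morph f ((morph_defect f ^^ n) G) u)"
      by (rule ext) (simp add: morph_defect_def[of f "(morph_defect f ^^ n) G"])
    with Suc assms(2) show ?case by (simp only: graded_minus graded_morph)
  qed (use assms in simp)
  then show ?thesis
    by (auto simp: graded_def morph_inv_def intro!: component_sum)
qed

lemma length_koszul_twist [simp]: "length (koszul_twist H w) = length w"
  by (induction w) auto

lemma koszul_twist_twist [simp]: "koszul_twist H (koszul_twist H w) = w"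
  by (induction w) (auto simp: degree_sign_degree_sign)

lemma multilin_twist:
  "multilin F \<Longrightarrow> multilin (\<lambda>w. F (koszul_twist H w))"
proof -
  have "klinear (\<lambda>x. F (koszul_twist H (xs @ x # ys)))" if "multilin F" for xs ys
    using that
  proof (induction xs arbitrary: F)
    case Nil
    show ?case
      using linear_comp[OF multilin_hd[OF Nil] linear_degree_sign] by simp
  next
    case (Cons a xs)
    show ?case using Cons(1)[OF multilin_Cons[OF Cons(2)]] by simp
  qed
  then show "multilin F \<Longrightarrow> multilin (\<lambda>w. F (koszul_twist H w))" by (simp add: multilin_def)
qed

text \<open>
  The exponent in \<open>s\<^sup>\<otimes>\<^sup>n(x\<^sub>1, \<dots>, x\<^sub>n) = \<plusminus>(s x\<^sub>1, \<dots>, s x\<^sub>n)\<close>.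
\<close>

fun twist_exp :: "(int \<times> 'v) list \<Rightarrow> int" where
  "twist_exp [] = 0"
| "twist_exp (a # w) = int (length w) * (fst a + 1) + twist_exp w"

lemma twist_hom_word: "multilin F \<Longrightarrow> hom_word w \<Longrightarrow> F (koszul_twist H (map snd w)) = signed (twist_exp w) (F (map snd w))"
proof (induction w arbitrary: F)
  case (Cons a w)
  then show ?case
    using Cons(1)[OF multilin_Cons[OF Cons(2)]]
    by (simp add: degree_sign_homogeneous[of _ "fst a + 1"] multiadd_hd_signed[OF multilin_multiadd] add.commute)
qed simp

text \<open>
  All operations of a family, suspended and put together to the projection to letters of the
  corresponding coalgebra map or coderivation.
\<close>

definition susp_total :: "(nat \<Rightarrow> 'v list \<Rightarrow> 'v) \<Rightarrow> 'v list \<Rightarrow> 'v" where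
  "susp_total m w = susp H (m (length w)) w"

lemma multilin_family:
  assumes "\<And>n. n \<ge> 1 \<Longrightarrow> multilinear scale n (m n)"
  shows "multilin (\<lambda>w. m (length w) w)"
  unfolding multilin_def
proof (intro allI linearI')
  fix xs ys :: "'v list" and x y c
  let ?n = "Suc (length xs + length ys)"
  show "m (length (xs @ (x + y) # ys)) (xs @ (x + y) # ys) =
      m (length (xs @ x # ys)) (xs @ x # ys) + m (length (xs @ y # ys)) (xs @ y # ys)"
    "m (length (xs @ scale c x # ys)) (xs @ scale c x # ys) = scale c (m (length (xs @ x # ys)) (xs @ x # ys))"
    using assms[of ?n] by (simp_all add: multilinear_def)
qed

lemma multilin_susp_total: "(\<And>n. n \<ge> 1 \<Longrightarrow> multilinear scale n (m n)) \<Longrightarrow> multilin (susp_total m)"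
  using multilin_twist[OF multilin_family, of m] by (simp add: susp_total_def[abs_def] susp_def)

lemma multilinear_arity_part:
  assumes "multilin F"
  shows "multilinear scale n (\<lambda>xs. if length xs = n then F xs else 0)"
  using linear_add'[OF multilin_linear[OF assms]] linear_scale'[OF multilin_linear[OF assms]]
  by (auto simp: multilinear_def)

lemma split_sum_sum: "split_sum K w = (\<Sum>i\<le>length w. K (take i w) (drop i w))"
  by (induction w arbitrary: K) (simp_all add: sum.atMost_Suc_shift del: sum.atMost_Suc)

lemma coder_sum: "coder t A F w = (\<Sum>r\<le>length w. \<Sum>l\<le>length w - r.
    F (map t (take r w) @ A (take l (drop r w)) # drop (r + l) w))"
proof (induction w arbitrary: F)
  case (Cons a w)
  have "coder t A F (a # w) = (\<Sum>l\<le>length (a # w). F (A (take l (a # w)) # drop l (a # w)))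
      + coder t A (\<lambda>u. F (t a # u)) w"
    by (simp add: split_sum_sum del: split_sum.simps)
  also have "\<dots> = (\<Sum>r\<le>Suc (length w). \<Sum>l\<le>length (a # w) - r.
    F (map t (take r (a # w)) @ A (take l (drop r (a # w))) # drop (r + l) (a # w)))"
    unfolding Cons by (simp add: sum.atMost_Suc_shift del: sum.atMost_Suc)
  finally show ?case by simp
qed simp

lemma triangle_sum:
  fixes X :: "nat \<Rightarrow> nat \<Rightarrow> 'w::comm_monoid_add"
  assumes "\<And>r. X r 0 = 0"
  shows "(\<Sum>l=1..n. \<Sum>r | r + l \<le> n. X r l) = (\<Sum>r\<le>n. \<Sum>l\<le>n - r. X r l)"
proof -
  have "(\<Sum>l=1..n. \<Sum>r | r + l \<le> n. X r l) = (\<Sum>l\<le>n. \<Sum>r | r + l \<le> n. X r l)"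
  proof (rule sum.mono_neutral_left)
    show "\<forall>l\<in>{..n} - {1..n}. (\<Sum>r | r + l \<le> n. X r l) = 0"
    proof
      fix l assume "l \<in> {..n} - {1..n}"
      then have "l = 0" by auto
      then show "(\<Sum>r | r + l \<le> n. X r l) = 0" by (simp add: assms)
    qed
  qed auto
  also have "\<dots> = (\<Sum>l\<le>n. \<Sum>r\<le>n. if r + l \<le> n then X r l else 0)"
    by (intro sum.cong refl sum.mono_neutral_cong_left) auto
  also have "\<dots> = (\<Sum>r\<le>n. \<Sum>l\<le>n. if r + l \<le> n then X r l else 0)"
    by (rule sum.swap)
  also have "\<dots> = (\<Sum>r\<le>n. \<Sum>l\<le>n - r. X r l)"
    by (intro sum.cong refl sum.mono_neutral_cong_right) auto
  finally show ?thesis .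
qed

text \<open>The sign for moving an operator of degree one past a letter of \<open>sH\<close>.\<close>

abbreviation "letter_sign \<equiv> degree_sign H 1 (-1)"

text \<open>
  The left hand sides of the \<open>C\<^sub>\<infinity>\<close>-relations and of the morphism equation are pullbacks along a
  coderivation; both are sums over the position and the length of the inserted block.
\<close>

lemma insertion_coder:
  assumes A0: "A 0 = (\<lambda>_. 0)" and M: "multilin (susp_total M)"
  shows "(\<Sum>l=1..length xs. insertion H 1 l (susp H (M (length xs + 1 - l))) (susp H (A l)) xs) =
    coder letter_sign (susp_total A) (susp_total M) xs"
proof -
  let ?X = "\<lambda>r l. susp_total M (map letter_sign (take r xs) @ susp_total A (take l (drop r xs)) # drop (r + l) xs)"
  have "(\<Sum>l=1..length xs. insertion H 1 l (susp H (M (length xs + 1 - l))) (susp H (A l)) xs) =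
     (\<Sum>l=1..length xs. \<Sum>r | r + l \<le> length xs. ?X r l)"
  proof (intro sum.cong refl)
    fix l assume l: "l \<in> {1..length xs}"
    show "insertion H 1 l (susp H (M (length xs + 1 - l))) (susp H (A l)) xs = (\<Sum>r | r + l \<le> length xs. ?X r l)"
      unfolding insertion_def
    proof (intro sum.cong refl)
      fix r assume "r \<in> {r. r + l \<le> length xs}"
      then have "length (take l (drop r xs)) = l"
        "length (map letter_sign (take r xs) @ susp_total A (take l (drop r xs)) # drop (r + l) xs) = length xs + 1 - l"
        using l by auto
      then show "susp H (M (length xs + 1 - l))
          (map letter_sign (take r xs) @ susp H (A l) (take l (drop r xs)) # drop (r + l) xs) = ?X r l"
        by (simp only: susp_total_def)
    qed
  qed
  also have "\<dots> = (\<Sum>r\<le>length xs. \<Sum>l\<le>length xs - r. ?X r l)"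
  proof (rule triangle_sum)
    fix r
    have "susp_total A [] = 0" by (simp add: susp_total_def susp_def A0)
    then show "?X r 0 = 0"
      using multiadd_zero[OF multilin_multiadd[OF M], of "map letter_sign (take r xs)"] by simp
  qed
  also have "\<dots> = coder letter_sign (susp_total A) (susp_total M) xs"
    by (rule coder_sum[symmetric])
  finally show ?thesis .
qed

definition compositions :: "nat \<Rightarrow> nat list set" where
  "compositions n = {c. sum_list c = n \<and> 0 \<notin> set c}"

lemma compositions_0: "compositions 0 = {[]}"
proof -
  have "c = []" if "c \<in> compositions 0" for c
    using that by (cases c) (auto simp: compositions_def)
  then show ?thesis by (auto simp: compositions_def)
qed

lemma compositions_Suc: "compositions (Suc n) = (\<lambda>(i, c). i # c) ` (SIGMA i:{1..Suc n}. compositions (Suc n - i))"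
proof (intro equalityI subsetI)
  fix c assume "c \<in> compositions (Suc n)"
  then show "c \<in> (\<lambda>(i, c). i # c) ` (SIGMA i:{1..Suc n}. compositions (Suc n - i))"
    by (cases c) (auto simp: compositions_def image_iff)
qed (auto simp: compositions_def)

lemma finite_compositions: "finite (compositions n)"
proof (induction n rule: less_induct)
  case (less n)
  then show ?case
    by (cases n) (auto simp: compositions_0 compositions_Suc intro!: finite_imageI finite_SigmaI)
qed

lemma sum_compositions_Suc: "(\<Sum>c\<in>compositions (Suc n). G c) = (\<Sum>i=1..Suc n. \<Sum>c\<in>compositions (Suc n - i). G (i # c))"
proof -
  have "inj_on (\<lambda>(i, c). i # c) (SIGMA i:{1..Suc n}. compositions (Suc n - i))"
    by (auto simp: inj_on_def)
  then show ?thesis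
    unfolding compositions_Suc by (simp add: sum.reindex sum.Sigma finite_compositions split_def del: sum.cl_ivl_Suc)
qed

lemma length_blocks [simp]: "length (blocks c xs) = length c"
  by (induction c xs rule: blocks.induct) auto

text \<open>
  If the components \<open>p\<close> of a coalgebra map vanish from arity three on, only blocks of length one and
  two contribute, and the sum over all compositions collapses to the recursion of \<open>morph\<close>.
\<close>

lemma compositions_morph:
  assumes F: "multiadd F" and p1: "\<And>a. p [a] = a" and p2: "\<And>a b. p [a, b] = f a b"
    and p3: "\<And>ys. length ys \<ge> 3 \<Longrightarrow> p ys = 0"
  shows "(\<Sum>c\<in>compositions (length w). F (map p (blocks c w))) = morph f F w"
  using F
proof (induction w arbitrary: F rule: induct_list012)
  case 1
  show ?case by (simp add: compositions_0)
next
  case (2 a)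
  show ?case by (simp add: compositions_0 sum_compositions_Suc p1)
next
  case (3 a b w)
  let ?n = "Suc (length w)" and ?w = "a # b # w"
  have "(\<Sum>c\<in>compositions (length ?w). F (map p (blocks c ?w))) =
    (\<Sum>i=1..Suc ?n. \<Sum>c\<in>compositions (Suc ?n - i). F (p (take i ?w) # map p (blocks c (drop i ?w))))"
    by (simp add: sum_compositions_Suc)
  also have "\<dots> = (\<Sum>i\<in>{1,2}. \<Sum>c\<in>compositions (Suc ?n - i). F (p (take i ?w) # map p (blocks c (drop i ?w))))"
  proof (rule sum.mono_neutral_right)
    show "\<forall>i\<in>{1..Suc ?n} - {1, 2}. (\<Sum>c\<in>compositions (Suc ?n - i). F (p (take i ?w) # map p (blocks c (drop i ?w)))) = 0"
    proof
      fix i assume "i \<in> {1..Suc ?n} - {1, 2}"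
      then have "p (take i ?w) = 0" by (intro p3) auto
      then show "(\<Sum>c\<in>compositions (Suc ?n - i). F (p (take i ?w) # map p (blocks c (drop i ?w)))) = 0"
        using 3(3) by (simp add: multiadd_hd_zero)
    qed
  qed auto
  also have "\<dots> = morph f F ?w"
    using 3(1)[of "\<lambda>u. F (f a b # u)"] 3(2)[of "\<lambda>u. F (a # u)"] 3(3)
    by (simp add: p1 p2 multiadd_Cons numeral_2_eq_2)
  finally show ?case .
qed

end

section \<open>Shuffle permutations and the shuffle recursion\<close>

text \<open>
  The Koszul exponent of a word of indices, summed over its inversions. For the word that lists the
  letters of a shuffled word by their original index this is the exponent of the shuffle.
\<close>

fun inversion_exp :: "(nat \<Rightarrow> int) \<Rightarrow> nat list \<Rightarrow> int" where
  "inversion_exp e [] = 0"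
| "inversion_exp e (i # w) = (\<Sum>j\<leftarrow>w. if j < i then e i * e j else 0) + inversion_exp e w"

lemma inversion_exp_sum:
  "inversion_exp e w = (\<Sum>k<length w. \<Sum>l<length w. if k < l \<and> w ! l < w ! k then e (w ! k) * e (w ! l) else 0)"
proof (induction w)
  case (Cons i w)
  have "(\<Sum>j\<leftarrow>w. if j < i then e i * e j else 0) = (\<Sum>l<length w. if w ! l < i then e i * e (w ! l) else 0)"
    by (simp add: sum_list_sum_nth atLeast0LessThan)
  then show ?case
    by (simp add: Cons sum.lessThan_Suc_shift del: sum.lessThan_Suc cong: if_cong)
qed simp

lemma inversion_exp_sorted: "sorted_wrt (<) w \<Longrightarrow> inversion_exp e w = 0"
proof (induction w)
  case (Cons i w)
  then have "map (\<lambda>j. if j < i then e i * e j else 0) w = map (\<lambda>_. 0) w" by (auto simp: not_less_iff_gr_or_eq)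
  then show ?case using Cons by (simp only: inversion_exp.simps) simp
qed simp

lemma inversion_exp_cong: "(\<And>i. i \<in> set w \<Longrightarrow> e i = e' i) \<Longrightarrow> inversion_exp e w = inversion_exp e' w"
proof (induction w)
  case (Cons i w)
  have "(\<Sum>j\<leftarrow>w. if j < i then e i * e j else 0) = (\<Sum>j\<leftarrow>w. if j < i then e' i * e' j else 0)"
    by (intro arg_cong[where f = sum_list] map_cong refl) (simp add: Cons.prems)
  then show ?case using Cons by simp
qed simp

text \<open>
  The recursion of \<open>shuffles\<close> on lists of indices is that of \<open>shuf\<close>. Moving an index \<open>j\<close> of the
  second list to the front creates exactly the inversions with the indices of the first list.
\<close>

lemma sum_shuffles:
  assumes "sorted_wrt (<) is" "sorted_wrt (<) js" "\<forall>i\<in>set is. \<forall>j\<in>set js. i < j"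
  shows "(\<Sum>w\<in>shuffles is js. signed (inversion_exp e w) (F (map g w))) =
    shuf F (map (\<lambda>i. (e i, g i)) is) (map (\<lambda>i. (e i, g i)) js)"
  using assms
proof (induction "is" js arbitrary: F rule: shuffles.induct)
  case (1 js)
  then show ?case by (simp add: inversion_exp_sorted comp_def)
next
  case (2 "is")
  then show ?case
    using inversion_exp_sorted[OF 2(1), of e]
    by (cases "is") (simp_all add: comp_def del: inversion_exp.simps(2))
next
  case (3 i "is" j js)
  have ij: "i < j" using 3 by auto
  let ?A = "shuffles is (j # js)" and ?B = "shuffles (i # is) js"
  have A: "inversion_exp e (i # w) = inversion_exp e w" if "w \<in> ?A" for w
  proof -
    have "set w = set is \<union> set (j # js)" using that by (rule set_shuffles)
    then have "map (\<lambda>j. if j < i then e i * e j else 0) w = map (\<lambda>_. 0) w"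
      using 3(3,5) by (fastforce dest: less_asym)
    then show ?thesis by (simp only: inversion_exp.simps) simp
  qed
  have B: "inversion_exp e (j # w) = e j * sum_list (map e (i # is)) + inversion_exp e w" if w: "w \<in> ?B" for w
  proof -
    have s: "set w = set (i # is) \<union> set js" using w by (rule set_shuffles)
    have d: "distinct (i # is)" "distinct js"
      using 3(3,4) by (auto simp: strict_sorted_iff)
    have disj: "set (i # is) \<inter> set js = {}" using 3(5) by fastforce
    have dw: "distinct w"
      by (rule distinct_disjoint_shuffles[OF d disj w])
    have "(\<Sum>k\<leftarrow>w. if k < j then e j * e k else 0) = (\<Sum>k\<in>set w. if k < j then e j * e k else 0)"
      using dw by (simp add: sum.distinct_set_conv_list)
    also have "\<dots> = (\<Sum>k\<in>set (i # is). e j * e k)"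
    proof (rule sum.mono_neutral_cong_right)
      show "\<forall>k\<in>set w - set (i # is). (if k < j then e j * e k else 0) = 0"
        using s 3(4) by (auto dest: less_asym)
    qed (use s 3(5) in auto)
    also have "\<dots> = e j * sum_list (map e (i # is))"
      using d by (simp only: sum_distrib_left[symmetric] sum.distinct_set_conv_list)
    finally show ?thesis by simp
  qed
  have "(\<Sum>w\<in>shuffles (i # is) (j # js). signed (inversion_exp e w) (F (map g w))) =
    (\<Sum>w\<in>(#) i ` ?A. signed (inversion_exp e w) (F (map g w))) + 
    (\<Sum>w\<in>(#) j ` ?B. signed (inversion_exp e w) (F (map g w)))"
    unfolding shuffles.simps by (rule sum.union_disjoint) (use ij in auto)
  also have "(\<Sum>w\<in>(#) i ` ?A. signed (inversion_exp e w) (F (map g w))) =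
    (\<Sum>w\<in>?A. signed (inversion_exp e w) (F (g i # map g w)))"
    by (subst sum.reindex) (use A in auto)
  also have "(\<Sum>w\<in>(#) j ` ?B. signed (inversion_exp e w) (F (map g w))) =
    (\<Sum>w\<in>?B. signed (e j * sum_list (map e (i # is))) (signed (inversion_exp e w) (F (g j # map g w))))"
    by (subst sum.reindex) (use B in auto)
  also have "\<dots> = signed (e j * sum_list (map e (i # is))) (\<Sum>w\<in>?B. signed (inversion_exp e w) (F (g j # map g w)))"
    by (simp add: signed_def sum_negf)
  finally show ?case
    using 3(1)[of "\<lambda>u. F (g i # u)"] 3(2)[of "\<lambda>u. F (g j # u)"] 3(3-5)
    by (simp add: word_deg_def comp_def del: shuffles.simps)
qed

text \<open>
  The word obtained from \<open>0 1 \<dots> n-1\<close> by moving the letter \<open>i\<close> to position \<open>\<sigma> i\<close>.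
\<close>

definition shuffle_word :: "nat \<Rightarrow> (nat \<Rightarrow> nat) \<Rightarrow> nat list" where
  "shuffle_word n \<sigma> = map (inv \<sigma>) [0..<n]"

lemma sorted_shuffle_word:
  assumes "\<sigma> permutes {..<n}"
  shows "sorted_wrt (\<lambda>i j. \<sigma> i < \<sigma> j) (shuffle_word n \<sigma>)"
  using permutes_inverses(1)[OF assms] by (auto simp: shuffle_word_def sorted_wrt_iff_nth_less)

lemma set_shuffle_word: "\<sigma> permutes {..<n} \<Longrightarrow> set (shuffle_word n \<sigma>) = {..<n}"
  using permutes_image[OF permutes_inv, of \<sigma> "{..<n}"]
  by (simp add: shuffle_word_def atLeast0LessThan flip: lessThan_atLeast0)

text \<open>
  A permutation is determined by its word. Monotonicity of \<open>\<sigma>\<close> on the two blocks means that the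
  indices of each block occur in the word in increasing order, which characterises the
  interleavings of the two lists.
\<close>

lemma bij_shuffle_word:
  "bij_betw (shuffle_word (p + q)) (shuffle_perms p q) (shuffles [0..<p] [p..<p + q])"
  unfolding bij_betw_def
proof (intro conjI equalityI subsetI)
  let ?n = "p + q"
  show "inj_on (shuffle_word ?n) (shuffle_perms p q)"
  proof (rule inj_onI)
    fix \<sigma> \<tau> assume \<sigma>: "\<sigma> \<in> shuffle_perms p q" and \<tau>: "\<tau> \<in> shuffle_perms p q"
      and eq: "shuffle_word ?n \<sigma> = shuffle_word ?n \<tau>"
    have perm: "\<sigma> permutes {..<?n}" "\<tau> permutes {..<?n}"
      using \<sigma> \<tau> by (auto simp: shuffle_perms_def)
    have "inv \<sigma> k = inv \<tau> k" for k
    proof (cases "k < ?n")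
      case True
      then show ?thesis using eq by (simp add: shuffle_word_def)
    next
      case False
      then show ?thesis
        using permutes_not_in[OF permutes_inv[OF perm(1)]] permutes_not_in[OF permutes_inv[OF perm(2)]] by simp
    qed
    then have "inv \<sigma> = inv \<tau>" by (rule ext)
    then show "\<sigma> = \<tau>"
      using permutes_inv_inv[OF perm(1)] permutes_inv_inv[OF perm(2)] by metis
  qed
next
  let ?n = "p + q"
  fix w assume "w \<in> shuffle_word ?n ` shuffle_perms p q"
  then obtain \<sigma> where w: "w = shuffle_word ?n \<sigma>" and "\<sigma> \<in> shuffle_perms p q" by auto
  then have perm: "\<sigma> permutes {..<?n}" and mono: "strict_mono_on {..<p} \<sigma>" "strict_mono_on {p..<?n} \<sigma>"
    by (auto simp: shuffle_perms_def)
  have srt: "sorted_wrt (\<lambda>i j. \<sigma> i < \<sigma> j) w" unfolding w by (rule sorted_shuffle_word[OF perm])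
  have st: "set w = {..<?n}" unfolding w by (rule set_shuffle_word[OF perm])
  have *: "sorted_wrt (<) (filter P w)" if "strict_mono_on {i. i < ?n \<and> P i} \<sigma>" for P
  proof (rule sorted_wrt_mono_rel[OF _ sorted_wrt_filter[OF srt]])
    fix i j assume "i \<in> set (filter P w)" "j \<in> set (filter P w)" "\<sigma> i < \<sigma> j"
    then show "i < j"
      using that strict_mono_onD[OF that, of j i] st by (cases i j rule: linorder_cases) auto
  qed
  have "filter (\<lambda>i. i < p) w = [0..<p]"
  proof (rule strict_sorted_equal)
    show "sorted_wrt (<) (filter (\<lambda>i. i < p) w)" 
      by (rule *[OF monotone_on_subset[OF mono(1)]]) auto
    show "set (filter (\<lambda>i. i < p) w) = set [0..<p]" unfolding set_filter st by auto
  qed simp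
  moreover have "filter (\<lambda>i. \<not> i < p) w = [p..<?n]"
  proof (rule strict_sorted_equal)
    show "sorted_wrt (<) (filter (\<lambda>i. \<not> i < p) w)" 
      by (rule *[OF monotone_on_subset[OF mono(2)]]) auto
    show "set (filter (\<lambda>i. \<not> i < p) w) = set [p..<?n]" unfolding set_filter st by auto
  qed simp
  ultimately show "w \<in> shuffles [0..<p] [p..<?n]"
    using partition_in_shuffles[of w "\<lambda>i. i < p"] by simp
next
  let ?n = "p + q"
  fix w assume w: "w \<in> shuffles [0..<p] [p..<?n]"
  have disj: "set [0..<p] \<inter> set [p..<?n] = {}" by auto
  have d: "distinct w" by (rule distinct_disjoint_shuffles[OF _ _ disj w]) auto
  have st: "set w = {..<?n}" unfolding set_shuffles[OF w] by auto
  have len: "length w = ?n" using length_shuffles[OF w] by simp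
  (* The permutation is built from its inverse, which reads off the word. *)
  define \<tau> where "\<tau> k = (if k < ?n then w ! k else k)" for k
  have "bij_betw ((!) w) {..<?n} {..<?n}"
    by (rule bij_betw_nth[OF d]) (simp_all only: st len)
  then have "bij_betw \<tau> {..<?n} {..<?n}"
    by (rule bij_betw_cong[THEN iffD1, rotated]) (simp add: \<tau>_def)
  then have \<tau>: "\<tau> permutes {..<?n}"
    by (rule bij_imp_permutes) (simp add: \<tau>_def)
  define \<sigma> where "\<sigma> = inv \<tau>"
  have perm: "\<sigma> permutes {..<?n}" unfolding \<sigma>_def by (rule permutes_inv[OF \<tau>])
  have inv: "inv \<sigma> = \<tau>" unfolding \<sigma>_def by (rule permutes_inv_inv[OF \<tau>])
  have word: "shuffle_word ?n \<sigma> = w"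
    unfolding shuffle_word_def inv by (rule nth_equalityI) (use len in \<open>auto simp: \<tau>_def\<close>)
  have srt: "sorted_wrt (\<lambda>i j. \<sigma> i < \<sigma> j) w"
    using sorted_shuffle_word[OF perm] word by simp
  have "filter (\<lambda>x. x \<in> set [0..<p]) w = [0..<p]" "filter (\<lambda>x. x \<notin> set [0..<p]) w = [p..<?n]"
    using filter_shuffles_disjoint1[OF disj w] by auto
  then have 1: "sorted_wrt (\<lambda>i j. \<sigma> i < \<sigma> j) [0..<p]" and 2: "sorted_wrt (\<lambda>i j. \<sigma> i < \<sigma> j) [p..<?n]"
    using sorted_wrt_filter[OF srt, of "\<lambda>x. x \<in> set [0..<p]"]
      sorted_wrt_filter[OF srt, of "\<lambda>x. x \<notin> set [0..<p]"] by (simp_all only:)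
  have "strict_mono_on {..<p} \<sigma>"
    using sorted_wrt_nth_less[OF 1] by (intro strict_mono_onI) auto
  moreover have "strict_mono_on {p..<?n} \<sigma>"
  proof (rule strict_mono_onI)
    fix i j assume "i \<in> {p..<?n}" "j \<in> {p..<?n}" "i < j"
    then show "\<sigma> i < \<sigma> j"
      using sorted_wrt_nth_less[OF 2, of "i - p" "j - p"] by (auto simp: less_diff_iff)
  qed
  ultimately have "\<sigma> \<in> shuffle_perms p q" using perm by (simp add: shuffle_perms_def)
  then show "w \<in> shuffle_word ?n ` shuffle_perms p q" 
    using word imageI[of \<sigma> "shuffle_perms p q" "shuffle_word ?n"] by simp
qed

lemma koszul_exp_word:
  assumes "\<sigma> permutes {..<length ds}"
  shows "shifted_koszul_exp \<sigma> ds = inversion_exp (\<lambda>i. ds ! i - 1) (shuffle_word (length ds) \<sigma>)"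
proof -
  let ?n = "length ds" and ?\<tau> = "inv \<sigma>"
  let ?c = "\<lambda>i j. (ds ! i - 1) * (ds ! j - 1)"
  have \<tau>: "bij_betw ?\<tau> {..<?n} {..<?n}" by (rule permutes_imp_bij[OF permutes_inv[OF assms]])
  have \<sigma>\<tau>: "\<sigma> (?\<tau> k) = k" for k using permutes_inverses(1)[OF assms] .
  have "shifted_koszul_exp \<sigma> ds = (\<Sum>(i, j)\<in>{..<?n} \<times> {..<?n}. if i < j \<and> \<sigma> j < \<sigma> i then ?c i j else 0)"
    unfolding shifted_koszul_exp_def
    by (rule sum.mono_neutral_cong_left) (auto split: if_splits)
  also have "\<dots> = (\<Sum>i<?n. \<Sum>j<?n. if i < j \<and> \<sigma> j < \<sigma> i then ?c i j else 0)"
    by (rule sum.cartesian_product[symmetric])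
  also have "\<dots> = (\<Sum>i<?n. \<Sum>k<?n. if i < ?\<tau> k \<and> k < \<sigma> i then ?c i (?\<tau> k) else 0)"
    by (rule sum.cong[OF refl], subst sum.reindex_bij_betw[OF \<tau>, symmetric]) (simp add: \<sigma>\<tau>)
  also have "\<dots> = (\<Sum>l<?n. \<Sum>k<?n. if ?\<tau> l < ?\<tau> k \<and> k < l then ?c (?\<tau> l) (?\<tau> k) else 0)"
    by (subst sum.reindex_bij_betw[OF \<tau>, symmetric]) (simp add: \<sigma>\<tau>)
  also have "\<dots> = (\<Sum>k<?n. \<Sum>l<?n. if ?\<tau> l < ?\<tau> k \<and> k < l then ?c (?\<tau> l) (?\<tau> k) else 0)"
    by (rule sum.swap)
  also have "\<dots> = inversion_exp (\<lambda>i. ds ! i - 1) (shuffle_word ?n \<sigma>)"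
    unfolding inversion_exp_sum
    by (intro sum.cong) (auto simp: shuffle_word_def mult.commute)
  finally show ?thesis .
qed

lemma permuted_word_word:
  "length xs = n \<Longrightarrow> permuted_word \<sigma> xs = map ((!) xs) (shuffle_word n \<sigma>)"
  by (simp add: permuted_word_def shuffle_word_def)

lemma shuffle_sum_shuf:
  assumes "length x = p" "length y = q"
  shows "(\<Sum>\<sigma>\<in>shuffle_perms p q. signed (shifted_koszul_exp \<sigma> (map (\<lambda>a. fst a + 1) (x @ y)))
      (F (permuted_word \<sigma> (map snd (x @ y))))) = shuf F x y"
proof -
  let ?n = "p + q" and ?z = "x @ y"
  let ?e = "\<lambda>i. fst (?z ! i)" and ?g = "\<lambda>i. snd (?z ! i)"
  have len: "length ?z = ?n" using assms by simp
  have e: "inversion_exp (\<lambda>i. map (\<lambda>a. fst a + 1) ?z ! i - 1) w = inversion_exp ?e w"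
    "map ((!) (map snd ?z)) w = map ?g w" if "set w \<subseteq> {..<?n}" for w
    using that len by (auto intro!: inversion_exp_cong simp del: map_append)
  have "(\<Sum>\<sigma>\<in>shuffle_perms p q. signed (shifted_koszul_exp \<sigma> (map (\<lambda>a. fst a + 1) ?z))
      (F (permuted_word \<sigma> (map snd ?z)))) =
    (\<Sum>\<sigma>\<in>shuffle_perms p q. signed (inversion_exp ?e (shuffle_word ?n \<sigma>)) (F (map ?g (shuffle_word ?n \<sigma>))))"
  proof (rule sum.cong[OF refl])
    fix \<sigma> assume "\<sigma> \<in> shuffle_perms p q"
    then have perm: "\<sigma> permutes {..<?n}" by (simp add: shuffle_perms_def)
    then have "set (shuffle_word ?n \<sigma>) \<subseteq> {..<?n}" by (simp add: set_shuffle_word)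
    note e = e[OF this]
    have "permuted_word \<sigma> (map snd ?z) = map ?g (shuffle_word ?n \<sigma>)"
      using permuted_word_word[of "map snd ?z" ?n \<sigma>] len e(2) by simp
    moreover have "shifted_koszul_exp \<sigma> (map (\<lambda>a. fst a + 1) ?z) = inversion_exp ?e (shuffle_word ?n \<sigma>)"
      using koszul_exp_word[of \<sigma> "map (\<lambda>a. fst a + 1) ?z"] perm len e(1) by (simp del: map_append)
    ultimately show "signed (shifted_koszul_exp \<sigma> (map (\<lambda>a. fst a + 1) ?z)) (F (permuted_word \<sigma> (map snd ?z)))
      = signed (inversion_exp ?e (shuffle_word ?n \<sigma>)) (F (map ?g (shuffle_word ?n \<sigma>)))"
      by simp
  qed
  also have "\<dots> = (\<Sum>w\<in>shuffles [0..<p] [p..<?n]. signed (inversion_exp ?e w) (F (map ?g w)))"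
    by (rule sum.reindex_bij_betw[OF bij_shuffle_word])
  also have "\<dots> = shuf F (map (\<lambda>i. (?e i, ?g i)) [0..<p]) (map (\<lambda>i. (?e i, ?g i)) [p..<?n])"
    by (rule sum_shuffles) auto
  also have "map (\<lambda>i. (?e i, ?g i)) [0..<p] = x"
    using assms by (intro nth_equalityI) (auto simp: nth_append)
  also have "map (\<lambda>i. (?e i, ?g i)) [p..<?n] = y"
    using assms by (intro nth_equalityI) (auto simp: nth_append)
  finally show ?thesis .
qed

context graded_vector_space
begin

lemma homog_hom_word:
  "homog H ds xs \<longleftrightarrow> (\<exists>w. hom_word w \<and> ds = map (\<lambda>a. fst a + 1) w \<and> xs = map snd w)"
proof
  assume "homog H ds xs"
  then have "list_all2 (\<lambda>d x. x \<in> H d) ds xs" by (simp add: homog_def)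
  then show "\<exists>w. hom_word w \<and> ds = map (\<lambda>a. fst a + 1) w \<and> xs = map snd w"
  proof induction
    case (Cons d ds x xs)
    then obtain w where "hom_word w" "ds = map (\<lambda>a. fst a + 1) w" "xs = map snd w" by auto
    with Cons(1) show ?case by (intro exI[of _ "(d - 1, x) # w"]) simp
  qed auto
next
  assume "\<exists>w. hom_word w \<and> ds = map (\<lambda>a. fst a + 1) w \<and> xs = map snd w"
  then show "homog H ds xs"
    by (auto simp: homog_def hom_word_def hom_letter_def list_all2_conv_all_nth list_all_length)
qed

lemma vanishes_on_shuffles_iff:
  "vanishes_on_shuffles H n F \<longleftrightarrow>
    (\<forall>x y. hom_word x \<longrightarrow> hom_word y \<longrightarrow> x \<noteq> [] \<longrightarrow> y \<noteq> [] \<longrightarrow> length x + length y = n \<longrightarrow> shuf F x y = 0)"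
    (is "?L \<longleftrightarrow> ?R")
proof
  assume L: ?L
  show ?R
  proof (intro allI impI)
    fix x y assume *: "hom_word x" "hom_word y" "x \<noteq> []" "y \<noteq> []" "length x + length y = n"
    have "homog H (map (\<lambda>a. fst a + 1) (x @ y)) (map snd (x @ y))"
      unfolding homog_hom_word using * hom_word_simps(3) by blast
    then show "shuf F x y = 0"
      using L * shuffle_sum_shuf[of x "length x" y "length y" F]
      unfolding vanishes_on_shuffles_def by (simp add: Suc_le_eq del: map_append)
  qed
next
  assume R: ?R
  show ?L
    unfolding vanishes_on_shuffles_def
  proof (intro allI impI)
    fix p q ds xs
    assume *: "1 \<le> p" "1 \<le> q" "p + q = n" "length xs = n" "homog H ds xs"
    then obtain w where w: "hom_word w" "ds = map (\<lambda>a. fst a + 1) w" "xs = map snd w"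
      unfolding homog_hom_word by blast
    let ?x = "take p w" and ?y = "drop p w"
    have "hom_word ?x" "hom_word ?y" using w(1) hom_word_simps(3)[of ?x ?y] by simp_all
    moreover have "length ?x = p" "length ?y = q" using * w by auto
    moreover from this have "?x \<noteq> []" "?y \<noteq> []" using * by auto
    ultimately show "(\<Sum>\<sigma>\<in>shuffle_perms p q. signed (shifted_koszul_exp \<sigma> ds) (F (permuted_word \<sigma> xs))) = 0"
      using R *(3) shuffle_sum_shuf[of ?x p ?y q F] by (simp add: w)
  qed
qed

end

section \<open>Transport of a structure along an isotopy with two components\<close>

lemma shuf_cong:
  "(\<And>u. length u = length x + length y \<Longrightarrow> F u = G u) \<Longrightarrow> shuf F x y = shuf G x y"
proof (induction x y arbitrary: F G rule: shuffles.induct)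
  case (3 a x b y)
  have "shuf (\<lambda>u. F (snd a # u)) x (b # y) = shuf (\<lambda>u. G (snd a # u)) x (b # y)"
    "shuf (\<lambda>u. F (snd b # u)) (a # x) y = shuf (\<lambda>u. G (snd b # u)) (a # x) y"
    by (rule 3; simp add: 3)+
  then show ?case by simp
qed simp_all

lemma morph_proj_letter: "morph f proj_letter w =
    (if length w = 1 then hd w else if length w = 2 then f (w ! 0) (w ! 1) else 0)"
proof (cases w rule: remdups_adj.cases)
  case (3 a b w')
  have "morph f (\<lambda>u. proj_letter (c # u)) v = (if v = [] then c else 0)" for c v
    using morph_ne_cong[of "\<lambda>u. proj_letter (c # u)" "\<lambda>_. 0" v f]
    by (cases "v = []") (simp_all add: proj_letter_def)
  then show ?thesis by (auto simp: 3)
qed (simp_all add: proj_letter_def)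

context graded_vector_space
begin

lemma degree_sign_0 [simp]: "degree_sign H 0 s x = x"
  by (simp add: degree_sign_def sum_hcomp)

lemma sum_list_hom_word: "sum_list (map (\<lambda>a. fst a + 1) w) = word_deg w + int (length w)"
  by (induction w) auto

lemma internal_degree_iff:
  "has_internal_degree H n j f \<longleftrightarrow>
    (\<forall>w. hom_word w \<longrightarrow> length w = n \<longrightarrow> f (map snd w) \<in> H (word_deg w + int n + j))"
proof
  assume *: "has_internal_degree H n j f"
  show "\<forall>w. hom_word w \<longrightarrow> length w = n \<longrightarrow> f (map snd w) \<in> H (word_deg w + int n + j)"
  proof (intro allI impI)
    fix w assume w: "hom_word w" "length w = n"
    then have "homog H (map (\<lambda>a. fst a + 1) w) (map snd w)" unfolding homog_hom_word by blast
    with * w have "f (map snd w) \<in> H (sum_list (map (\<lambda>a. fst a + 1) w) + j)"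
      unfolding has_internal_degree_def by (metis length_map)
    then show "f (map snd w) \<in> H (word_deg w + int n + j)" by (simp only: sum_list_hom_word w)
  qed
next
  assume *: "\<forall>w. hom_word w \<longrightarrow> length w = n \<longrightarrow> f (map snd w) \<in> H (word_deg w + int n + j)"
  then show "has_internal_degree H n j f"
    unfolding has_internal_degree_def homog_hom_word by (auto simp: sum_list_hom_word)
qed

definition desusp :: "nat \<Rightarrow> ('v list \<Rightarrow> 'v) \<Rightarrow> 'v list \<Rightarrow> 'v" where
  "desusp n F xs = (if length xs = n then F (koszul_twist H xs) else 0)"

lemma susp_desusp: "length w = n \<Longrightarrow> susp H (desusp n F) w = F w"
  by (simp add: susp_def desusp_def)

lemma desusp_harrison:
  assumes F: "multilin F" and deg: "graded k F" and shuf: "\<And>x y. hom_word x \<Longrightarrow> hom_word y \<Longrightarrow> x \<noteq> [] \<Longrightarrow> y \<noteq> [] \<Longrightarrow> shuf F x y = 0"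
  shows "desusp n F \<in> harrison scale H n (k + 1 - int n)"
  unfolding harrison_def
proof (intro CollectI conjI)
  show "multilinear scale n (desusp n F)"
    using multilinear_arity_part[OF multilin_twist[OF F], of n] by (simp add: desusp_def[abs_def])
  show "has_internal_degree H n (k + 1 - int n) (desusp n F)"
    unfolding internal_degree_iff
  proof (intro allI impI)
    fix w assume w: "hom_word w" "length w = n"
    have "signed (twist_exp w) (F (map snd w)) \<in> H (word_deg w + 1 + k)"
      using gradedD[OF deg w(1)] by (rule component_signed)
    then show "desusp n F (map snd w) \<in> H (word_deg w + int n + (k + 1 - int n))"
      using w twist_hom_word[OF F w(1)] by (simp add: desusp_def algebra_simps)
  qed
  show "vanishes_on_shuffles H n (susp H (desusp n F))"
    unfolding vanishes_on_shuffles_iff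
  proof (intro allI impI)
    fix x y assume *: "hom_word x" "hom_word y" "x \<noteq> []" "y \<noteq> []" "length x + length y = n"
    have "shuf (susp H (desusp n F)) x y = shuf F x y"
      by (rule shuf_cong) (use * in \<open>simp add: susp_desusp\<close>)
    then show "shuf (susp H (desusp n F)) x y = 0" using shuf * by simp
  qed
qed

lemma harrison_multilinear: "f \<in> harrison scale H n j \<Longrightarrow> multilinear scale n f"
  by (simp add: harrison_def)

lemma harrison_hom_word:
  assumes "f \<in> harrison scale H n j" "hom_word w" "length w = n"
  shows "susp H f (map snd w) \<in> H (word_deg w + int n + j)"
proof -
  let ?m = "\<lambda>k. if k = n then f else (\<lambda>_. 0)"
  have "multilin (\<lambda>w. ?m (length w) w)"
    using harrison_multilinear[OF assms(1)] by (intro multilin_family) (auto simp: multilinear_def)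
  from twist_hom_word[OF this assms(2)] have "f (koszul_twist H (map snd w)) = signed (twist_exp w) (f (map snd w))"
    using assms(3) by simp
  moreover have "f (map snd w) \<in> H (word_deg w + int n + j)"
    using assms by (auto simp: harrison_def internal_degree_iff)
  ultimately show ?thesis by (simp add: susp_def component_signed)
qed

lemma harrison_shuf:
  assumes "f \<in> harrison scale H n j" "hom_word x" "hom_word y" "x \<noteq> []" "y \<noteq> []" "length x + length y = n"
  shows "shuf (susp H f) x y = 0"
  using assms by (simp add: harrison_def vanishes_on_shuffles_iff)

lemma
  assumes m0: "m 0 = (\<lambda>_. 0)" and m: "\<And>n. n \<ge> 1 \<Longrightarrow> m n \<in> harrison scale H n (k + 1 - int n)"
  shows susp_total_Nil: "susp_total m [] = 0" and multilin_susp_total_harrison: "multilin (susp_total m)" and graded_susp_total: "graded k (susp_total m)"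
    and shuf_susp_total: "hom_word x \<Longrightarrow> hom_word y \<Longrightarrow> x \<noteq> [] \<Longrightarrow> y \<noteq> [] \<Longrightarrow> shuf (susp_total m) x y = 0"
proof -
  show "susp_total m [] = 0" by (simp add: susp_total_def susp_def m0)
  show "multilin (susp_total m)" by (rule multilin_susp_total) (rule harrison_multilinear, rule m)
  show "graded k (susp_total m)"
    unfolding graded_def
  proof (intro allI impI)
    fix w assume w: "hom_word w"
    show "susp_total m (map snd w) \<in> H (word_deg w + 1 + k)"
    proof (cases "w = []")
      case True
      then show ?thesis by (simp add: susp_total_def susp_def m0 component_0)
    next
      case False
      then have "m (length w) \<in> harrison scale H (length w) (k + 1 - int (length w))"
        by (intro m) (simp add: Suc_le_eq)
      from harrison_hom_word[OF this w refl] show ?thesis by (simp add: susp_total_def algebra_simps)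
    qed
  qed
  assume *: "hom_word x" "hom_word y" "x \<noteq> []" "y \<noteq> []"
  let ?n = "length x + length y"
  have "shuf (susp_total m) x y = shuf (susp H (m ?n)) x y"
    by (rule shuf_cong) (simp add: susp_total_def)
  also have "\<dots> = 0"
    by (rule harrison_shuf[OF m]) (use * in \<open>auto simp: Suc_le_eq\<close>)
  finally show "shuf (susp_total m) x y = 0" .
qed

lemma letter_sign_hom_word: "hom_word x \<Longrightarrow> \<forall>(e, v) \<in> set x. letter_sign v = signed e v"
  by (auto simp: hom_word_def hom_letter_def list_all_iff degree_sign_homogeneous[of _ "e + 1" for e])

text \<open>
  A map of degree one on \<open>sH\<close> changes the parity of the total degree. Both sides are multilinear, so
  it suffices to compare them on homogeneous letters.
\<close>

lemma letter_sign_anticommute: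
  assumes "multilin F" "graded 1 F"
  shows "F (map letter_sign u) = - letter_sign (F u)"
proof -
  have lin: "letter_sign (x + y) = letter_sign x + letter_sign y" for x y
    by (rule linear_add'[OF linear_degree_sign])
  have "F (map letter_sign u) + letter_sign (F u) = 0"
  proof (rule multiadd_ext_hom_word[of "\<lambda>u. F (map letter_sign u) + letter_sign (F u)"])
    show "multiadd (\<lambda>u. F (map letter_sign u) + letter_sign (F u))"
      using multilin_multiadd[OF assms(1)] by (simp add: multiadd_def lin algebra_simps)
    fix w assume w: "hom_word w"
    have "F (map letter_sign (map snd w)) = signed (word_deg w) (F (map snd w))"
      by (rule multiadd_map_signed[OF multilin_multiadd[OF assms(1)] letter_sign_hom_word[OF w]])
    moreover have "letter_sign (F (map snd w)) = signed (word_deg w + 1) (F (map snd w))"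
      by (simp add: degree_sign_homogeneous[OF gradedD[OF assms(2) w]] add.commute)
    ultimately show "F (map letter_sign (map snd w)) + letter_sign (F (map snd w)) = 0"
      by (simp add: signed_def)
  qed
  then show ?thesis by (simp add: eq_neg_iff_add_eq_0)
qed

lemma letter_sign_letter_sign: "letter_sign (letter_sign x) = x"
  by (rule degree_sign_degree_sign)

lemma letter_sign_mem: "x \<in> H d \<Longrightarrow> letter_sign x \<in> H d"
  by (simp add: degree_sign_homogeneous component_signed)

lemma C_inf_susp_total:
  assumes "C_inf_algebra scale H A"
  shows "susp_total A [] = 0" "multilin (susp_total A)" "graded 1 (susp_total A)"
    "hom_word x \<Longrightarrow> hom_word y \<Longrightarrow> x \<noteq> [] \<Longrightarrow> y \<noteq> [] \<Longrightarrow> shuf (susp_total A) x y = 0"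
    "coder letter_sign (susp_total A) (susp_total A) w = 0"
proof -
  have 0: "A 0 = (\<lambda>_. 0)" and h: "\<And>n. n \<ge> 1 \<Longrightarrow> A n \<in> harrison scale H n (1 + 1 - int n)"
    using assms by (auto simp: C_inf_algebra_def)
  show "susp_total A [] = 0" by (rule susp_total_Nil[OF 0 h])
  show M: "multilin (susp_total A)" by (rule multilin_susp_total_harrison[OF 0 h])
  show "graded 1 (susp_total A)" by (rule graded_susp_total[OF 0 h])
  show "hom_word x \<Longrightarrow> hom_word y \<Longrightarrow> x \<noteq> [] \<Longrightarrow> y \<noteq> [] \<Longrightarrow> shuf (susp_total A) x y = 0"
    by (rule shuf_susp_total[OF 0 h])
  show "coder letter_sign (susp_total A) (susp_total A) w = 0"
    using assms by (simp add: insertion_coder[where A = A and M = A, OF 0 M, symmetric] C_inf_algebra_def)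
qed

definition isotopy_of :: "('v list \<Rightarrow> 'v) \<Rightarrow> nat \<Rightarrow> 'v list \<Rightarrow> 'v" where
  "isotopy_of g n = (if n = 1 then (\<lambda>xs. if length xs = 1 then hd xs else 0)
     else if n = 2 then g else (\<lambda>_. 0))"

definition susp2 :: "('v list \<Rightarrow> 'v) \<Rightarrow> 'v \<Rightarrow> 'v \<Rightarrow> 'v" where
  "susp2 g a b = susp H g [a, b]"

lemma id_harrison: "(\<lambda>xs. if length xs = 1 then hd xs else 0) \<in> harrison scale H 1 0"
proof -
  have "desusp 1 proj_letter \<in> harrison scale H 1 (0 + 1 - int 1)"
  proof -
    have "multilinear scale 1 (desusp 1 proj_letter)"
      using multilinear_arity_part[OF multilin_twist[OF multilin_proj_letter], of 1] by (simp add: desusp_def[abs_def])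
    moreover have "has_internal_degree H 1 0 (desusp 1 proj_letter)"
      unfolding internal_degree_iff
    proof (intro allI impI)
      fix w assume "hom_word w" "length w = 1"
      then show "desusp 1 proj_letter (map snd w) \<in> H (word_deg w + int 1 + 0)"
        by (cases w) (auto simp: desusp_def proj_letter_def)
    qed
    moreover have "vanishes_on_shuffles H 1 F" for F
      unfolding vanishes_on_shuffles_iff
    proof (intro allI impI)
      fix x y :: "(int \<times> 'v) list" assume "x \<noteq> []" "y \<noteq> []" "length x + length y = 1"
      then show "shuf F x y = 0" by (cases x; cases y) auto
    qed
    ultimately show ?thesis by (simp add: harrison_def)
  qed
  moreover have "desusp 1 proj_letter = (\<lambda>xs. if length xs = 1 then hd xs else 0)"
  proof
    fix xs show "desusp 1 proj_letter xs = (if length xs = 1 then hd xs else 0)"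
      by (cases xs) (auto simp: desusp_def proj_letter_def)
  qed
  ultimately show ?thesis by simp
qed

lemma zero_harrison: "(\<lambda>_. 0) \<in> harrison scale H n j"
  by (auto simp: harrison_def multilinear_def has_internal_degree_def vanishes_on_shuffles_def
      component_0 susp_def)

lemma isotopy_of_harrison:
  assumes "g \<in> harrison scale H 2 (-1)" "n \<ge> 1"
  shows "isotopy_of g n \<in> harrison scale H n (1 - int n)"
  using assms id_harrison zero_harrison by (auto simp: isotopy_of_def)

lemma susp_total_isotopy_of: "g \<in> harrison scale H 2 (-1) \<Longrightarrow> susp_total (isotopy_of g) = morph (susp2 g) proj_letter"
proof
  fix w
  assume "g \<in> harrison scale H 2 (-1)"
  show "susp_total (isotopy_of g) w = morph (susp2 g) proj_letter w"
  proof (cases w rule: remdups_adj.cases)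
    case (3 a b w')
    then show ?thesis
      by (cases w') (simp_all add: morph_proj_letter susp_total_def susp_def isotopy_of_def susp2_def del: morph.simps)
  qed (simp_all add: morph_proj_letter susp_total_def susp_def isotopy_of_def del: morph.simps)
qed

lemma susp2_properties:
  assumes g: "g \<in> harrison scale H 2 (-1)"
  shows "bilin (susp2 g)" "degree_preserving (susp2 g)"
    "susp2 g (letter_sign a) (letter_sign b) = letter_sign (susp2 g a b)"
    "a' \<in> H (d + 1) \<Longrightarrow> b' \<in> H (e + 1) \<Longrightarrow> susp2 g a' b' + signed (d * e) (susp2 g b' a') = 0"
proof -
  let ?m = "\<lambda>k. if k = 2 then g else (\<lambda>_. 0)"
  have "multilin (susp_total ?m)"
    by (rule multilin_susp_total) (use harrison_multilinear[OF g] in \<open>auto simp: multilinear_def\<close>)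
  from multilin_linear[OF this, of "[]" "[_]"] multilin_linear[OF this, of "[_]" "[]"]
  have l: "klinear (\<lambda>x. susp2 g x b)"
    "klinear (susp2 g b)" for b
    by (simp_all add: susp_total_def susp2_def[abs_def])
  then show bil: "bilin (susp2 g)" by (simp add: bilin_def)
  have deg: "susp2 g a b \<in> H (d + e + 1)" if "a \<in> H (d + 1)" "b \<in> H (e + 1)" for a b d e
    using harrison_hom_word[OF g, of "[(d, a), (e, b)]"] that by (simp add: susp2_def algebra_simps)
  then show "degree_preserving (susp2 g)" by (simp add: degree_preserving_def)
  let ?D = "\<lambda>a b. susp2 g (letter_sign a) (letter_sign b) - letter_sign (susp2 g a b)"
  note lin = linear_add'[OF l(1)] linear_add'[OF l(2)] linear_add'[OF linear_degree_sign]
  have "?D a b = 0" 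
  proof (rule additive_ext_homogeneous[of "\<lambda>a. ?D a b"])
    fix a d assume a: "a \<in> H d"
    show "?D a b = 0"
    proof (rule additive_ext_homogeneous[of "\<lambda>b. ?D a b"])
      fix b e assume b: "b \<in> H e"
      have s: "susp2 g (signed i a) (signed j b) = signed (i + j) (susp2 g a b)" for i j
        using linear_scale'[OF l(1), of "-1"] linear_scale'[OF l(2), of _ "-1"]
        by (auto simp: signed_def)
      have "susp2 g a b \<in> H ((d - 1) + (e - 1) + 1)" using deg[of a "d - 1" b "e - 1"] a b by simp
      then show "?D a b = 0"
        using a b s by (simp add: degree_sign_homogeneous[of _ d] degree_sign_homogeneous[of _ e]
            degree_sign_homogeneous[of "susp2 g a b" "(d - 1) + (e - 1) + 1"] algebra_simps)
    qed (simp add: lin)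
  qed (simp add: lin)
  then show "susp2 g (letter_sign a) (letter_sign b) = letter_sign (susp2 g a b)" by simp
  assume "a' \<in> H (d + 1)" "b' \<in> H (e + 1)"
  then show "susp2 g a' b' + signed (d * e) (susp2 g b' a') = 0"
    using harrison_shuf[OF g, of "[(d, a')]" "[(e, b')]"] by (simp add: susp2_def mult.commute)
qed

context
  fixes A g
  assumes A: "C_inf_algebra scale H A" and g: "g \<in> harrison scale H 2 (-1)"
begin

text \<open>
  The components of \<open>\<Phi>D\<Phi>\<^sup>-\<^sup>1\<close>. In terms of pullbacks the projection to letters of \<open>\<Phi>D\<close> is
  \<open>coder (morph proj_letter)\<close>, and \<open>morph_inv\<close> composes it with \<open>\<Phi>\<^sup>-\<^sup>1\<close>.
\<close>

definition transported_total :: "'v list \<Rightarrow> 'v" where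
  "transported_total = morph_inv (susp2 g) (coder letter_sign (susp_total A) (morph (susp2 g) proj_letter))"

definition transported :: "nat \<Rightarrow> 'v list \<Rightarrow> 'v" where
  "transported n = (if n = 0 then (\<lambda>_. 0) else desusp n transported_total)"

lemma morph_transported_total: "morph (susp2 g) transported_total w = coder letter_sign (susp_total A) (morph (susp2 g) proj_letter) w"
  by (simp add: transported_total_def morph_inv)

lemma transported_total_Nil: "transported_total [] = 0"
  using morph_transported_total[of "[]"] by (simp add: C_inf_susp_total(1)[OF A] proj_letter_def)

lemma susp_total_transported: "susp_total transported = transported_total"
proof
  fix w show "susp_total transported w = transported_total w"
    by (cases "w = []") (simp_all add: susp_total_def transported_def susp_desusp transported_total_Nil susp_def[of _ "\<lambda>_. 0"])
qed

lemma multilin_transported_total: "multilin transported_total"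
  unfolding transported_total_def
  by (intro multilin_morph_inv multilin_coder multilin_morph multilin_proj_letter C_inf_susp_total[OF A] linear_degree_sign susp2_properties(1)[OF g])

lemma graded_transported_total: "graded 1 transported_total"
  unfolding transported_total_def
  using graded_morph_inv[OF graded_coder[OF graded_morph[OF graded_proj_letter susp2_properties(2)[OF g]] C_inf_susp_total(3)[OF A] letter_sign_mem] susp2_properties(2)[OF g]]
  by simp

lemma shuf_morph_hom_word:
  assumes "multiadd F" "hom_word x" "hom_word y"
  shows "shuf (morph (susp2 g) F) x y = morph (letter_op (susp2 g)) (\<lambda>x'. morph (letter_op (susp2 g)) (\<lambda>y'. shuf F x' y') y) x"
proof (rule shuf_morph[OF assms(1)])
  fix a b assume "a \<in> set x" "b \<in> set y"
  then show "susp2 g (snd a) (snd b) + signed (fst a * fst b) (susp2 g (snd b) (snd a)) = 0"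
    using assms(2,3) by (intro susp2_properties(4)[OF g]) (auto simp: hom_word_def hom_letter_def list_all_iff)
qed

lemma shuf_proj_letter: "x \<noteq> [] \<Longrightarrow> y \<noteq> [] \<Longrightarrow> shuf proj_letter x y = 0"
proof -
  assume "x \<noteq> []" "y \<noteq> []"
  then have "shuf proj_letter x y = shuf (\<lambda>_. 0) x y"
    by (intro shuf_cong) (cases x; cases y; auto simp: proj_letter_def)
  then show ?thesis by (simp add: additive_op_zero[of "\<lambda>F. shuf F x y"] additive_op_def shuf_add)
qed

lemma morph_ne_zero: "(\<And>u. u \<noteq> [] \<Longrightarrow> F u = 0) \<Longrightarrow> w \<noteq> [] \<Longrightarrow> morph f F w = 0"
  using morph_ne_cong[of F "\<lambda>_. 0" w f] by simp

lemma shuf_morph_proj_letter: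
  assumes "hom_word x" "hom_word y" "x \<noteq> []" "y \<noteq> []"
  shows "shuf (morph (susp2 g) proj_letter) x y = 0"
  unfolding shuf_morph_hom_word[OF multilin_multiadd[OF multilin_proj_letter] assms(1,2)]
  by (intro morph_ne_zero) (use assms in \<open>auto simp: shuf_proj_letter\<close>)

lemma letter_op_hom_word: "hom_letter a \<Longrightarrow> hom_letter b \<Longrightarrow> hom_letter (letter_op (susp2 g) a b)"
  using susp2_properties(2)[OF g] by (simp add: hom_letter_def letter_op_def degree_preserving_def)

text \<open>\<open>D\<close> maps nonempty words of homogeneous letters to sums of such words.\<close>

lemma coder_hom_word_zero:
  assumes "\<And>u. hom_word u \<Longrightarrow> u \<noteq> [] \<Longrightarrow> F u = 0" "hom_word w"
  shows "coder (on_letter letter_sign) (letter_coder (susp_total A)) F w = 0"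
  using assms
proof (induction w arbitrary: F)
  case Nil
  then show ?case
    using component_0 by (simp add: letter_coder_Nil C_inf_susp_total(1)[OF A])
next
  case (Cons a w)
  have "split_sum (\<lambda>u v. F (letter_coder (susp_total A) u # v)) (a # w) = 0"
  proof (rule split_sum_zero)
    fix u v assume uv: "u @ v = a # w"
    then have gd: "hom_word u" "hom_word v" using Cons(3) hom_word_simps(3) by metis+
    then have "hom_word (letter_coder (susp_total A) u # v)"
      using gradedD[OF C_inf_susp_total(3)[OF A] gd(1)] by (simp add: letter_coder_def)
    then show "F (letter_coder (susp_total A) u # v) = 0" by (rule Cons(2)) simp
  qed
  moreover have "coder (on_letter letter_sign) (letter_coder (susp_total A)) (\<lambda>u. F (on_letter letter_sign a # u)) w = 0"
    by (rule Cons(1)) (use Cons(2,3) letter_sign_mem in auto)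
  ultimately show ?case by (simp del: split_sum.simps)
qed

lemma hom_word_map_letter_sign: "hom_word x \<Longrightarrow> hom_word (map (on_letter letter_sign) x)"
  by (induction x) (auto simp: letter_sign_mem)

text \<open>
  Let \<open>B\<close> denote the components in question, so \<open>B \<circ> \<Phi>\<close> is the projection of \<open>\<Phi>D\<close> to letters. On a
  shuffle of \<open>x\<close> and \<open>y\<close> the latter vanishes, because \<open>D\<close> is a derivation, \<open>\<Phi>\<close> is multiplicative
  and a shuffle of two nonempty words has no words of length one. On the other hand \<open>B \<circ> \<Phi>\<close> is
  evaluated on the shuffle of \<open>\<Phi> x\<close> and \<open>\<Phi> y\<close>, where all terms except the one for \<open>x\<close> and \<open>y\<close>
  vanish by induction on the length.
\<close>

lemma shuf_transported_total:
  assumes "hom_word x" "hom_word y" "x \<noteq> []" "y \<noteq> []"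
  shows "shuf transported_total x y = 0"
  using assms
proof (induction "length x + length y" arbitrary: x y rule: less_induct)
  case less
  let ?f = "letter_op (susp2 g)"
  have P: "shuf (morph (susp2 g) transported_total) x y = shuf (coder letter_sign (susp_total A) (morph (susp2 g) proj_letter)) x y"
    by (rule shuf_cong) (rule morph_transported_total)
  have "shuf (coder letter_sign (susp_total A) (morph (susp2 g) proj_letter)) x y =
      coder (on_letter letter_sign) (letter_coder (susp_total A)) (\<lambda>x'. shuf (morph (susp2 g) proj_letter) x' y) x +
      coder (on_letter letter_sign) (letter_coder (susp_total A)) (\<lambda>y'. shuf (morph (susp2 g) proj_letter) (map (on_letter letter_sign) x) y') y"
  proof (rule shuf_coder)
    show "multiadd (morph (susp2 g) proj_letter)" by (rule multilin_multiadd[OF multilin_morph[OF multilin_proj_letter susp2_properties(1)[OF g]]])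
    show "\<forall>(e, v)\<in>set x \<union> set y. letter_sign v = signed e v"
      using letter_sign_hom_word less(2,3) by blast
    fix x1 y1 assume *: "x1 \<noteq> []" "y1 \<noteq> []" "set x1 \<subseteq> set x" "set y1 \<subseteq> set y"
    show "shuf (susp_total A) x1 y1 = 0"
      by (rule C_inf_susp_total(4)[OF A hom_word_subset[OF less(2) *(3)] hom_word_subset[OF less(3) *(4)] *(1,2)])
  qed (rule C_inf_susp_total(1)[OF A])
  also have "\<dots> = 0"
    using less by (simp add: coder_hom_word_zero shuf_morph_proj_letter hom_word_map_letter_sign)
  finally have R: "shuf (morph (susp2 g) transported_total) x y = 0" using P by simp
  have "shuf (morph (susp2 g) transported_total) x y = morph ?f (\<lambda>x'. morph ?f (\<lambda>y'. shuf transported_total x' y') y) x"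
    by (rule shuf_morph_hom_word[OF multilin_multiadd[OF multilin_transported_total] less(2,3)])
  also have "\<dots> = morph ?f (\<lambda>y'. shuf transported_total x y') y"
  proof (rule morph_leading[where P = hom_letter])
    fix u assume u: "u \<noteq> []" "list_all hom_letter u" "length u < length x"
    show "morph ?f (\<lambda>y'. shuf transported_total u y') y = 0"
      by (rule morph_vanish[where P = hom_letter])
        (use u less letter_op_hom_word in \<open>auto simp: hom_word_def\<close>)
  qed (use less letter_op_hom_word in \<open>auto simp: hom_word_def\<close>)
  also have "\<dots> = shuf transported_total x y"
    by (rule morph_leading[where P = hom_letter]) (use less letter_op_hom_word in \<open>auto simp: hom_word_def\<close>)
  finally show ?case using R by simp
qed

lemma transported_harrison: "n \<ge> 1 \<Longrightarrow> transported n \<in> harrison scale H n (2 - int n)"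
  using desusp_harrison[OF multilin_transported_total graded_transported_total shuf_transported_total, of n]
  by (simp add: transported_def)

text \<open>
  Pulling back along \<open>\<Phi>\<close> is injective and turns the square of the transported coderivation into
  \<open>D\<^sup>2 = 0\<close>.
\<close>

lemma coder_transported_total: "coder letter_sign transported_total transported_total w = 0"
proof -
  let ?f = "susp2 g"
  have comm: "morph ?f (coder letter_sign transported_total F) v = coder letter_sign (susp_total A) (morph ?f F) v" if "multiadd F" for F v
    by (rule morph_coder[where f = "susp2 g" and t = letter_sign and A = "susp_total A" and B = transported_total and F = F,
          OF that C_inf_susp_total(1)[OF A] transported_total_Nil morph_transported_total susp2_properties(3)[OF g]])
  have "morph ?f (coder letter_sign transported_total transported_total) v = morph ?f (\<lambda>_. 0) v" for v
  proof -
    have "morph ?f (coder letter_sign transported_total transported_total) v = coder letter_sign (susp_total A) (morph ?f transported_total) v"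
      by (rule comm[OF multilin_multiadd[OF multilin_transported_total]])
    also have "\<dots> = coder letter_sign (susp_total A) (coder letter_sign (susp_total A) (morph ?f proj_letter)) v"
      by (simp add: morph_transported_total[abs_def])
    also have "\<dots> = 0"
      by (rule coder_coder[where t = letter_sign and A = "susp_total A" and F = "morph ?f proj_letter",
        OF multilin_multiadd[OF multilin_morph[OF multilin_proj_letter susp2_properties(1)[OF g]]]
        multilin_multiadd[OF C_inf_susp_total(2)[OF A]] C_inf_susp_total(1)[OF A] C_inf_susp_total(5)[OF A] letter_sign_letter_sign
        letter_sign_anticommute[OF C_inf_susp_total(2,3)[OF A]]])
    finally show ?thesis by simp
  qed
  then show ?thesis by (rule morph_inject[of ?f "coder letter_sign transported_total transported_total" "\<lambda>_. 0" w])
qed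

end

end

section \<open>Isotopies modulo three\<close>

lemma multilinear_zero_length: "multilinear scale n f \<Longrightarrow> length xs \<noteq> n \<Longrightarrow> f xs = 0"
  by (simp add: multilinear_def)

context graded_vector_space
begin

lemma susp_total_inject:
  assumes "multilinear scale n (B n)" "multilinear scale n (C n)" "susp_total B = susp_total C"
  shows "B n = C n"
proof
  fix xs
  show "B n xs = C n xs"
  proof (cases "length xs = n")
    case True
    then show ?thesis using fun_cong[OF assms(3), of "koszul_twist H xs"] by (simp add: susp_total_def susp_def)
  qed (use assms in \<open>simp add: multilinear_zero_length\<close>)
qed

lemma C_inf_harrison: "C_inf_algebra scale H A \<Longrightarrow> n \<ge> 1 \<Longrightarrow> A n \<in> harrison scale H n (2 - int n)"
  by (simp add: C_inf_algebra_def)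

lemma morphism_equation:
  assumes A: "C_inf_algebra scale H A" and B: "C_inf_algebra scale H B"
    and ph: "\<forall>n\<ge>1. \<phi> n \<in> harrison scale H n (1 - int n)"
  shows "(\<forall>xs. xs \<noteq> [] \<longrightarrow>
        (\<Sum>l=1..length xs.
           insertion H 1 l (susp H (\<phi> (length xs + 1 - l))) (susp H (A l)) xs) =
        (\<Sum>c | sum_list c = length xs \<and> 0 \<notin> set c.
           susp H (B (length c)) (map (\<lambda>ys. susp H (\<phi> (length ys)) ys) (blocks c xs))))
    \<longleftrightarrow> (\<forall>xs. xs \<noteq> [] \<longrightarrow> coder letter_sign (susp_total A) (susp_total \<phi>) xs =
        (\<Sum>c\<in>compositions (length xs). susp_total B (map (susp_total \<phi>) (blocks c xs))))"
proof -
  have A0: "A 0 = (\<lambda>_. 0)" using A by (simp add: C_inf_algebra_def)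
  have m: "multilin (susp_total \<phi>)"
    by (rule multilin_susp_total) (use ph in \<open>auto intro: harrison_multilinear\<close>)
  show ?thesis
    by (simp only: insertion_coder[where A = A and M = \<phi>, OF A0 m] compositions_def susp_total_def length_map length_blocks)
      (simp add: susp_total_def[abs_def])
qed

text \<open>
  The target exists by the construction above. It is unique because the morphism equation determines
  the pullback of its components along \<open>\<Phi>\<close>, and pulling back along \<open>\<Phi>\<close> is injective.
\<close>

lemma transported_isotopy:
  assumes A: "C_inf_algebra scale H A" and g: "g \<in> harrison scale H 2 (-1)"
  shows "C_inf_isotopy scale H A (transported A g) (isotopy_of g)"
    and "C_inf_isotopy scale H A C (isotopy_of g) \<Longrightarrow> C = transported A g"
proof -
  let ?B = "transported A g" and ?\<phi> = "isotopy_of g"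
  have ph: "\<forall>n\<ge>1. ?\<phi> n \<in> harrison scale H n (1 - int n)"
    using isotopy_of_harrison[OF g] by blast
  have rhs: "(\<Sum>c\<in>compositions (length xs). susp_total C (map (susp_total ?\<phi>) (blocks c xs))) = morph (susp2 g) (susp_total C) xs"
    if "multilin (susp_total C)" for C xs
    by (rule compositions_morph[OF multilin_multiadd[OF that]]) (simp_all add: susp_total_isotopy_of[OF g] morph_proj_letter del: morph.simps)
  have B: "C_inf_algebra scale H ?B"
    unfolding C_inf_algebra_def
  proof (intro conjI allI impI)
    show B0: "?B 0 = (\<lambda>_. 0)" by (simp add: transported_def[OF A g])
    show "?B n \<in> harrison scale H n (2 - int n)" if "1 \<le> n" for n
      by (rule transported_harrison[OF A g that])
    have m: "multilin (susp_total ?B)" by (simp add: susp_total_transported[OF A g] multilin_transported_total[OF A g])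
    show "(\<Sum>l=1..length xs. insertion H 1 l (susp H (?B (length xs + 1 - l))) (susp H (?B l)) xs) = 0" for xs
      unfolding insertion_coder[where A = ?B and M = ?B, OF B0 m]
      by (simp add: susp_total_transported[OF A g] coder_transported_total[OF A g])
  qed
  show "C_inf_isotopy scale H A ?B ?\<phi>"
    unfolding C_inf_isotopy_def C_inf_morphism_def morphism_equation[OF A B ph]
    using A B ph rhs[of ?B]
    by (simp add: susp_total_transported[OF A g] multilin_transported_total[OF A g] morph_transported_total[OF A g] susp_total_isotopy_of[OF g])
      (simp add: isotopy_of_def)
  assume iso: "C_inf_isotopy scale H A C ?\<phi>"
  then have C: "C_inf_algebra scale H C" by (simp add: C_inf_isotopy_def C_inf_morphism_def)
  have "coder letter_sign (susp_total A) (susp_total ?\<phi>) xs = (\<Sum>c\<in>compositions (length xs). susp_total C (map (susp_total ?\<phi>) (blocks c xs)))"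
    if "xs \<noteq> []" for xs
    using iso that
    unfolding C_inf_isotopy_def C_inf_morphism_def morphism_equation[OF A C ph] by blast
  then have *: "morph (susp2 g) (susp_total C) xs = coder letter_sign (susp_total A) (morph (susp2 g) proj_letter) xs" if "xs \<noteq> []" for xs
    using that rhs[OF C_inf_susp_total(2)[OF C]] by (simp add: susp_total_isotopy_of[OF g])
  have "susp_total C w = susp_total ?B w" for w
  proof (rule morph_inject)
    fix w show "morph (susp2 g) (susp_total C) w = morph (susp2 g) (susp_total ?B) w"
      by (cases "w = []")
        (simp_all add: * susp_total_transported[OF A g] morph_transported_total[OF A g] C_inf_susp_total(1)[OF C] transported_total_Nil[OF A g])
  qed
  then have eq: "susp_total C = susp_total ?B" by (rule ext)
  show "C = ?B"
  proof
    fix n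
    show "C n = ?B n"
    proof (cases "n = 0")
      case True
      then show ?thesis using B C by (simp add: C_inf_algebra_def)
    next
      case False
      then have "multilinear scale n (C n)" "multilinear scale n (?B n)"
        using B C by (auto simp: C_inf_algebra_def Suc_le_eq intro: harrison_multilinear)
      then show ?thesis by (rule susp_total_inject) (rule eq)
    qed
  qed
qed

lemma transport_isotopy_of:
  assumes "C_inf_algebra scale H A" "g \<in> harrison scale H 2 (-1)"
  shows "transport scale H (isotopy_of g) A = transported A g"
  unfolding transport_def using transported_isotopy[OF assms] by (rule the_equality)

text \<open>
  The differential of a suspended binary operation \<open>f\<close>, the commutator of the coderivations with
  components \<open>m\<close> of degree one and \<open>f\<close> of degree zero.
\<close>

definition delta3 :: "('v \<Rightarrow> 'v \<Rightarrow> 'v) \<Rightarrow> ('v \<Rightarrow> 'v \<Rightarrow> 'v) \<Rightarrow> 'v \<Rightarrow> 'v \<Rightarrow> 'v \<Rightarrow> 'v" where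
  "delta3 m f a b c = m (f a b) c + m a (f b c) - f (m a b) c - f (letter_sign a) (m b c)"

lemma insertion_3: 
  assumes "length xs = 3"
  shows "insertion H e 2 F G xs = F [G [xs ! 0, xs ! 1], xs ! 2] + F [degree_sign H e (-1) (xs ! 0), G [xs ! 1, xs ! 2]]"
proof -
  obtain a b c where xs: "xs = [a, b, c]"
    using assms by (auto simp: numeral_3_eq_3 length_Suc_conv)
  have "{r. r + 2 \<le> length xs} = {0, 1}" by (auto simp: xs)
  then show ?thesis by (simp add: insertion_def xs)
qed

lemma insertion_length:
  assumes "\<And>u. length u \<noteq> k \<Longrightarrow> F u = 0" "length xs + 1 \<noteq> k + l"
  shows "insertion H e l F G xs = 0"
  unfolding insertion_def using assms by (intro sum.neutral) auto

lemma susp_length: "multilinear scale n f \<Longrightarrow> length u \<noteq> n \<Longrightarrow> susp H f u = 0"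
  by (simp add: susp_def multilinear_zero_length)

lemma harrison_d_2:
  assumes m: "multilinear scale 2 (mult_cochain mul)" and g: "multilinear scale 2 g"
  shows "harrison_d H mul 2 (-1) g = desusp 3 (\<lambda>w. delta3 (susp2 (mult_cochain mul)) (susp2 g) (w ! 0) (w ! 1) (w ! 2))"
proof
  fix xs
  let ?w = "koszul_twist H xs" and ?m = "mult_cochain mul"
  have d: "harrison_d H mul 2 (-1) g xs =
    insertion H 0 2 (susp H ?m) (susp H g) ?w - insertion H 1 2 (susp H g) (susp H ?m) ?w"
    by (simp add: harrison_d_def gerstenhaber_def susp_def[of H "\<lambda>_. _ _ - _ _"] Let_def)
       (simp add: susp_def)
  show "harrison_d H mul 2 (-1) g xs = desusp 3 (\<lambda>w. delta3 (susp2 ?m) (susp2 g) (w ! 0) (w ! 1) (w ! 2)) xs"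
  proof (cases "length xs = 3")
    case True
    then show ?thesis
      unfolding d by (simp add: insertion_3 desusp_def delta3_def susp2_def)
  next
    case False
    then have "insertion H 0 2 (susp H ?m) (susp H g) ?w = 0" "insertion H 1 2 (susp H g) (susp H ?m) ?w = 0"
      using m g by (auto intro!: insertion_length[where k = 2] simp: susp_length)
    with False show ?thesis by (simp add: d desusp_def)
  qed
qed

lemma minimal_operations:
  assumes "minimal_enhancement scale H mul A"
  shows "C_inf_algebra scale H A" "susp_total A [a] = 0" "susp_total A [a, b] = susp2 (mult_cochain mul) a b"
    "multilinear scale 2 (mult_cochain mul)" "A 3 \<in> harrison scale H 3 (-1)"
proof -
  show A: "C_inf_algebra scale H A" using assms by (simp add: minimal_enhancement_def)
  show "susp_total A [a] = 0" "susp_total A [a, b] = susp2 (mult_cochain mul) a b"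
    using assms by (simp_all add: minimal_enhancement_def susp_total_def susp_def susp2_def numeral_2_eq_2)
  have "A 2 \<in> harrison scale H 2 (2 - int 2)" "A 3 \<in> harrison scale H 3 (2 - int 3)"
    by (rule C_inf_harrison[OF A]; simp)+
  then show "multilinear scale 2 (mult_cochain mul)" "A 3 \<in> harrison scale H 3 (-1)"
    using assms by (auto simp: minimal_enhancement_def dest: harrison_multilinear)
qed

text \<open>
  In a minimal structure only the insertions of \<open>m\<^sub>2\<close> and \<open>m\<^sub>3\<close> are possible in words of length at
  most three.
\<close>

lemma coder_arity_le_3:
  assumes A: "minimal_enhancement scale H mul A" and P: "multilin P" "P [] = 0" "\<And>a. P [a] = a"
    "\<And>a b. P [a, b] = f a b"
  shows "coder letter_sign (susp_total A) P [a] = 0"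
    "coder letter_sign (susp_total A) P [a, b] = susp2 (mult_cochain mul) a b"
    "coder letter_sign (susp_total A) P [a, b, c] = susp_total A [a, b, c] + f (susp2 (mult_cochain mul) a b) c +
       f (letter_sign a) (susp2 (mult_cochain mul) b c)"
proof -
  have z: "P (0 # u) = 0" "P (x # 0 # u) = 0" "P (x # y # 0 # u) = 0"  "P (x # y # z # 0 # u) = 0" for x y z u
    using multiadd_zero[OF multilin_multiadd[OF P(1)], of "[]" u] multiadd_zero[OF multilin_multiadd[OF P(1)], of "[x]" u]
      multiadd_zero[OF multilin_multiadd[OF P(1)], of "[x, y]" u] multiadd_zero[OF multilin_multiadd[OF P(1)], of "[x, y, z]" u] by simp_all
  note simps = z minimal_operations(2,3)[OF A] C_inf_susp_total(1)[OF minimal_operations(1)[OF A]] P(2-)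
  have f0: "f 0 x = 0" "f x 0 = 0" for x using z(1)[of "[x]"] z(2)[of x "[]"] by (simp_all add: P)
  show "coder letter_sign (susp_total A) P [a] = 0"
    "coder letter_sign (susp_total A) P [a, b] = susp2 (mult_cochain mul) a b"
    "coder letter_sign (susp_total A) P [a, b, c] = susp_total A [a, b, c] + f (susp2 (mult_cochain mul) a b) c +
       f (letter_sign a) (susp2 (mult_cochain mul) b c)"
    by (simp_all add: simps f0)
qed

lemma diff_eq_desuspI:
  assumes X: "multilinear scale 3 X" and Y: "multilinear scale 3 Y"
    and *: "\<And>a b c. susp H X [a, b, c] - susp H Y [a, b, c] = D a b c"
  shows "(\<lambda>xs. X xs - Y xs) = desusp 3 (\<lambda>w. D (w ! 0) (w ! 1) (w ! 2))"
proof
  fix xs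
  show "X xs - Y xs = desusp 3 (\<lambda>w. D (w ! 0) (w ! 1) (w ! 2)) xs"
  proof (cases "length xs = 3")
    case True
    then have "length (koszul_twist H xs) = 3" by simp
    then obtain a b c where w: "koszul_twist H xs = [a, b, c]"
      by (auto simp: numeral_3_eq_3 length_Suc_conv)
    then have "xs = koszul_twist H [a, b, c]" using koszul_twist_twist by metis
    then have "X xs = susp H X [a, b, c]" "Y xs = susp H Y [a, b, c]" by (simp_all add: susp_def)
    then show ?thesis using * True by (simp add: desusp_def w)
  qed (use X Y in \<open>simp add: desusp_def multilinear_zero_length\<close>)
qed

lemma sum_compositions_le_3: "(\<Sum>c\<in>compositions (Suc 0). G c) = G [1]" "(\<Sum>c\<in>compositions 3. G c) = G [1,1,1] + G [1,2] + G [2,1] + G [3]"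
proof -
  show "(\<Sum>c\<in>compositions (Suc 0). G c) = G [1]" by (simp add: sum_compositions_Suc compositions_0)
  show "(\<Sum>c\<in>compositions 3. G c) = G [1,1,1] + G [1,2] + G [2,1] + G [3]"
    by (simp add: numeral_3_eq_3 numeral_2_eq_2 sum_compositions_Suc compositions_0 add.assoc)
qed

text \<open>
  In arity three the component \<open>\<phi>\<^sub>3\<close> enters the morphism equation only through \<open>m\<^sub>1\<close>, which is zero
  on both sides. For the target this is the morphism equation in arity one.
\<close>

lemma isotopy_imp_coboundary:
  assumes A: "minimal_enhancement scale H mul A" and iso: "C_inf_isotopy scale H A B \<phi>"
    and B2: "B 2 = mult_cochain mul"
  shows "\<phi> 2 \<in> harrison scale H 2 (-1)"
    "(\<lambda>xs. A 3 xs - B 3 xs) = harrison_d H mul 2 (-1) (\<phi> 2)"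
proof -
  have A': "C_inf_algebra scale H A" and B: "C_inf_algebra scale H B"
    and ph: "\<forall>n\<ge>1. \<phi> n \<in> harrison scale H n (1 - int n)" 
    and ph1: "\<phi> 1 = (\<lambda>xs. if length xs = 1 then hd xs else 0)"
    and eq0: "\<forall>xs. xs \<noteq> [] \<longrightarrow>
        (\<Sum>l=1..length xs.
           insertion H 1 l (susp H (\<phi> (length xs + 1 - l))) (susp H (A l)) xs) =
        (\<Sum>c | sum_list c = length xs \<and> 0 \<notin> set c.
           susp H (B (length c)) (map (\<lambda>ys. susp H (\<phi> (length ys)) ys) (blocks c xs)))"
    using iso by (auto simp: C_inf_isotopy_def C_inf_morphism_def)
  show g: "\<phi> 2 \<in> harrison scale H 2 (-1)" using ph[rule_format, of 2] by simp
  (* The component of index 0 of a morphism is arbitrary, hence so is the value of susp_total at the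
     empty word; it is replaced by 0. *)
  let ?P = "\<lambda>w. if w = [] then 0 else susp_total \<phi> w"
  have mP: "multilin ?P"
    using multilin_susp_total[of \<phi>] ph by (auto simp: multilin_def intro: harrison_multilinear)
  have P1: "susp_total \<phi> [a] = a" for a using ph1 by (simp add: susp_total_def susp_def)
  have P2: "susp_total \<phi> [a, b] = susp2 (\<phi> 2) a b" for a b by (simp add: susp_total_def susp2_def numeral_2_eq_2)
  have eq: "coder letter_sign (susp_total A) (susp_total \<phi>) xs = (\<Sum>c\<in>compositions (length xs). susp_total B (map (susp_total \<phi>) (blocks c xs)))"
    if "xs \<noteq> []" for xs
    using eq0 that unfolding morphism_equation[OF A' B ph] by blast
  have eq: "coder letter_sign (susp_total A) ?P xs = (\<Sum>c\<in>compositions (length xs). susp_total B (map (susp_total \<phi>) (blocks c xs)))"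
    if "xs \<noteq> []" for xs
    using eq[OF that] coder_ne_cong[of ?P "susp_total \<phi>" letter_sign "susp_total A" xs] by simp
  note low = coder_arity_le_3[OF A mP, of "susp2 (\<phi> 2)"]
  have B1: "susp_total B [a] = 0" for a
    using eq[of "[a]"] low(1)[of a] by (simp add: sum_compositions_le_3 P1 P2)
  have B2': "susp_total B [a, b] = susp2 (mult_cochain mul) a b" for a b
    using B2 by (simp add: susp_total_def susp2_def numeral_2_eq_2)
  have B3: "multilinear scale 3 (B 3)" "multilinear scale 3 (A 3)"
    by (rule harrison_multilinear, rule C_inf_harrison, rule B A', simp)+
  have h3: "susp H (X 3) [a, b, c] = susp_total X [a, b, c]" for X a b c
    by (simp add: susp_total_def numeral_3_eq_3)
  have "susp_total A [a, b, c] - susp_total B [a, b, c] = delta3 (susp2 (mult_cochain mul)) (susp2 (\<phi> 2)) a b c" for a b c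
  proof -
    have "(\<Sum>c'\<in>compositions 3. susp_total B (map (susp_total \<phi>) (blocks c' [a, b, c]))) = coder letter_sign (susp_total A) ?P [a, b, c]"
      using eq[of "[a, b, c]"] by (simp add: numeral_3_eq_3 del: coder.simps)
    then show ?thesis
      using low(3)[of a b c] by (simp add: sum_compositions_le_3 P1 P2 B1 B2' delta3_def algebra_simps)
  qed
  then have "(\<lambda>xs. A 3 xs - B 3 xs) = desusp 3 (\<lambda>w. delta3 (susp2 (mult_cochain mul)) (susp2 (\<phi> 2)) (w ! 0) (w ! 1) (w ! 2))"
    using B3 by (intro diff_eq_desuspI) (simp_all add: h3)
  then show "(\<lambda>xs. A 3 xs - B 3 xs) = harrison_d H mul 2 (-1) (\<phi> 2)"
    by (simp only: harrison_d_2[OF minimal_operations(4)[OF A] harrison_multilinear[OF g]])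
qed

lemma isotopic_mod_3_iff:
  assumes A1: "minimal_enhancement scale H mul A1" and A2: "minimal_enhancement scale H mul A2"
  shows "isotopic_mod scale H 3 A1 A2 \<longleftrightarrow>
    (\<exists>g\<in>harrison scale H 2 (-1). (\<lambda>xs. A1 3 xs - A2 3 xs) = harrison_d H mul 2 (-1) g)"
proof
  assume "isotopic_mod scale H 3 A1 A2"
  then obtain \<phi> where iso: "C_inf_isotopy scale H A1 (transport scale H \<phi> A1) \<phi>"
    and eq: "\<forall>i\<in>{2..3}. transport scale H \<phi> A1 i = A2 i"
    by (auto simp: isotopic_mod_def)
  have "transport scale H \<phi> A1 2 = A2 2" "transport scale H \<phi> A1 3 = A2 3" using eq by auto
  moreover have "A2 2 = mult_cochain mul" using A2 by (simp add: minimal_enhancement_def)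
  ultimately show "\<exists>g\<in>harrison scale H 2 (-1). (\<lambda>xs. A1 3 xs - A2 3 xs) = harrison_d H mul 2 (-1) g"
    using isotopy_imp_coboundary[OF A1 iso] by auto
next
  assume "\<exists>g\<in>harrison scale H 2 (-1). (\<lambda>xs. A1 3 xs - A2 3 xs) = harrison_d H mul 2 (-1) g"
  then obtain g where g: "g \<in> harrison scale H 2 (-1)"
    and eq: "(\<lambda>xs. A1 3 xs - A2 3 xs) = harrison_d H mul 2 (-1) g" by blast
  note A = minimal_operations(1)[OF A1]
  let ?B = "transported A1 g"
  note iso = transported_isotopy(1)[OF A g]
  have ml: "multilinear scale n (?B n)" if "n \<ge> 1" for n
    using harrison_multilinear[OF transported_harrison[OF A g that]] .
  have P: "multilin (morph (susp2 g) proj_letter)" "morph (susp2 g) proj_letter [] = 0" "\<And>a. morph (susp2 g) proj_letter [a] = a"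
    "\<And>a b. morph (susp2 g) proj_letter [a, b] = susp2 g a b"
    by (rule multilin_morph[OF multilin_proj_letter susp2_properties(1)[OF g]]) (simp_all add: morph_proj_letter del: morph.simps)
  note low = coder_arity_le_3[OF A1 P]
  have B1: "transported_total A1 g [a] = 0" for a
    using morph_transported_total[OF A g, of "[a]"] low(1) by simp
  have "transported_total A1 g [a, b] = susp2 (mult_cochain mul) a b" for a b
    using morph_transported_total[OF A g, of "[a, b]"] low(2) B1 by simp
  then have "susp_total ?B [a, b] = susp_total A1 [a, b]" for a b
    by (simp add: susp_total_transported[OF A g] minimal_operations(3)[OF A1])
  then have "susp H (?B 2) [a, b] = susp H (mult_cochain mul) [a, b]" for a b
    using minimal_operations(3)[OF A1] by (simp add: susp_total_def numeral_2_eq_2 susp2_def)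
  then have *: "susp H (?B 2) w = susp H (mult_cochain mul) w" if "length w = 2" for w
    using that by (auto simp: numeral_2_eq_2 length_Suc_conv)
  have 2: "?B 2 = mult_cochain mul"
  proof
    fix xs show "?B 2 xs = mult_cochain mul xs"
    proof (cases "length xs = 2")
      case True
      then show ?thesis using *[of "koszul_twist H xs"] by (simp add: susp_def)
    qed (use ml[of 2] in \<open>simp add: multilinear_zero_length mult_cochain_def\<close>)
  qed
  have "\<phi>2 = g" if "\<phi>2 = isotopy_of g 2" for \<phi>2 using that by (simp add: isotopy_of_def)
  with isotopy_imp_coboundary(2)[OF A1 iso 2]
  have "(\<lambda>xs. A1 3 xs - ?B 3 xs) = (\<lambda>xs. A1 3 xs - A2 3 xs)" using eq by simp
  then have "A1 3 xs - ?B 3 xs = A1 3 xs - A2 3 xs" for xs by (rule fun_cong)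
  then have 3: "?B 3 = A2 3" by (intro ext) simp
  have t: "transport scale H (isotopy_of g) A1 = ?B" by (rule transport_isotopy_of[OF A g])
  have "{2..3::nat} = {2, 3}" by auto
  moreover have "A2 2 = mult_cochain mul" using A2 by (simp add: minimal_enhancement_def)
  ultimately show "isotopic_mod scale H 3 A1 A2"
    unfolding isotopic_mod_def using iso 2 3 t by (intro exI[of _ "isotopy_of g"]) auto
qed

end

section \<open>Harrison classes\<close>

lemma class_eq_iff:
  fixes C :: "('x \<Rightarrow> 'w::ab_group_add) set"
  assumes R: "R = {(f, g). f \<in> Z \<and> g \<in> Z \<and> (\<lambda>x. f x - g x) \<in> C}"
    and zero: "(\<lambda>_. 0) \<in> C" and diff: "\<And>a b. a \<in> C \<Longrightarrow> b \<in> C \<Longrightarrow> (\<lambda>x. a x - b x) \<in> C"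
    and fg: "f \<in> Z" "g \<in> Z"
  shows "R `` {f} = R `` {g} \<longleftrightarrow> (\<lambda>x. f x - g x) \<in> C"
proof
  assume "R `` {f} = R `` {g}"
  moreover have "g \<in> R `` {g}" using fg zero by (simp add: R)
  ultimately have "g \<in> R `` {f}" by simp
  then show "(\<lambda>x. f x - g x) \<in> C" by (simp add: R)
next
  assume c: "(\<lambda>x. f x - g x) \<in> C"
  have "(\<lambda>x. f x - h x) \<in> C \<longleftrightarrow> (\<lambda>x. g x - h x) \<in> C" for h
    using diff[OF _ c, of "\<lambda>x. f x - h x"] diff[OF _ diff[OF zero c], of "\<lambda>x. g x - h x"] by auto
  then show "R `` {f} = R `` {g}" using fg by (auto simp: R)
qed

lemma shuf_diff: "shuf (\<lambda>u. F u - G u) x y = shuf F x y - shuf G x y"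
  using shuf_add[of "\<lambda>u. F u - G u" G x y] by simp

context graded_vector_space
begin

lemma harrison_diff:
  assumes "f \<in> harrison scale H n j" "g \<in> harrison scale H n j"
  shows "(\<lambda>xs. f xs - g xs) \<in> harrison scale H n j"
  unfolding harrison_def
proof (intro CollectI conjI)
  show "multilinear scale n (\<lambda>xs. f xs - g xs)"
    using assms[THEN harrison_multilinear]
    by (simp add: multilinear_def scale_right_diff_distrib)
  show "has_internal_degree H n j (\<lambda>xs. f xs - g xs)"
    using assms subspace_diff[OF subspace_component]
    by (auto simp: harrison_def has_internal_degree_def)
  have "susp H (\<lambda>xs. f xs - g xs) = (\<lambda>u. susp H f u - susp H g u)" by (rule ext) (simp add: susp_def)
  then show "vanishes_on_shuffles H n (susp H (\<lambda>xs. f xs - g xs))"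
    using assms by (simp add: harrison_def vanishes_on_shuffles_iff shuf_diff)
qed

lemma harrison_d_diff:
  assumes m: "multilinear scale 2 (mult_cochain mul)"
    and "f \<in> harrison scale H 2 (-1)" "g \<in> harrison scale H 2 (-1)"
  shows "(\<lambda>xs. harrison_d H mul 2 (-1) f xs - harrison_d H mul 2 (-1) g xs) =
    harrison_d H mul 2 (-1) (\<lambda>xs. f xs - g xs)"
proof -
  let ?m = "susp2 (mult_cochain mul)"
  have ml: "klinear (\<lambda>x. ?m x b)" "klinear (?m b)" for b
  proof -
    let ?f = "\<lambda>k. if k = 2 then mult_cochain mul else (\<lambda>_. 0)"
    have "multilin (susp_total ?f)"
      by (rule multilin_susp_total) (use m in \<open>auto simp: multilinear_def\<close>)
    from multilin_linear[OF this, of "[]" "[_]"] multilin_linear[OF this, of "[_]" "[]"]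
    show "klinear (\<lambda>x. ?m x b)" "klinear (?m b)"
      by (simp_all add: susp_total_def susp2_def[abs_def])
  qed
  have d: "?m (a - a') b = ?m a b - ?m a' b" "?m b (a - a') = ?m b a - ?m b a'" for a a' b
    using linear_add'[OF ml(1), of "a - a'" a' b] linear_add'[OF ml(2), of b "a - a'" a'] by simp_all
  have q: "susp2 (\<lambda>xs. f xs - g xs) a b = susp2 f a b - susp2 g a b" for a b
    by (simp add: susp2_def susp_def)
  show ?thesis
    unfolding harrison_d_2[OF m assms(2)[THEN harrison_multilinear]]
      harrison_d_2[OF m assms(3)[THEN harrison_multilinear]]
      harrison_d_2[OF m harrison_diff[OF assms(2,3), THEN harrison_multilinear]]
    by (rule ext) (simp add: desusp_def delta3_def q d algebra_simps)
qed

text \<open>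
  The \<open>C\<^sub>\<infinity>\<close>-relation in arity four; the terms with \<open>m\<^sub>4\<close> contain \<open>m\<^sub>1 = 0\<close>.
\<close>

lemma m3_cocycle:
  assumes A: "minimal_enhancement scale H mul A"
  shows "A 3 \<in> harrison_cocycles scale H mul 3 (-1)"
proof -
  note f = minimal_operations[OF A]
  let ?m = "mult_cochain mul"
  have ml3: "multilinear scale 3 (A 3)" by (rule harrison_multilinear[OF f(5)])
  have A1: "A 1 = (\<lambda>_. 0)" and A2: "A 2 = ?m" using A by (simp_all add: minimal_enhancement_def)
  have "harrison_d H mul 3 (-1) (A 3) xs = 0" for xs
  proof -
    let ?w = "koszul_twist H xs"
    have d: "harrison_d H mul 3 (-1) (A 3) xs =
      insertion H 1 3 (susp H ?m) (susp H (A 3)) ?w + insertion H 1 2 (susp H (A 3)) (susp H ?m) ?w"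
      by (simp add: harrison_d_def gerstenhaber_def susp_def[of H "\<lambda>_. _ _ - _ _"] Let_def signed_def)
         (simp add: susp_def)
    show ?thesis
    proof (cases "length xs = 4")
      case False
      then have "insertion H 1 3 (susp H ?m) (susp H (A 3)) ?w = 0"
        using f(4) by (auto intro!: insertion_length[where k = 2] simp: susp_length)
      moreover have "insertion H 1 2 (susp H (A 3)) (susp H ?m) ?w = 0"
        using False ml3 by (auto intro!: insertion_length[where k = 3] simp: susp_length)
      ultimately show ?thesis by (simp add: d)
    next
      case True
      have "0 = (\<Sum>l=1..length ?w. insertion H 1 l (susp H (A (length ?w + 1 - l))) (susp H (A l)) ?w)"
        using f(1) unfolding C_inf_algebra_def by metis
      also have "\<dots> = (\<Sum>l\<in>{1,2,3,4}. insertion H 1 l (susp H (A (5 - l))) (susp H (A l)) ?w)"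
        by (rule sum.cong) (auto simp: True)
      also have "\<dots> = insertion H 1 1 (susp H (A 4)) (susp H (A 1)) ?w + insertion H 1 2 (susp H (A 3)) (susp H ?m) ?w
         + insertion H 1 3 (susp H ?m) (susp H (A 3)) ?w + insertion H 1 4 (susp H (A 1)) (susp H (A 4)) ?w"
        using A2 by simp
      also have "insertion H 1 4 (susp H (A 1)) (susp H (A 4)) ?w = 0"
        by (simp add: insertion_def A1[unfolded One_nat_def] susp_def)
      also have "insertion H 1 1 (susp H (A 4)) (susp H (A 1)) ?w = 0"
      proof -
        have M: "multilin (susp_total A)" by (rule C_inf_susp_total(2)[OF f(1)])
        have "susp H (A 4) (u @ 0 # v) = 0" if "length u + length v = 3" for u v
          using multiadd_zero[OF multilin_multiadd[OF M], of u v] that by (simp add: susp_total_def)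
        then show ?thesis
          unfolding insertion_def by (intro sum.neutral) (auto simp: A1[unfolded One_nat_def] susp_def True)
      qed
      finally show ?thesis by (simp add: d add.commute)
    qed
  qed
  then show ?thesis using f(5) by (auto simp: harrison_cocycles_def)
qed

lemma harrison_class_iff:
  assumes A1: "minimal_enhancement scale H mul A1" and A2: "minimal_enhancement scale H mul A2"
  shows "harrison_class scale H mul 3 (-1) (A1 3) = harrison_class scale H mul 3 (-1) (A2 3) \<longleftrightarrow>
    (\<exists>g\<in>harrison scale H 2 (-1). (\<lambda>xs. A1 3 xs - A2 3 xs) = harrison_d H mul 2 (-1) g)"
proof -
  note m = minimal_operations(4)[OF A1]
  let ?C = "harrison_coboundaries scale H mul 3 (-1)"
  have C: "a \<in> ?C \<longleftrightarrow> (\<exists>g\<in>harrison scale H 2 (-1). a = harrison_d H mul 2 (-1) g)" for a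
    by (auto simp: harrison_coboundaries_def)
  have diff: "(\<lambda>x. a x - b x) \<in> ?C" if "a \<in> ?C" "b \<in> ?C" for a b
    using that harrison_d_diff[OF m] harrison_diff unfolding C by blast
  have "harrison_d H mul 2 (-1) (\<lambda>_. 0) \<in> ?C" using zero_harrison C by blast
  from diff[OF this this] have zero: "(\<lambda>_. 0) \<in> ?C" by simp
  show ?thesis
    unfolding harrison_class_def C[symmetric]
    by (rule class_eq_iff[OF harrison_rel_def zero diff m3_cocycle[OF A1] m3_cocycle[OF A2]])
qed

end

section \<open>Cyclic cochains on Poincare algebras\<close>

context graded_vector_space
begin

text \<open>
  After suspension the sign \<open>(-1)^((|a|-1)(|b|-1))\<close> of the shuffle turns vanishing on shuffles into
  graded symmetry.
\<close>

lemma bilinear_harrison: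
  assumes K: "bilin K" and deg: "\<And>a b d e. a \<in> H d \<Longrightarrow> b \<in> H e \<Longrightarrow> K a b \<in> H (d + e - 1)"
    and sym: "\<And>a b d e. a \<in> H d \<Longrightarrow> b \<in> H e \<Longrightarrow> K a b = signed (d * e) (K b a)"
  shows "(\<lambda>xs. if length xs = 2 then K (xs ! 0) (xs ! 1) else 0) \<in> harrison scale H 2 (-1)"
    (is "?f \<in> _")
  unfolding harrison_def
proof (intro CollectI conjI)
  have l: "klinear (K a)" "klinear (\<lambda>x. K x a)" for a
    using K by (simp_all add: bilin_def)
  note lin = linear_add'[OF l(1)] linear_add'[OF l(2)] linear_scale'[OF l(1)] linear_scale'[OF l(2)]
  show "multilinear scale 2 ?f"
    unfolding multilinear_def
  proof (intro conjI allI impI)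
    fix xs ys :: "'v list" and x y c
    assume "length xs + length ys + 1 = 2"
    then consider a where "xs = []" "ys = [a]" | a where "xs = [a]" "ys = []"
      by (cases xs; cases ys) auto
    then show "?f (xs @ (x + y) # ys) = ?f (xs @ x # ys) + ?f (xs @ y # ys)"
      and "?f (xs @ scale c x # ys) = scale c (?f (xs @ x # ys))"
      by (cases; simp add: lin)+
  qed simp
  show "has_internal_degree H 2 (-1) ?f"
    unfolding internal_degree_iff
  proof (intro allI impI)
    fix w assume "hom_word w" "length w = 2"
    then obtain a b where "w = [a, b]" "snd a \<in> H (fst a + 1)" "snd b \<in> H (fst b + 1)"
      by (auto simp: numeral_2_eq_2 length_Suc_conv)
    then show "?f (map snd w) \<in> H (word_deg w + int 2 + - 1)"
      using deg[of "snd a" "fst a + 1" "snd b" "fst b + 1"] by (simp add: algebra_simps)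
  qed
  show "vanishes_on_shuffles H 2 (susp H ?f)"
    unfolding vanishes_on_shuffles_iff
  proof (intro allI impI)
    fix x y assume *: "hom_word x" "hom_word y" "x \<noteq> []" "y \<noteq> []" "length x + length y = 2"
    then obtain a b where xy: "x = [a]" "y = [b]"
      by (cases x; cases y) auto
    obtain d u e v where ab: "a = (d, u)" "b = (e, v)" by force
    have uv: "u \<in> H (d + 1)" "v \<in> H (e + 1)" using * xy ab by auto
    have s: "K (signed i p) q = signed i (K p q)" for i p q
      using lin(4)[of "-1" p q] by (simp add: signed_def)
    have "shuf (susp H ?f) x y = signed (d + 1) (K u v) + signed (e * d + (e + 1)) (K v u)"
      using uv by (simp add: xy ab susp_def degree_sign_homogeneous[of _ "d + 1"] degree_sign_homogeneous[of _ "e + 1"] s)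
    also have "K v u = signed ((e + 1) * (d + 1)) (K u v)" by (rule sym[OF uv(2,1)])
    finally show "shuf (susp H ?f) x y = 0" by (simp add: signed_def)
  qed
qed

end

context finite_dim_gca
begin

lemma mul_add: "mul (x + y) z = mul x z + mul y z" "mul z (x + y) = mul z x + mul z y"
  using linear_add'[OF mult_linear_left] linear_add'[OF mult_linear_right] by auto

lemma mul_scale: "mul (scale c x) z = scale c (mul x z)" "mul z (scale c x) = scale c (mul z x)"
  using linear_scale'[OF mult_linear_left] linear_scale'[OF mult_linear_right] by auto

lemma mul_zero [simp]: "mul 0 z = 0" "mul z 0 = 0"
  using mul_add(1)[of 0 0 z] mul_add(2)[of z 0 0] by simp_all

lemma mul_minus: "mul (- x) z = - mul x z" "mul z (- x) = - mul z x"
  using mul_add(1)[of "- x" x z] mul_add(2)[of z "- x" x] by (simp_all add: eq_neg_iff_add_eq_0)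

lemma mul_diff: "mul (x - y) z = mul x z - mul y z" "mul z (x - y) = mul z x - mul z y"
  using mul_add(1)[of x "- y" z] mul_add(2)[of z x "- y"] by (simp_all add: mul_minus)

lemma mul_signed: "mul (signed e x) z = signed e (mul x z)" "mul z (signed e x) = signed e (mul z x)"
  by (simp_all add: signed_def mul_minus)

lemma mul_commute: "x \<in> H d \<Longrightarrow> y \<in> H e \<Longrightarrow> mul x y = signed (d * e) (mul y x)"
  by (simp add: mult_graded_commute[of x d y e] signed_def)

lemma mult_cochain_multilinear: "multilinear scale 2 (mult_cochain mul)"
  unfolding multilinear_def
proof (intro conjI allI impI)
  fix xs ys :: "'v list" and x y c
  assume "length xs + length ys + 1 = 2"
  then consider a where "xs = []" "ys = [a]" | a where "xs = [a]" "ys = []"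
    by (cases xs; cases ys) auto
  then show "mult_cochain mul (xs @ (x + y) # ys) = mult_cochain mul (xs @ x # ys) + mult_cochain mul (xs @ y # ys)"
    and "mult_cochain mul (xs @ scale c x # ys) = scale c (mult_cochain mul (xs @ x # ys))"
    by (cases; simp add: mult_cochain_def mul_add mul_scale)+
qed (simp add: mult_cochain_def)

context
  fixes g assumes g: "g \<in> harrison scale H 2 (-1)"
begin

lemma cochain2_add: "g [x + x', y] = g [x, y] + g [x', y]" "g [x, y + y'] = g [x, y] + g [x, y']"
  and cochain2_scale: "g [scale c x, y] = scale c (g [x, y])" "g [x, scale c y] = scale c (g [x, y])"
proof -
  have m: "multilinear scale 2 g" by (rule harrison_multilinear[OF g])
  have *: "length xs + length ys + 1 = 2 \<Longrightarrow> g (xs @ (x + y) # ys) = g (xs @ x # ys) + g (xs @ y # ys) \<and>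
        g (xs @ scale c x # ys) = scale c (g (xs @ x # ys))" for xs ys x y c
    using m unfolding multilinear_def by blast
  show "g [x + x', y] = g [x, y] + g [x', y]" "g [x, y + y'] = g [x, y] + g [x, y']"
    "g [scale c x, y] = scale c (g [x, y])" "g [x, scale c y] = scale c (g [x, y])"
    using *[of "[]" "[y]" x x' c] *[of "[x]" "[]" y y' c] by simp_all
qed

lemma cochain2_minus: "g [- x, y] = - g [x, y]" "g [x, - y] = - g [x, y]"
  using cochain2_scale(1)[of "-1" x y] cochain2_scale(2)[of x "-1" y] by simp_all

lemma cochain2_signed: "g [signed e x, y] = signed e (g [x, y])" "g [x, signed e y] = signed e (g [x, y])"
  by (simp_all add: signed_def cochain2_minus)

lemma cochain2_zero: "g [0, y] = 0" "g [x, 0] = 0"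
  using cochain2_scale(1)[of 0 0 y] cochain2_scale(2)[of x 0 0] by simp_all

lemma cochain2_degree: "x \<in> H d \<Longrightarrow> y \<in> H e \<Longrightarrow> g [x, y] \<in> H (d + e - 1)"
  using g by (auto simp: harrison_def has_internal_degree_def homog_def dest!: spec[of _ "[d, e]"])

lemma cochain2_sym:
  assumes "x \<in> H d" "y \<in> H e"
  shows "g [x, y] = signed (d * e) (g [y, x])"
proof -
  have "susp2 g x y + signed ((d - 1) * (e - 1)) (susp2 g y x) = 0"
    using susp2_properties(4)[OF g, of x "d - 1" y "e - 1"] assms by simp
  moreover have "susp2 g x y = signed d (g [x, y])" "susp2 g y x = signed e (g [y, x])"
    using assms by (simp_all add: susp2_def susp_def degree_sign_homogeneous[of _ d] degree_sign_homogeneous[of _ e] cochain2_signed)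
  ultimately have "signed d (g [x, y]) + signed ((d - 1) * (e - 1) + e) (g [y, x]) = 0" by simp
  then have "signed d (signed d (g [x, y]) + signed ((d - 1) * (e - 1) + e) (g [y, x])) = 0" by simp
  then have "signed (d + d) (g [x, y]) + signed (d + ((d - 1) * (e - 1) + e)) (g [y, x]) = 0"
    unfolding signed_add signed_signed .
  moreover have "signed (d + d) (g [x, y]) = g [x, y]" by (simp add: signed_def)
  moreover have "signed (d + ((d - 1) * (e - 1) + e)) (g [y, x]) = - signed (d * e) (g [y, x])"
    by (simp add: signed_def)
  ultimately show ?thesis by simp
qed

lemma susp2_homogeneous: "x \<in> H d \<Longrightarrow> susp2 g x y = signed d (g [x, y])"
  by (simp add: susp2_def susp_def degree_sign_homogeneous[of _ d] cochain2_signed)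

lemma susp2_mult_homogeneous: "x \<in> H d \<Longrightarrow> susp2 (mult_cochain mul) x y = signed d (mul x y)"
  by (simp add: susp2_def susp_def mult_cochain_def degree_sign_homogeneous[of _ d] mul_signed)

text \<open>
  The differential in terms of unsuspended degrees, up to signs the Hochschild differential.
\<close>

lemma harrison_d_homogeneous:
  assumes "x \<in> H a" "y \<in> H b" "z \<in> H c"
  shows "harrison_d H mul 2 (-1) g [x, y, z] =
    - mul (g [x, y]) z + signed a (mul x (g [y, z])) - g [mul x y, z] + g [x, mul y z]"
proof -
  (* On three letters the desuspension only affects the middle one. *)
  let ?y = "signed b y"
  have y: "?y \<in> H b" using assms(2) by (rule component_signed)
  have tw: "koszul_twist H [x, y, z] = [x, ?y, z]"
    using assms by (simp add: degree_sign_homogeneous[of _ a] degree_sign_homogeneous[of _ b]) (simp add: signed_def)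
  have 1: "susp2 (mult_cochain mul) (susp2 g x ?y) z = - mul (g [x, y]) z"
  proof -
    have "susp2 g x ?y \<in> H (a + b - 1)"
      using cochain2_degree[OF assms(1) y] assms(1) by (simp add: susp2_homogeneous component_signed)
    then show ?thesis
      using assms(1) by (simp add: susp2_mult_homogeneous[of _ "a + b - 1"] susp2_homogeneous[of _ a] cochain2_signed mul_signed)
        (simp add: signed_def)
  qed
  have 2: "susp2 (mult_cochain mul) x (susp2 g ?y z) = signed a (mul x (g [y, z]))"
    using assms(1) y by (simp add: susp2_mult_homogeneous susp2_homogeneous[of _ b] cochain2_signed mul_signed)
      (simp add: signed_def)
  have 3: "susp2 g (susp2 (mult_cochain mul) x ?y) z = g [mul x y, z]"
  proof -
    have "susp2 (mult_cochain mul) x ?y \<in> H (a + b)"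
      using mult_degree[OF assms(1) y] assms(1) by (simp add: susp2_mult_homogeneous component_signed)
    then show ?thesis
      using assms(1) by (simp add: susp2_homogeneous[of _ "a + b"] susp2_mult_homogeneous[of _ a] cochain2_signed mul_signed)
        (simp add: signed_def)
  qed
  have 4: "susp2 g (letter_sign x) (susp2 (mult_cochain mul) ?y z) = - g [x, mul y z]"
    using assms(1) y component_signed[OF assms(1)]
    by (simp add: degree_sign_homogeneous[of _ a] susp2_homogeneous[of _ a] susp2_mult_homogeneous[of _ b] cochain2_signed mul_signed)
      (simp add: signed_def)
  show ?thesis
    unfolding harrison_d_2[OF mult_cochain_multilinear harrison_multilinear[OF g]]
    using tw by (simp add: desusp_def delta3_def 1 2 3 4)
qed

lemma susp2_add: "susp2 g (x + x') y = susp2 g x y + susp2 g x' y" "susp2 g x (y + y') = susp2 g x y + susp2 g x y'"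
  using linear_add'[of "susp2 g x"] linear_add'[of "\<lambda>x. susp2 g x y"] susp2_properties(1)[OF g] by (auto simp: bilin_def)

end

lemma susp2_mult_add: "susp2 (mult_cochain mul) (x + x') y = susp2 (mult_cochain mul) x y + susp2 (mult_cochain mul) x' y"
  "susp2 (mult_cochain mul) x (y + y') = susp2 (mult_cochain mul) x y + susp2 (mult_cochain mul) x y'"
  by (simp_all add: susp2_def susp_def mult_cochain_def mul_add linear_add'[OF linear_degree_sign])

lemma harrison_d_eqI:
  assumes f: "f \<in> harrison scale H 2 (-1)" and g: "g \<in> harrison scale H 2 (-1)"
    and eq: "\<And>x y z a b c. x \<in> H a \<Longrightarrow> y \<in> H b \<Longrightarrow> z \<in> H c \<Longrightarrow>
      harrison_d H mul 2 (-1) f [x, y, z] = harrison_d H mul 2 (-1) g [x, y, z]"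
  shows "harrison_d H mul 2 (-1) f = harrison_d H mul 2 (-1) g"
proof -
  let ?m = "susp2 (mult_cochain mul)"
  let ?D = "\<lambda>x y z. delta3 ?m (susp2 f) x y z - delta3 ?m (susp2 g) x y z"
  note d2 = harrison_d_2[OF mult_cochain_multilinear f[THEN harrison_multilinear]]
    harrison_d_2[OF mult_cochain_multilinear g[THEN harrison_multilinear]]
  note lin = susp2_add[OF f] susp2_add[OF g] susp2_mult_add linear_add'[OF linear_degree_sign]
  have hom: "?D x y z = 0" if "x \<in> H a" "y \<in> H b" "z \<in> H c" for x y z a b c
  proof -
    let ?y = "signed b y"
    have "koszul_twist H [x, ?y, z] = [x, y, z]"
      using that component_signed[OF that(2), of b]
      by (simp add: degree_sign_homogeneous[of _ a] degree_sign_homogeneous[of _ b]) (simp add: signed_def)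
    then show ?thesis
      using eq[OF that(1) component_signed[OF that(2), of b] that(3)] by (simp add: d2 desusp_def)
  qed
  have "?D x y z = 0" for x y z
  proof (rule additive_ext_homogeneous[of "\<lambda>x. ?D x y z"])
    fix x a assume x: "x \<in> H a"
    show "?D x y z = 0"
    proof (rule additive_ext_homogeneous[of "\<lambda>y. ?D x y z"])
      fix y b assume y: "y \<in> H b"
      show "?D x y z = 0"
      proof (rule additive_ext_homogeneous[of "\<lambda>z. ?D x y z"])
        fix z c assume "z \<in> H c"
        with x y show "?D x y z = 0" by (rule hom)
      qed (simp add: delta3_def lin algebra_simps)
    qed (simp add: delta3_def lin algebra_simps)
  qed (simp add: delta3_def lin algebra_simps)
  then show ?thesis by (simp add: d2)
qed

end

context poincare_gca
begin

abbreviation "pairing \<equiv> poincare_pairing H mul n integ"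

text \<open>
  The integral, extended by zero to the other degrees, so that it is linear on all of \<open>H\<close>.
\<close>

definition trace :: "'v \<Rightarrow> 'k" where "trace a = integ (hcomp H a (int n))"

lemma pairing_trace: "pairing a b = trace (mul a b)"
  by (simp add: poincare_pairing_def trace_def)

lemma trace_add: "trace (a + b) = trace a + trace b"
  by (simp add: trace_def hcomp_add integ_add hcomp_mem)

lemma trace_scale: "trace (scale c a) = c * trace a"
  by (simp add: trace_def hcomp_scale integ_scale hcomp_mem)

lemma trace_minus: "trace (- a) = - trace a"
  using trace_scale[of "-1" a] by simp

lemma trace_diff: "trace (a - b) = trace a - trace b"
  using trace_add[of a "- b"] by (simp add: trace_minus)

lemma trace_signed: "trace (signed e a) = signed e (trace a)"
  by (simp add: signed_def trace_minus)

lemma trace_zero [simp]: "trace 0 = 0"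
  using trace_scale[of 0 0] by simp

lemma trace_degree: "a \<in> H d \<Longrightarrow> d \<noteq> int n \<Longrightarrow> trace a = 0"
  using integ_scale[of 0 0] component_0 by (simp add: trace_def hcomp_homogeneous[of a d])

lemma nondegenerate': "(\<And>b. pairing a b = pairing a' b) \<Longrightarrow> a = a'"
  using nondegenerate[of "a - a'"] by (simp add: pairing_trace mul_diff trace_diff)

text \<open>
  The map \<open>a \<mapsto> \<Sum>\<^sub>b \<langle>a, b\<rangle> b\<close>, summed over a finite basis, is an injective endomorphism of
  a finite dimensional space, hence surjective.
\<close>

lemma riesz:
  assumes L: "\<And>x y. L (x + y) = L x + L y" "\<And>c x. L (scale c x) = c * L x"
  shows "\<exists>a. \<forall>v. pairing a v = L v"
proof -
  obtain S where S: "finite S" "span S = UNIV" using finite_dim by blast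
  obtain B where B: "B \<subseteq> S" "independent B" "S \<subseteq> span B"
    using maximal_independent_subset[of S] by blast
  have fB: "finite B" using B S finite_subset by blast
  have sB: "span B = UNIV" using S(2) span_minimal[OF B(3) subspace_span] by auto
  interpret fd: finite_dimensional_vector_space scale B
    by unfold_locales (use fB B sB in auto)
  let ?T = "\<lambda>a. \<Sum>b\<in>B. scale (pairing a b) b"
  have ext: "pairing a v = M v" if "\<And>b. b \<in> B \<Longrightarrow> pairing a b = M b"
    "\<And>x y. M (x + y) = M x + M y" "\<And>c x. M (scale c x) = c * M x" for a M v
  proof -
    have "v \<in> span B" using sB by simp
    moreover have "M 0 = 0" using that(3)[of 0 0] by simp
    ultimately show ?thesis
      by (induction rule: span_induct_alt)
        (simp_all add: pairing_trace mul_add mul_scale trace_add trace_scale that(2,3) that(1)[unfolded pairing_trace])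
  qed
  have linT: "klinear ?T"
    by (rule linearI')
      (simp_all add: pairing_trace mul_add mul_scale trace_add trace_scale scale_left_distrib sum.distrib scale_sum_right)
  have coef: "u b = w b" if "(\<Sum>b\<in>B. scale (u b) b) = (\<Sum>b\<in>B. scale (w b) b)" "b \<in> B" for u w b
  proof -
    have "(\<Sum>b\<in>B. scale (u b - w b) b) = 0"
      using that(1) by (simp add: scale_left_diff_distrib sum_subtractf)
    from independentD[OF B(2) fB subset_refl this that(2)] show ?thesis by simp
  qed
  have "inj ?T"
  proof (rule injI)
    fix a a' assume "?T a = ?T a'"
    then have "pairing a b = pairing a' b" if "b \<in> B" for b
      using coef[of "pairing a" "pairing a'"] that by blast
    then have "pairing a v = pairing a' v" for v
      by (rule ext) (simp_all add: pairing_trace mul_add mul_scale trace_add trace_scale)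
    then show "a = a'" by (rule nondegenerate')
  qed
  then have "surj ?T" by (rule fd.linear_inj_imp_surj[OF linT])
  from surjD[OF this, of "\<Sum>b\<in>B. scale (L b) b"]
  obtain a where "?T a = (\<Sum>b\<in>B. scale (L b) b)" by (auto dest: sym)
  then have "pairing a b = L b" if "b \<in> B" for b
    using coef[of "pairing a" L] that by blast
  then have "pairing a v = L v" for v by (rule ext) (simp_all add: L)
  then show ?thesis by blast
qed

lemma pairing_component:
  assumes "v \<in> H k"
  shows "pairing a v = pairing (hcomp H a (int n - k)) v"
proof -
  have "pairing a v - pairing (hcomp H a (int n - k)) v = 0"
  proof (rule additive_ext_homogeneous[of "\<lambda>a. pairing a v - pairing (hcomp H a (int n - k)) v"])
    fix a d assume a: "a \<in> H d"
    show "pairing a v - pairing (hcomp H a (int n - k)) v = 0"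
      using trace_degree[OF mult_degree[OF a assms]] by (auto simp: hcomp_homogeneous[OF a] pairing_trace)
  qed (simp add: pairing_trace hcomp_add mul_add trace_add)
  then show ?thesis by simp
qed

text \<open>
  The pairing puts \<open>H\<^sup>d\<close> in duality with \<open>H\<^sup>n\<^sup>-\<^sup>d\<close>.
\<close>

lemma degree_by_pairing:
  assumes "\<And>v k. v \<in> H k \<Longrightarrow> k \<noteq> int n - d \<Longrightarrow> pairing a v = 0"
  shows "a \<in> H d"
proof -
  have "hcomp H a e = 0" if "e \<noteq> d" for e
  proof (rule nondegenerate)
    fix b
    show "pairing (hcomp H a e) b = 0"
    proof (rule additive_ext_homogeneous[of "pairing (hcomp H a e)"])
      fix v k assume v: "v \<in> H k"
      show "pairing (hcomp H a e) v = 0"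
      proof (cases "k = int n - e")
        case True
        then show ?thesis using pairing_component[OF v, of a] assms[OF v] that by simp
      next
        case False
        then show ?thesis
          using trace_degree[OF mult_degree[OF hcomp_mem v]] by (simp add: pairing_trace)
      qed
    qed (simp add: pairing_trace mul_add trace_add)
  qed
  then have "e = d" if "hcomp H a e \<noteq> 0" for e using that by blast
  then have "(\<Sum>e | hcomp H a e \<noteq> 0. hcomp H a e) \<in> H d"
    using hcomp_mem[of a d] by (intro component_sum) fastforce
  then show ?thesis by (simp add: sum_hcomp)
qed

text \<open>
  For any \<open>g\<close> with \<open>\<integral> g(u,v) = 0\<close> the terms \<open>\<integral> g(xy,z)\<close> and \<open>\<integral> g(x,yz)\<close> of \<open>\<integral> \<delta>g(x,y,z)\<close>
  vanish; if the whole integral is zero as well, what remains is \<open>\<langle>g(x,y), z\<rangle> = \<plusminus>\<langle>g(y,z), x\<rangle>\<close>,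
  with the sign of cyclicity. To achieve \<open>\<integral> g = 0\<close> without changing \<open>\<delta>g\<close>, the cocycle
  \<open>E(x,y) = \<plusminus>x h(y) + h(x) y - h(xy)\<close> is added. Both \<open>\<integral> h(x) y\<close> and, by graded symmetry,
  \<open>\<integral> \<plusminus>x h(y)\<close> are equal to \<open>- \<integral> g(x,y) / 2\<close>, which explains the factor, and \<open>\<integral> h(xy)\<close> vanishes for
  reasons of degree.
\<close>

lemma cyclic_representative:
  assumes g: "g \<in> harrison scale H 2 (-1)"
    and tr0: "\<And>x y z a b c. x \<in> H a \<Longrightarrow> y \<in> H b \<Longrightarrow> z \<in> H c \<Longrightarrow> trace (harrison_d H mul 2 (-1) g [x, y, z]) = 0"
  shows "\<exists>g'\<in>harrison scale H 2 (-1). cyclic_cochain H pairing 2 g' \<and>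
    harrison_d H mul 2 (-1) g' = harrison_d H mul 2 (-1) g"
proof -
  note gl = cochain2_add[OF g] cochain2_scale[OF g]
  have "\<exists>a. \<forall>v. pairing a v = - (1/2) * trace (g [u, v])" for u
    by (rule riesz) (simp_all add: gl trace_add trace_scale algebra_simps)
  then obtain h where h: "pairing (h u) v = - (1/2) * trace (g [u, v])" for u v by metis
  have h_add: "h (u + u') = h u + h u'" for u u'
  proof (rule nondegenerate')
    fix b
    have "pairing (h u + h u') b = pairing (h u) b + pairing (h u') b"
      by (simp add: pairing_trace mul_add trace_add)
    then show "pairing (h (u + u')) b = pairing (h u + h u') b"
      by (simp only: h) (simp add: gl trace_add algebra_simps)
  qed
  have h_scale: "h (scale c u) = scale c (h u)" for c u
  proof (rule nondegenerate')
    fix b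
    have "pairing (scale c (h u)) b = c * pairing (h u) b"
      by (simp add: pairing_trace mul_scale trace_scale)
    then show "pairing (h (scale c u)) b = pairing (scale c (h u)) b"
      by (simp only: h) (simp add: gl trace_scale)
  qed
  have h_deg: "h u \<in> H (d - 1)" if "u \<in> H d" for u d
    by (rule degree_by_pairing) (use trace_degree[OF cochain2_degree[OF g that]] in \<open>force simp: h\<close>)
  have h_minus: "h (- u) = - h u" for u using h_scale[of "-1" u] by simp
  have h_signed: "h (signed e u) = signed e (h u)" for e u by (simp add: signed_def h_minus)

  define E where "E x y = mul (degree_sign H 1 0 x) (h y) + mul (h x) y - h (mul x y)" for x y
  have E: "E x y = signed d (mul x (h y)) + mul (h x) y - h (mul x y)" if "x \<in> H d" for x y d
    using that by (simp add: E_def degree_sign_homogeneous[of _ d] mul_signed)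
  define K where "K x y = g [x, y] + E x y" for x y
  define g' where "g' xs = (if length xs = 2 then K (xs ! 0) (xs ! 1) else 0)" for xs

  have K_bilin: "bilin K"
    unfolding bilin_def
    by (intro allI conjI linearI')
      (simp_all add: K_def E_def gl mul_add mul_scale h_add h_scale scale_right_distrib scale_right_diff_distrib
        linear_add'[OF linear_degree_sign] linear_scale'[OF linear_degree_sign] algebra_simps)
  have E_deg: "E x y \<in> H (d + e - 1)" if x: "x \<in> H d" and y: "y \<in> H e" for x y d e
  proof -
    have "mul x (h y) \<in> H (d + (e - 1))" "mul (h x) y \<in> H (d - 1 + e)" "h (mul x y) \<in> H (d + e - 1)"
      using mult_degree[OF x h_deg[OF y]] mult_degree[OF h_deg[OF x] y] h_deg[OF mult_degree[OF x y]] .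
    then show ?thesis
      unfolding E[OF x] by (intro subspace_diff[OF subspace_component] component_add component_signed)
        (simp_all add: algebra_simps)
  qed
  have E_sym: "E x y = signed (d * e) (E y x)" if x: "x \<in> H d" and y: "y \<in> H e" for x y d e
  proof -
    have 1: "mul x (h y) = signed (d * (e - 1)) (mul (h y) x)" by (rule mul_commute[OF x h_deg[OF y]])
    have 2: "mul (h x) y = signed ((d - 1) * e) (mul y (h x))" by (rule mul_commute[OF h_deg[OF x] y])
    have 3: "mul x y = signed (d * e) (mul y x)" by (rule mul_commute[OF x y])
    have "E x y = signed (d + d * (e - 1)) (mul (h y) x) + signed ((d - 1) * e) (mul y (h x)) - signed (d * e) (h (mul y x))"
      unfolding E[OF x] 1 2 3 by (simp add: h_signed)
    also have "signed (d + d * (e - 1)) (mul (h y) x) = signed (d * e) (mul (h y) x)"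
      by (rule signed_cong) auto
    also have "signed ((d - 1) * e) (mul y (h x)) = signed (d * e + e) (mul y (h x))"
      by (rule signed_cong) auto
    also have "signed (d * e) (mul (h y) x) + signed (d * e + e) (mul y (h x)) - signed (d * e) (h (mul y x)) =
      signed (d * e) (E y x)"
      unfolding E[OF y] by (simp add: signed_def)
    finally show ?thesis .
  qed
  have g': "g' \<in> harrison scale H 2 (-1)"
    unfolding g'_def[abs_def]
  proof (rule bilinear_harrison[OF K_bilin])
    fix a b d e assume ab: "a \<in> H d" "b \<in> H e"
    show "K a b \<in> H (d + e - 1)"
      unfolding K_def by (intro component_add cochain2_degree[OF g ab] E_deg[OF ab])
    show "K a b = signed (d * e) (K b a)"
      unfolding K_def signed_add using cochain2_sym[OF g ab] E_sym[OF ab] by simp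
  qed
  have g'_pair: "g' [x, y] = g [x, y] + E x y" for x y by (simp add: g'_def K_def)

  have dg': "harrison_d H mul 2 (-1) g' = harrison_d H mul 2 (-1) g"
  proof (rule harrison_d_eqI[OF g' g])
    fix x y z a b c assume xyz: "x \<in> H a" "y \<in> H b" "z \<in> H c"
    have "- mul (E x y) z + signed a (mul x (E y z)) - E (mul x y) z + E x (mul y z) = 0"
      unfolding E[OF xyz(1)] E[OF xyz(2)] E[OF mult_degree[OF xyz(1,2)]]
      by (simp add: mul_add mul_diff mul_signed signed_add mult_assoc) (simp add: signed_def mult_assoc algebra_simps)
    then show "harrison_d H mul 2 (-1) g' [x, y, z] = harrison_d H mul 2 (-1) g [x, y, z]"
      unfolding harrison_d_homogeneous[OF g' xyz] harrison_d_homogeneous[OF g xyz] g'_pair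
      by (simp add: mul_add signed_add algebra_simps)
  qed

  have trg': "trace (g' [x, y]) = 0" if x: "x \<in> H d" and y: "y \<in> H e" for x y d e
  proof -
    have 1: "trace (mul (h x) y) = - (1/2) * trace (g [x, y])" using h[of x y] by (simp add: pairing_trace)
    have "trace (mul x (h y)) = signed (d * (e - 1)) (trace (mul (h y) x))"
      using mul_commute[OF x h_deg[OF y]] by (simp add: trace_signed)
    also have "trace (mul (h y) x) = - (1/2) * trace (g [y, x])" using h[of y x] by (simp add: pairing_trace)
    also have "trace (g [y, x]) = signed (e * d) (trace (g [x, y]))" using cochain2_sym[OF g y x] by (simp add: trace_signed)
    finally have 2: "signed d (trace (mul x (h y))) = - (1/2) * trace (g [x, y])" by (auto simp: signed_def)
    (* Either the degrees do not match or x y lies in the degree n + 1, where H vanishes. *)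
    have 3: "trace (h (mul x y)) = 0"
    proof -
      have "trace (h (mul x y)) = - (1/2) * trace (g [mul x y, unit])"
        using h[of "mul x y" unit] by (simp add: pairing_trace unit_right)
      also have "trace (g [mul x y, unit]) = 0"
      proof (cases "d + e - 1 = int n")
        case True
        then have "mul x y \<in> {0}" using mult_degree[OF x y] degree_range[of "d + e"] by simp
        then show ?thesis by (simp add: cochain2_zero[OF g])
      next
        case False
        then show ?thesis using trace_degree[OF cochain2_degree[OF g mult_degree[OF x y] unit_degree]] by simp
      qed
      finally show ?thesis by simp
    qed
    show ?thesis
      unfolding g'_pair E[OF x] by (simp add: trace_add trace_diff trace_signed 1 2 3)
  qed

  have "cyclic_cochain H pairing 2 g'"
    unfolding cyclic_cochain_def
  proof (intro allI impI)
    fix d ds x xs assume len: "length xs = 2" and x: "x \<in> H d" and hom: "homog H ds xs"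
    obtain y z where xs: "xs = [y, z]" using len by (auto simp: numeral_2_eq_2 length_Suc_conv)
    then obtain b c where ds: "ds = [b, c]" and yz: "y \<in> H b" "z \<in> H c"
      using hom by (auto simp: homog_def list_all2_Cons2)
    have "0 = trace (harrison_d H mul 2 (-1) g' [x, y, z])" using tr0[OF x yz] dg' by simp
    also have "\<dots> = - trace (mul (g' [x, y]) z) + signed d (trace (mul x (g' [y, z])))"
      unfolding harrison_d_homogeneous[OF g' x yz]
      using trg'[OF mult_degree[OF x yz(1)] yz(2)] trg'[OF x mult_degree[OF yz]]
      by (simp add: trace_add trace_diff trace_minus trace_signed)
    also have "mul x (g' [y, z]) = signed (d * (b + c - 1)) (mul (g' [y, z]) x)"
      by (rule mul_commute[OF x cochain2_degree[OF g' yz]])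
    finally have "trace (mul (g' [x, y]) z) = signed (d + d * (b + c - 1)) (trace (mul (g' [y, z]) x))"
      by (simp add: trace_signed)
    also have "\<dots> = signed (int 2 + d * sum_list ds) (trace (mul (g' [y, z]) x))"
      by (rule signed_cong) (auto simp: ds)
    finally show "cyclic_form pairing g' (x # xs) = signed (int 2 + d * sum_list ds) (cyclic_form pairing g' (xs @ [x]))"
      by (simp add: cyclic_form_def xs pairing_trace)
  qed
  with g' dg' show ?thesis by blast
qed

lemma pairing_diff: "pairing (a - b) v = pairing a v - pairing b v"
  by (simp add: pairing_trace mul_diff trace_diff)

lemma cyclic_form_diff:
  "cyclic_form pairing (\<lambda>xs. f xs - g xs) = (\<lambda>xs. cyclic_form pairing f xs - cyclic_form pairing g xs)"
  by (rule ext) (simp add: cyclic_form_def pairing_diff)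

lemma cyclic_form_inject:
  assumes "cyclic_form pairing f = cyclic_form pairing g"
  shows "f = g"
proof
  fix xs
  have "pairing (f xs) y = pairing (g xs) y" for y
    using fun_cong[OF assms, of "xs @ [y]"] by (simp add: cyclic_form_def)
  then show "f xs = g xs" by (rule nondegenerate')
qed

lemma cyclic_harrison_diff:
  assumes "f \<in> cyclic_harrison scale H pairing k j" "g \<in> cyclic_harrison scale H pairing k j"
  shows "(\<lambda>xs. f xs - g xs) \<in> cyclic_harrison scale H pairing k j"
  using assms harrison_diff
  by (auto simp: cyclic_harrison_def cyclic_cochain_def cyclic_form_diff signed_def)

lemma HC_class_iff:
  assumes A1: "minimal_unital_cyclic_enhancement scale H mul unit pairing A1"
    and A2: "minimal_unital_cyclic_enhancement scale H mul unit pairing A2"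
  shows "HC_class scale H mul pairing 4 (-1) (cyclic_form pairing (A1 3)) =
      HC_class scale H mul pairing 4 (-1) (cyclic_form pairing (A2 3)) \<longleftrightarrow>
    (\<exists>g\<in>cyclic_harrison scale H pairing 2 (-1). (\<lambda>xs. A1 3 xs - A2 3 xs) = harrison_d H mul 2 (-1) g)"
proof -
  let ?C = "HC_coboundaries scale H mul pairing 4 (-1)"
  let ?T = "cyclic_form pairing"
  have C: "a \<in> ?C \<longleftrightarrow> (\<exists>g\<in>cyclic_harrison scale H pairing 2 (-1). a = ?T (harrison_d H mul 2 (-1) g))" for a
    by (auto simp: HC_coboundaries_def)
  have diff: "(\<lambda>x. a x - b x) \<in> ?C" if "a \<in> ?C" "b \<in> ?C" for a b
  proof -
    from that obtain f g where f: "f \<in> cyclic_harrison scale H pairing 2 (-1)" "a = ?T (harrison_d H mul 2 (-1) f)"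
      and g: "g \<in> cyclic_harrison scale H pairing 2 (-1)" "b = ?T (harrison_d H mul 2 (-1) g)"
      unfolding C by blast
    have "f \<in> harrison scale H 2 (-1)" "g \<in> harrison scale H 2 (-1)"
      using f g by (simp_all add: cyclic_harrison_def)
    then have "(\<lambda>x. a x - b x) = ?T (harrison_d H mul 2 (-1) (\<lambda>xs. f xs - g xs))"
      unfolding f g by (simp only: cyclic_form_diff[symmetric] harrison_d_diff[OF mult_cochain_multilinear])
    then show ?thesis using cyclic_harrison_diff[OF f(1) g(1)] C by blast
  qed
  have "(\<lambda>_. 0) \<in> cyclic_harrison scale H pairing 2 (-1)"
    by (simp add: cyclic_harrison_def zero_harrison cyclic_cochain_def cyclic_form_def pairing_trace)
  then have "?T (harrison_d H mul 2 (-1) (\<lambda>_. 0)) \<in> ?C" using C by blast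
  from diff[OF this this] have zero: "(\<lambda>_. 0) \<in> ?C" by simp
  have Z: "?T (A 3) \<in> HC_cocycles scale H mul pairing 4 (-1)"
    if "minimal_unital_cyclic_enhancement scale H mul unit pairing A" for A
  proof -
    from that have "minimal_enhancement scale H mul A" "cyclic_cochain H pairing 3 (A 3)"
      by (simp_all add: minimal_unital_cyclic_enhancement_def)
    with m3_cocycle[of mul A] show ?thesis
      by (auto simp: HC_cocycles_def cyclic_harrison_def harrison_cocycles_def)
  qed
  have "HC_class scale H mul pairing 4 (-1) (?T (A1 3)) = HC_class scale H mul pairing 4 (-1) (?T (A2 3)) \<longleftrightarrow>
      (\<lambda>x. ?T (A1 3) x - ?T (A2 3) x) \<in> ?C"
    unfolding HC_class_def by (rule class_eq_iff[OF HC_rel_def zero diff Z[OF A1] Z[OF A2]])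
  also have "\<dots> \<longleftrightarrow> (\<exists>g\<in>cyclic_harrison scale H pairing 2 (-1).
      ?T (\<lambda>xs. A1 3 xs - A2 3 xs) = ?T (harrison_d H mul 2 (-1) g))"
    by (simp only: C cyclic_form_diff)
  also have "\<dots> \<longleftrightarrow> (\<exists>g\<in>cyclic_harrison scale H pairing 2 (-1).
      (\<lambda>xs. A1 3 xs - A2 3 xs) = harrison_d H mul 2 (-1) g)"
    using cyclic_form_inject by (intro bex_cong refl iffI) auto
  finally show ?thesis .
qed

text \<open>
  \<open>\<integral> m\<^sub>3(x,y,z)\<close> is \<open>\<langle>m\<^sub>3(x,y,z), 1\<rangle>\<close>, and a cyclic rotation moves the unit into an input of
  \<open>m\<^sub>3\<close>.
\<close>

lemma trace_m3:
  assumes A: "minimal_unital_cyclic_enhancement scale H mul unit pairing A"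
    and xyz: "x \<in> H a" "y \<in> H b" "z \<in> H c"
  shows "trace (A 3 [x, y, z]) = 0"
proof -
  have cyc: "cyclic_cochain H pairing 3 (A 3)" and norm: "normalized_cochain unit (A 3)"
    using A by (simp_all add: minimal_unital_cyclic_enhancement_def)
  have "homog H [b, c, 0] [y, z, unit]" using xyz unit_degree by (simp add: homog_def)
  then have "cyclic_form pairing (A 3) (x # [y, z, unit]) =
      signed (int 3 + a * sum_list [b, c, 0]) (cyclic_form pairing (A 3) ([y, z, unit] @ [x]))"
    using cyc xyz(1) unfolding cyclic_cochain_def by (metis length_Cons list.size(3) numeral_3_eq_3)
  moreover have "A 3 [y, z, unit] = 0" using norm by (simp add: normalized_cochain_def)
  ultimately show ?thesis by (simp add: cyclic_form_def pairing_trace unit_right)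
qed

lemma cyclic_isotopy_criterion:
  assumes A1: "minimal_unital_cyclic_enhancement scale H mul unit pairing A1"
    and A2: "minimal_unital_cyclic_enhancement scale H mul unit pairing A2"
  shows "(\<exists>g\<in>cyclic_harrison scale H pairing 2 (-1). (\<lambda>xs. A1 3 xs - A2 3 xs) = harrison_d H mul 2 (-1) g)
    \<longleftrightarrow> (\<exists>g\<in>harrison scale H 2 (-1). (\<lambda>xs. A1 3 xs - A2 3 xs) = harrison_d H mul 2 (-1) g)"
proof
  assume "\<exists>g\<in>harrison scale H 2 (-1). (\<lambda>xs. A1 3 xs - A2 3 xs) = harrison_d H mul 2 (-1) g"
  then obtain g where g: "g \<in> harrison scale H 2 (-1)"
    and eq: "(\<lambda>xs. A1 3 xs - A2 3 xs) = harrison_d H mul 2 (-1) g" by blast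
  have "trace (harrison_d H mul 2 (-1) g [x, y, z]) = 0"
    if "x \<in> H a" "y \<in> H b" "z \<in> H c" for x y z a b c
    unfolding eq[symmetric] using trace_m3[OF A1 that] trace_m3[OF A2 that] by (simp add: trace_diff)
  from cyclic_representative[OF g] this
  have "\<exists>g'\<in>harrison scale H 2 (-1). cyclic_cochain H pairing 2 g' \<and>
    harrison_d H mul 2 (-1) g' = harrison_d H mul 2 (-1) g" by simp
  then show "\<exists>g\<in>cyclic_harrison scale H pairing 2 (-1). (\<lambda>xs. A1 3 xs - A2 3 xs) = harrison_d H mul 2 (-1) g"
    unfolding eq by (auto simp: cyclic_harrison_def)
qed (auto simp: cyclic_harrison_def)

end

theorem proposition4p10:
  fixes scale :: "'k::field_char_0 \<Rightarrow> 'v::ab_group_add \<Rightarrow> 'v"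
    and H :: "int \<Rightarrow> 'v set"
    and mul :: "'v \<Rightarrow> 'v \<Rightarrow> 'v"
    and A1 A2 :: "nat \<Rightarrow> 'v list \<Rightarrow> 'v"
  assumes "finite_dim_gca scale H mul"
    and "minimal_enhancement scale H mul A1"
    and "minimal_enhancement scale H mul A2"
  shows "(isotopic_mod scale H 3 A1 A2 \<longleftrightarrow>
            harrison_class scale H mul 3 (-1) (A1 3) = harrison_class scale H mul 3 (-1) (A2 3)) \<and>
         (\<forall>(n::nat) unit (integ :: 'v \<Rightarrow> 'k).
            let pairing = poincare_pairing H mul n integ in
            poincare_gca scale H mul n unit integ \<longrightarrow>
            minimal_unital_cyclic_enhancement scale H mul unit pairing A1 \<longrightarrow>
            minimal_unital_cyclic_enhancement scale H mul unit pairing A2 \<longrightarrow>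
            (isotopic_mod scale H 3 A1 A2 \<longleftrightarrow>
               HC_class scale H mul pairing 4 (-1) (cyclic_form pairing (A1 3)) =
               HC_class scale H mul pairing 4 (-1) (cyclic_form pairing (A2 3))))"
proof -
  interpret finite_dim_gca scale H mul by fact
  note iso = isotopic_mod_3_iff[OF assms(2,3)]
  show ?thesis
    unfolding Let_def
  proof (intro conjI allI impI)
    show "isotopic_mod scale H 3 A1 A2 \<longleftrightarrow>
        harrison_class scale H mul 3 (-1) (A1 3) = harrison_class scale H mul 3 (-1) (A2 3)"
      by (simp only: iso harrison_class_iff[OF assms(2,3)])
  next
    fix n unit and integ :: "'v \<Rightarrow> 'k"
    let ?p = "poincare_pairing H mul n integ"
    assume P: "poincare_gca scale H mul n unit integ"
      and A: "minimal_unital_cyclic_enhancement scale H mul unit ?p A1"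
        "minimal_unital_cyclic_enhancement scale H mul unit ?p A2"
    show "isotopic_mod scale H 3 A1 A2 \<longleftrightarrow>
        HC_class scale H mul ?p 4 (-1) (cyclic_form ?p (A1 3)) =
        HC_class scale H mul ?p 4 (-1) (cyclic_form ?p (A2 3))"
      by (simp only: iso poincare_gca.HC_class_iff[OF P A] poincare_gca.cyclic_isotopy_criterion[OF P A])
  qed
qed

end
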